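(* For all integers $n,k\ge1$ and every $\rho\in[0,1]$ there exists an optimally stable function $f:\mathbb{R}^n\to B^k$ with parameter $\rho$. Moreover, if $k\le n$ and $\rho\in(0,1)$, then for every optimally stable $f$ with parameter $\rho$ there exist an orthogonal $n\times n$ matrix $M$ and a measurable $h:\mathbb{R}^k\to B^k$ such that $f(x)=h\big((Mx)_1,\dots,(Mx)_k\big)$ for almost every $x\in\mathbb{R}^n$.
   Context: $\gamma$ is the standard Gaussian measure on $\mathbb{R}^n$ and $\mathbf{x}\sim_\rho\mathbf{y}$ means $(\mathbf{x},\mathbf{y})\sim\mathcal N\big(0,\begin{bmatrix}I_n&\rho I_n\\\rho I_n&I_n\end{bmatrix}\big)$. A measurable $f:\mathbb{R}^n\to B^k$ (closed unit ball of $\mathbb{R}^k$) is optimally stable with parameter $\rho\in[0,1]$ if $\mathbb{E}_{\mathbf{x}\sim\gamma}[f(\mathbf{x})]=0$ and $\mathbb{E}_{\mathbf{x}\sim_\rho\mathbf{y}}\langle f(\mathbf{x}),f(\mathbf{y})\rangle$ is maximal among all measurable $g:\mathbb{R}^n\to B^k$ with $\mathbb{E}_\gamma[g]=0$. *)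

theory Defs
  imports "HOL-Probability.Probability"
begin

text \<open>Vectors of R^n are represented as extensional functions in
  PiE {..<n} (\<lambda>_. UNIV) :: (nat \<Rightarrow> real) set; coordinates are 0,...,n-1.\<close>

definition gauss :: "nat \<Rightarrow> (nat \<Rightarrow> real) measure" where
  "gauss n = PiM {..<n} (\<lambda>_. density lborel std_normal_density)"

text \<open>Law of a rho-correlated pair (x,y): x, z independent standard Gaussians
  and y = rho x + sqrt(1 - rho^2) z; this is exactly the centred Gaussian with
  covariance [[I, rho I],[rho I, I]].\<close>
definition corr_gauss :: "nat \<Rightarrow> real \<Rightarrow> ((nat \<Rightarrow> real) \<times> (nat \<Rightarrow> real)) measure" where
  "corr_gauss n \<rho> = distr (gauss n \<Otimes>\<^sub>M gauss n)
      (PiM {..<n} (\<lambda>_. borel) \<Otimes>\<^sub>M PiM {..<n} (\<lambda>_. borel))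
      (\<lambda>(x, z). (x, \<lambda>i\<in>{..<n}. \<rho> * x i + sqrt (1 - \<rho>\<^sup>2) * z i))"

definition inner_k :: "nat \<Rightarrow> (nat \<Rightarrow> real) \<Rightarrow> (nat \<Rightarrow> real) \<Rightarrow> real" where
  "inner_k k u v = (\<Sum>i<k. u i * v i)"

definition ball_valued :: "nat \<Rightarrow> nat \<Rightarrow> ((nat \<Rightarrow> real) \<Rightarrow> (nat \<Rightarrow> real)) \<Rightarrow> bool" where
  "ball_valued n k f \<longleftrightarrow>
     f \<in> measurable (PiM {..<n} (\<lambda>_. borel)) (PiM {..<k} (\<lambda>_. borel)) \<and>
     (\<forall>x \<in> space (PiM {..<n} (\<lambda>_. borel)). inner_k k (f x) (f x) \<le> 1)"

definition mean_zero :: "nat \<Rightarrow> nat \<Rightarrow> ((nat \<Rightarrow> real) \<Rightarrow> (nat \<Rightarrow> real)) \<Rightarrow> bool" where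
  "mean_zero n k f \<longleftrightarrow> (\<forall>i<k. (\<integral>x. f x i \<partial>gauss n) = 0)"

definition noise_stability :: "nat \<Rightarrow> nat \<Rightarrow> real \<Rightarrow> ((nat \<Rightarrow> real) \<Rightarrow> (nat \<Rightarrow> real)) \<Rightarrow> real" where
  "noise_stability n k \<rho> f = (\<integral>p. inner_k k (f (fst p)) (f (snd p)) \<partial>corr_gauss n \<rho>)"

definition optimally_stable :: "nat \<Rightarrow> nat \<Rightarrow> real \<Rightarrow> ((nat \<Rightarrow> real) \<Rightarrow> (nat \<Rightarrow> real)) \<Rightarrow> bool" where
  "optimally_stable n k \<rho> f \<longleftrightarrow>
     ball_valued n k f \<and> mean_zero n k f \<and>
     (\<forall>g. ball_valued n k g \<and> mean_zero n k g \<longrightarrow>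
          noise_stability n k \<rho> g \<le> noise_stability n k \<rho> f)"

definition orthogonal_mat :: "nat \<Rightarrow> (nat \<Rightarrow> nat \<Rightarrow> real) \<Rightarrow> bool" where
  "orthogonal_mat n M \<longleftrightarrow>
     (\<forall>i<n. \<forall>j<n. (\<Sum>l<n. M l i * M l j) = (if i = j then 1 else 0))"

definition proj_mat :: "nat \<Rightarrow> nat \<Rightarrow> (nat \<Rightarrow> nat \<Rightarrow> real) \<Rightarrow> (nat \<Rightarrow> real) \<Rightarrow> (nat \<Rightarrow> real)" where
  "proj_mat n k M x = (\<lambda>i\<in>{..<k}. \<Sum>j<n. M i j * x j)"

end

theory Submission
  imports Defs "HOL-Real_Asymp.Real_Asymp"
begin

text \<open>Let \<open>T\<close> be the Ornstein--Uhlenbeck operator with parameter \<open>\<rho>\<close>, so that the noise stability of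
  \<open>f\<close> is the positive definite quadratic form \<open>S f = \<langle>T f, f\<rangle>\<close>. For bounded \<open>G\<close>, the linear functional
  \<open>\<langle>G, u\<rangle>\<close> is maximized over mean-zero ball-valued \<open>u\<close> by \<open>u = (G - \<nu>) / |G - \<nu>|\<close>, constant on
  \<open>{G = \<nu>}\<close>, where \<open>\<nu>\<close> minimizes the expectation of \<open>|G - \<nu>|\<close>.

  Existence: along a maximizing sequence \<open>f\<^sub>j\<close> a subsequence of \<open>T f\<^sub>j\<close> converges pointwise to some \<open>G\<close> by
  equicontinuity, and convexity of \<open>S\<close> shows that the maximizer of \<open>\<langle>G, \<cdot>\<rangle>\<close> is optimal.

  Dimension reduction: by strict convexity an optimal \<open>f\<close> agrees almost everywhere with the maximizer \<open>u\<close> for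
  \<open>G = T f\<close>, so it is a function of \<open>N = T f - \<lambda>\<close>. The directions \<open>w\<close> for which the expectation of
  \<open>f(x) \<langle>x, w\<rangle>\<close> vanishes have codimension at most \<open>k\<close>. For such \<open>w\<close> the translates
  \<open>u\<^sub>t = u(\<cdot> + t w)\<close> have mean \<open>O(t\<^sup>2)\<close>, and \<open>T u\<^sub>t\<close> is \<open>T u\<close> translated by \<open>t w / \<rho>\<close>.
  The function \<open>F(s, t) = \<langle>u(\<cdot> + s w), N(\<cdot> + t w)\<rangle>\<close> is smooth by the Cameron--Martin formula and satisfies
  \<open>F(s, t) \<le> F(t, t)\<close>; comparing \<open>S u\<close> with a mean-zero competitor built from \<open>u\<^sub>t\<close> then gives, to second
  order, \<open>(1/\<rho> - 1) c \<le> 0\<close> with \<open>c \<ge> 0\<close>. Hence \<open>c = 0\<close>, so \<open>S (u\<^sub>t - u) = o(t\<^sup>2)\<close>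
  and \<open>N\<close> is invariant under translation by \<open>w\<close>.\<close>

section \<open>The one-dimensional Gaussian measure\<close>

text \<open>The translate \<open>u_t\<close> is not an admissible competitor, since its mean need
  not vanish. The competitor is instead the maximizer of the linear functional given by
  \<open>T u_t\<close>, and passing to it costs the scalar product of its multiplier
  \<open>\<nu>\<close> with the mean of \<open>u_t\<close>. That mean is only \<open>O(t^2)\<close>,
  the very order of the terms being compared, so the multiplier must itself tend to
  \<open>0\<close>; this is why the minimizer of the expectation of \<open>|N - \<nu>|\<close> has
  to be unique. Nothing is known about the regularity of \<open>u\<close>, so no derivative of
  \<open>u\<close> is ever taken: all translations are moved onto the Gaussian density. Null sets
  are settled by two devices. The maximizer \<open>u\<close> is constructed at every point, and
  \<open>T\<close> turns equality almost everywhere into equality everywhere. The final invariance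
  of \<open>N\<close> is therefore exact, and \<open>h\<close> can be taken as \<open>u\<close>
  composed with a linear embedding.\<close>

abbreviation std_gauss :: "real measure" where
  "std_gauss \<equiv> density lborel std_normal_density"

interpretation std_gauss: prob_space std_gauss
  by (rule prob_space_normal_density) simp

text \<open>The map is an orthogonal involution of the plane and the joint density depends on
  \<open>x^2 + y^2\<close> only. Invariance follows from Fubini and two affine substitutions in one
  variable, whose factors \<open>1 / a\<close> and \<open>a\<close> cancel in absolute value. A
  reflection is used because it is its own inverse, which later exchanges the two members of a
  correlated pair.\<close>

lemma std_gauss_rotation:
  assumes ab: "a\<^sup>2 + b\<^sup>2 = 1" and a: "a \<noteq> 0"
  shows "distr (std_gauss \<Otimes>\<^sub>M std_gauss) (std_gauss \<Otimes>\<^sub>M std_gauss)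
      (\<lambda>p. (a * fst p + b * snd p, b * fst p - a * snd p)) = std_gauss \<Otimes>\<^sub>M std_gauss"
  (is "distr ?P ?P ?R = ?P")
proof -
  let ?L = "lborel \<Otimes>\<^sub>M lborel :: (real \<times> real) measure"
  let ?d = "\<lambda>p. ennreal (std_normal_density (fst p)) * ennreal (std_normal_density (snd p))"
  have sfl: "sigma_finite_measure std_gauss" by unfold_locales
  have P: "?P = density ?L ?d"
    by (subst pair_measure_density) (auto simp: sfl case_prod_beta' lborel.sigma_finite_measure_axioms)
  have dmul: "std_normal_density x * std_normal_density y
      = (1 / (2 * pi)) * exp (- (x\<^sup>2 + y\<^sup>2) / 2)" for x y :: real
    by (simp add: std_normal_density_def add_divide_distrib exp_add[symmetric] algebra_simps
        real_sqrt_mult[symmetric])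
  have main: "(\<integral>\<^sup>+p. g (?R p) \<partial>?P) = (\<integral>\<^sup>+p. g p \<partial>?P)"
    if [measurable]: "g \<in> borel_measurable (borel \<Otimes>\<^sub>M borel)" for g :: "real \<times> real \<Rightarrow> ennreal"
  proof -
    define D where "D x y = ennreal ((1 / (2 * pi)) * exp (- (x\<^sup>2 + y\<^sup>2) / 2))" for x y :: real
    have D: "?d (x, y) = D x y" for x y
      by (simp add: D_def ennreal_mult[symmetric] dmul)
    have [measurable]: "(\<lambda>p. D (f p) (h p)) \<in> borel_measurable M"
      if [measurable]: "f \<in> borel_measurable M" "h \<in> borel_measurable M"
      for f h and M :: "'z measure"
      unfolding D_def by measurable
    have sqid: "(a * u + b * v)\<^sup>2 + (b * u - a * v)\<^sup>2 = u\<^sup>2 + v\<^sup>2" for u v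
    proof -
      have "(a * u + b * v)\<^sup>2 + (b * u - a * v)\<^sup>2 = (a\<^sup>2 + b\<^sup>2) * (u\<^sup>2 + v\<^sup>2)"
        by (simp add: power2_eq_square algebra_simps)
      thus ?thesis using ab by simp
    qed
    have "(\<integral>\<^sup>+p. g (?R p) \<partial>?P) = (\<integral>\<^sup>+p. D (fst p) (snd p) * g (?R p) \<partial>?L)"
      unfolding P by (subst nn_integral_density) (auto simp: D[symmetric])
    also have "\<dots> = (\<integral>\<^sup>+z. \<integral>\<^sup>+x. D x z * g (a * x + b * z, b * x - a * z) \<partial>lborel \<partial>lborel)"
      by (subst lborel_pair.nn_integral_snd[symmetric]) auto
    \<comment> \<open>Substitution \<open>u = a x + b z\<close> in the inner integral with
      \<open>z\<close> fixed; then \<open>b x - a z = (b u - z) / a\<close> because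
      \<open>a^2 + b^2 = 1\<close>.\<close>
    also have "\<dots> = (\<integral>\<^sup>+z. \<integral>\<^sup>+u. ennreal \<bar>1 / a\<bar> * (D ((u - b * z) / a) z * g (u, (b * u - z) / a)) \<partial>lborel \<partial>lborel)"
    proof (rule nn_integral_cong)
      fix z :: real
      have e1: "a * ((u - b * z) / a) + b * z = u" for u using a by (simp add: field_simps)
      have e2: "b * ((u - b * z) / a) - a * z = (b * u - z) / a" for u
      proof -
        have "b * ((u - b * z) / a) - a * z = (b * u - (a\<^sup>2 + b\<^sup>2) * z) / a"
          using a by (simp add: field_simps power2_eq_square)
        thus ?thesis using ab by simp
      qed
      have e3: "- (b * z / a) + 1 / a * u = (u - b * z) / a" for u using a by (simp add: field_simps)
      have "(\<integral>\<^sup>+x. D x z * g (a * x + b * z, b * x - a * z) \<partial>lborel) =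
          ennreal \<bar>1 / a\<bar> * (\<integral>\<^sup>+u. D ((u - b * z) / a) z * g (u, (b * u - z) / a) \<partial>lborel)"
        using a by (subst nn_integral_real_affine[where c="1/a" and t="- (b * z / a)"])
            (simp, simp, simp only: e3 e1 e2)
      thus "(\<integral>\<^sup>+x. D x z * g (a * x + b * z, b * x - a * z) \<partial>lborel) =
          (\<integral>\<^sup>+u. ennreal \<bar>1 / a\<bar> * (D ((u - b * z) / a) z * g (u, (b * u - z) / a)) \<partial>lborel)"
        by (simp add: nn_integral_cmult)
    qed
    also have "\<dots> = (\<integral>\<^sup>+u. \<integral>\<^sup>+z. ennreal \<bar>1 / a\<bar> * (D ((u - b * z) / a) z * g (u, (b * u - z) / a)) \<partial>lborel \<partial>lborel)"
      by (subst lborel_pair.Fubini') auto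
    \<comment> \<open>Substitution \<open>z = b u - a v\<close> with \<open>u\<close> fixed. The
      second argument of \<open>g\<close> becomes \<open>v\<close>, and the arguments of
      \<open>D\<close> become a point of the same norm as \<open>(u, v)\<close>.\<close>
    also have "\<dots> = (\<integral>\<^sup>+u. \<integral>\<^sup>+v. D u v * g (u, v) \<partial>lborel \<partial>lborel)"
    proof (rule nn_integral_cong)
      fix u :: real
      have e1: "(b * u - (b * u + (- a) * v)) / a = v" for v using a by (simp add: field_simps)
      have e2: "(u - b * (b * u + (- a) * v)) / a = a * u + b * v" for v
      proof -
        have "u = (a\<^sup>2 + b\<^sup>2) * u" using ab by simp
        then have "u - b * (b * u + (- a) * v) = a * (a * u + b * v)"
          by (simp add: power2_eq_square algebra_simps)
        thus ?thesis using a by simp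
      qed
      have e3: "D (a * u + b * v) (b * u + (- a) * v) = D u v" for v
        using sqid[of u v] by (simp add: D_def)
      have "(\<integral>\<^sup>+z. ennreal \<bar>1 / a\<bar> * (D ((u - b * z) / a) z * g (u, (b * u - z) / a)) \<partial>lborel)
        = ennreal \<bar>a\<bar> * (\<integral>\<^sup>+v. ennreal \<bar>1 / a\<bar> * (D u v * g (u, v)) \<partial>lborel)"
        using a by (subst nn_integral_real_affine[where c="-a" and t="b * u"])
            (simp, simp, simp only: e1 e2 e3 abs_minus_cancel)
      also have "\<dots> = (\<integral>\<^sup>+v. D u v * g (u, v) \<partial>lborel)"
        using a by (subst nn_integral_cmult) (auto simp: mult.assoc[symmetric] ennreal_mult[symmetric] abs_mult[symmetric])
      finally show "(\<integral>\<^sup>+z. ennreal \<bar>1 / a\<bar> * (D ((u - b * z) / a) z * g (u, (b * u - z) / a)) \<partial>lborel)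
        = (\<integral>\<^sup>+v. D u v * g (u, v) \<partial>lborel)" .
    qed
    also have "\<dots> = (\<integral>\<^sup>+p. D (fst p) (snd p) * g p \<partial>?L)"
      by (subst lborel.nn_integral_fst[symmetric]) auto
    also have "\<dots> = (\<integral>\<^sup>+p. g p \<partial>?P)"
      unfolding P by (subst nn_integral_density) (auto simp: D[symmetric])
    finally show ?thesis .
  qed
  have setsP: "sets ?P = sets (borel \<Otimes>\<^sub>M borel)" by (auto intro!: sets_pair_measure_cong)
  show ?thesis
  proof (rule measure_eqI)
    fix A assume "A \<in> sets (distr ?P ?P ?R)"
    then have A: "A \<in> sets ?P" by simp
    then have A'[measurable]: "A \<in> sets (borel \<Otimes>\<^sub>M borel)" by (simp add: setsP)
    have R: "?R \<in> measurable ?P ?P" 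
      using measurable_cong_sets[OF setsP setsP] by simp
    have "emeasure (distr ?P ?P ?R) A = (\<integral>\<^sup>+p. indicator A p \<partial>distr ?P ?P ?R)" using A by simp
    also have "\<dots> = (\<integral>\<^sup>+p. indicator A (?R p) \<partial>?P)"
      using R A by (subst nn_integral_distr) auto
    also have "\<dots> = (\<integral>\<^sup>+p. indicator A p \<partial>?P)"
      by (rule main) measurable
    finally show "emeasure (distr ?P ?P ?R) A = emeasure ?P A" using A by simp
  qed simp
qed

text \<open>Completing the square: the Cameron-Martin formula on the line.\<close>

lemma std_gauss_shift:
  "distr std_gauss std_gauss (\<lambda>x. x + c) = density std_gauss (\<lambda>x. ennreal (exp (c * x - c\<^sup>2 / 2)))"
proof (rule measure_eqI)
  fix A assume "A \<in> sets (distr std_gauss std_gauss (\<lambda>x. x + c))"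
  then have A[measurable]: "A \<in> sets borel" by simp
  have "emeasure (distr std_gauss std_gauss (\<lambda>x. x + c)) A
      = (\<integral>\<^sup>+x. ennreal (std_normal_density x) * indicator A (x + c) \<partial>lborel)"
    by (subst nn_integral_indicator[symmetric], simp)
      (subst nn_integral_distr, auto simp: nn_integral_density)
  also have "\<dots> = (\<integral>\<^sup>+x. ennreal (std_normal_density (-c + x)) * indicator A x \<partial>lborel)"
    by (subst nn_integral_real_affine[where c=1 and t="-c"]) auto
  also have "\<dots> = (\<integral>\<^sup>+x. ennreal (std_normal_density x) * (ennreal (exp (c * x - c\<^sup>2 / 2)) * indicator A x) \<partial>lborel)"
  proof (rule nn_integral_cong)
    fix x
    have "std_normal_density (-c + x) = std_normal_density x * exp (c * x - c\<^sup>2 / 2)"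
      by (simp add: std_normal_density_def exp_add[symmetric] power2_eq_square field_simps exp_diff[symmetric])
    then show "ennreal (std_normal_density (-c + x)) * indicator A x
      = ennreal (std_normal_density x) * (ennreal (exp (c * x - c\<^sup>2 / 2)) * indicator A x)"
      by (simp add: ennreal_mult mult.assoc)
  qed
  also have "\<dots> = emeasure (density std_gauss (\<lambda>x. ennreal (exp (c * x - c\<^sup>2 / 2)))) A"
    by (simp add: emeasure_density nn_integral_density)
  finally show "emeasure (distr std_gauss std_gauss (\<lambda>x. x + c)) A =
    emeasure (density std_gauss (\<lambda>x. ennreal (exp (c * x - c\<^sup>2 / 2)))) A" .
qed simp

section \<open>Rotations and translations of the Gaussian measure\<close>

abbreviation borel_vec :: "nat \<Rightarrow> (nat \<Rightarrow> real) measure" where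
  "borel_vec n \<equiv> PiM {..<n} (\<lambda>_. borel)"

abbreviation vecs :: "nat \<Rightarrow> (nat \<Rightarrow> real) set" where
  "vecs n \<equiv> PiE {..<n} (\<lambda>_. UNIV)"

abbreviation gauss_sq :: "nat \<Rightarrow> ((nat \<Rightarrow> real) \<times> (nat \<Rightarrow> real)) measure" where
  "gauss_sq n \<equiv> gauss n \<Otimes>\<^sub>M gauss n"

interpretation std_gauss_prod: product_sigma_finite "\<lambda>_::nat. std_gauss"
  by unfold_locales

lemma sets_gauss [simp, measurable_cong]: "sets (gauss n) = sets (borel_vec n)"
  unfolding gauss_def by (intro sets_PiM_cong) auto

lemma space_gauss [simp]: "space (gauss n) = vecs n"
  unfolding gauss_def by (simp add: space_PiM)

lemma space_borel_vec [simp]: "space (borel_vec n) = vecs n"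
  by (simp add: space_PiM)

interpretation gauss: prob_space "gauss n" for n
  unfolding gauss_def by (rule prob_space_PiM) unfold_locales

interpretation gauss2: pair_prob_space "gauss n" "gauss m" for n m
  by unfold_locales

section \<open>Linear combinations of vectors, and measures determined by boxes\<close>

definition lincomb :: "nat \<Rightarrow> real \<Rightarrow> real \<Rightarrow> (nat \<Rightarrow> real) \<Rightarrow> (nat \<Rightarrow> real) \<Rightarrow> (nat \<Rightarrow> real)" where
  "lincomb n a b x z = (\<lambda>i\<in>{..<n}. a * x i + b * z i)"

lemma lincomb_nth [simp]: "i < n \<Longrightarrow> lincomb n a b x z i = a * x i + b * z i"
  by (simp add: lincomb_def)

lemma lincomb_in_space [simp, intro]: "lincomb n a b x z \<in> vecs n"
  by (simp add: lincomb_def)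

lemma vec_eqI:
  assumes "x \<in> vecs n" "y \<in> vecs n" "\<And>i. i < n \<Longrightarrow> x i = y i"
  shows "x = (y :: nat \<Rightarrow> real)"
  using assms by (intro PiE_ext) auto

lemma measurable_nth:
  assumes "f \<in> measurable M (borel_vec n)" "i < n"
  shows "(\<lambda>p. f p i) \<in> borel_measurable M"
  using assms by (intro measurable_compose[OF assms(1)] measurable_component_singleton) auto

lemma measurable_lincomb [measurable (raw)]:
  assumes "f \<in> measurable M (borel_vec n)" "g \<in> measurable M (borel_vec n)"
  shows "(\<lambda>p. lincomb n a b (f p) (g p)) \<in> measurable M (borel_vec n)"
  unfolding lincomb_def using assms by (intro measurable_restrict) (auto intro!: measurable_nth borel_measurable_add borel_measurable_times)

lemma measurable_inner_k [measurable (raw)]: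
  assumes "f \<in> measurable M (borel_vec n)" "g \<in> measurable M (borel_vec n)"
  shows "(\<lambda>p. inner_k n (f p) (g p)) \<in> borel_measurable M"
  unfolding inner_k_def using assms
  by (intro borel_measurable_sum borel_measurable_times) (auto intro: measurable_nth)

lemma borel_vec_measure_eqI:
  assumes "sets P = sets (borel_vec n)" "sets Q = sets (borel_vec n)" "finite_measure P"
    and "\<And>A. (\<And>i. i < n \<Longrightarrow> A i \<in> sets borel) \<Longrightarrow> emeasure P (PiE {..<n} A) = emeasure Q (PiE {..<n} A)"
  shows "P = Q"
proof (rule measure_eqI_PiM_finite[of "{..<n}" P "\<lambda>_. borel" Q "\<lambda>_. vecs n"])
  have "vecs n \<in> prod_algebra {..<n} (\<lambda>_. borel :: real measure)"
    by (rule prod_algebraI_finite) auto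
  then show "range (\<lambda>_::nat. vecs n) \<subseteq> prod_algebra {..<n} (\<lambda>_. borel :: real measure)"
    by auto
  show "emeasure P (vecs n) \<noteq> \<infinity>" for i :: nat
    using assms(3) finite_measure.emeasure_finite by auto
qed (use assms in auto)

lemma emeasure_gauss_box:
  assumes "\<And>i. i < n \<Longrightarrow> A i \<in> sets borel"
  shows "emeasure (gauss n) (PiE {..<n} A) = (\<Prod>i<n. emeasure std_gauss (A i))"
  unfolding gauss_def using assms by (subst std_gauss_prod.emeasure_PiM) auto

lemma sets_box [measurable]:
  assumes "\<And>i. i < n \<Longrightarrow> A i \<in> sets borel"
  shows "PiE {..<n} A \<in> sets (borel_vec n)"
  using assms by (intro sets_PiM_I_finite) auto

text \<open>Boxes generate each factor, so the extension to all measurable rectangles goes one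
  factor at a time. For a fixed box \<open>B\<close>, the set function
  \<open>P (A \<times> B)\<close> of \<open>A\<close> is a finite measure determined by boxes; then
  \<open>A\<close> is fixed and \<open>B\<close> varies.\<close>

lemma gauss_pair_eqI:
  assumes sets: "sets P = sets (gauss_sq n)" and fin: "finite_measure P"
    and eq: "\<And>A B. (\<And>i. i < n \<Longrightarrow> A i \<in> sets borel) \<Longrightarrow> (\<And>i. i < n \<Longrightarrow> B i \<in> sets borel) \<Longrightarrow>
      emeasure P (PiE {..<n} A \<times> PiE {..<n} B)
      = (\<Prod>i<n. emeasure std_gauss (A i)) * (\<Prod>i<n. emeasure std_gauss (B i))"
  shows "gauss_sq n = P"
proof -
  interpret P: finite_measure P by fact
  note [measurable_cong] = sets
  have sp: "space P = vecs n \<times> vecs n"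
    using sets_eq_imp_space_eq[OF sets] by (simp add: space_pair_measure)
  have fst_eq: "emeasure P (A \<times> B) = emeasure (gauss n) A * emeasure (gauss n) B"
    if A: "A \<in> sets (borel_vec n)" and B: "B = PiE {..<n} B'" "\<And>i. i < n \<Longrightarrow> B' i \<in> sets borel" for A B B'
  proof -
    have Bm[measurable]: "B \<in> sets (borel_vec n)" using B by simp
    let ?Q = "distr (density P (\<lambda>p. indicator B (snd p))) (borel_vec n) fst"
    have Q: "emeasure ?Q A = emeasure P (A \<times> B)" if [measurable]: "A \<in> sets (borel_vec n)" for A
    proof -
      have "A \<subseteq> vecs n" "B \<subseteq> vecs n" 
        using sets.sets_into_space[OF that] sets.sets_into_space[OF Bm] by auto
      then have "emeasure ?Q A = (\<integral>\<^sup>+p. indicator (A \<times> B) p \<partial>P)"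
        by (subst emeasure_distr, simp, simp, subst emeasure_density, measurable,
            intro nn_integral_cong) (auto simp: sp split: split_indicator)
      then show ?thesis using sets by simp
    qed
    have "?Q = density (gauss n) (\<lambda>_. emeasure (gauss n) B)"
    proof (rule borel_vec_measure_eqI)
      show "finite_measure ?Q"
        using Q[of "space (borel_vec n)"] by (intro finite_measureI) (simp)
      fix A' :: "nat \<Rightarrow> real set" assume A': "\<And>i. i < n \<Longrightarrow> A' i \<in> sets borel"
      show "emeasure ?Q (PiE {..<n} A') = emeasure (density (gauss n) (\<lambda>_. emeasure (gauss n) B)) (PiE {..<n} A')"
        using A' B by (subst Q) (simp_all add: eq emeasure_density_const emeasure_gauss_box mult.commute)
    qed auto
    then have "emeasure ?Q A = emeasure (density (gauss n) (\<lambda>_. emeasure (gauss n) B)) A" by simp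
    then show ?thesis using A by (simp add: Q emeasure_density_const mult.commute)
  qed
  have "emeasure P (A \<times> B) = emeasure (gauss n) A * emeasure (gauss n) B"
    if A[measurable]: "A \<in> sets (borel_vec n)" and B: "B \<in> sets (borel_vec n)" for A B
  proof -
    let ?Q = "distr (density P (\<lambda>p. indicator A (fst p))) (borel_vec n) snd"
    have Q: "emeasure ?Q B = emeasure P (A \<times> B)" if [measurable]: "B \<in> sets (borel_vec n)" for B
    proof -
      have "A \<subseteq> vecs n" "B \<subseteq> vecs n" 
        using sets.sets_into_space[OF that] sets.sets_into_space[OF A] by auto
      then have "emeasure ?Q B = (\<integral>\<^sup>+p. indicator (A \<times> B) p \<partial>P)"
        by (subst emeasure_distr, simp, simp, subst emeasure_density, measurable,
            intro nn_integral_cong) (auto simp: sp split: split_indicator)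
      then show ?thesis using sets by simp
    qed
    have "?Q = density (gauss n) (\<lambda>_. emeasure (gauss n) A)"
    proof (rule borel_vec_measure_eqI)
      show "finite_measure ?Q"
        using Q[of "space (borel_vec n)"] by (intro finite_measureI) (simp)
      fix B' :: "nat \<Rightarrow> real set" assume B': "\<And>i. i < n \<Longrightarrow> B' i \<in> sets borel"
      show "emeasure ?Q (PiE {..<n} B') = emeasure (density (gauss n) (\<lambda>_. emeasure (gauss n) A)) (PiE {..<n} B')"
        using B' by (subst Q) (simp_all add: fst_eq[OF A refl] emeasure_density_const)
    qed auto
    then have "emeasure ?Q B = emeasure (density (gauss n) (\<lambda>_. emeasure (gauss n) A)) B" by simp
    then show ?thesis using B by (simp add: Q emeasure_density_const)
  qed
  then show ?thesis
    by (intro pair_measure_eqI) (auto simp: sets gauss.sigma_finite_measure_axioms)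
qed

lemma measurable_unzip:
  "(\<lambda>w. (\<lambda>i\<in>{..<n}. fst (w i), \<lambda>i\<in>{..<n}. snd (w i)))
    \<in> measurable (PiM {..<n} (\<lambda>_. std_gauss \<Otimes>\<^sub>M std_gauss)) (gauss_sq n)"
proof -
  have "(\<lambda>w. \<lambda>i\<in>{..<n}. fst (w i)) \<in> measurable (PiM {..<n} (\<lambda>_. std_gauss \<Otimes>\<^sub>M std_gauss)) (borel_vec n)"
    "(\<lambda>w. \<lambda>i\<in>{..<n}. snd (w i)) \<in> measurable (PiM {..<n} (\<lambda>_. std_gauss \<Otimes>\<^sub>M std_gauss)) (borel_vec n)"
    by (auto intro!: measurable_restrict measurable_compose[OF measurable_component_singleton])
  then show ?thesis by (intro measurable_Pair) simp_all
qed

text \<open>Regrouping of \<open>2 n\<close> independent coordinates: a vector of Gaussian pairs is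
  a pair of Gaussian vectors. It lifts facts about one pair of coordinates to pairs of
  vectors.\<close>

lemma gauss_pair_unzip:
  "gauss_sq n = distr (PiM {..<n} (\<lambda>_. std_gauss \<Otimes>\<^sub>M std_gauss)) (gauss_sq n)
     (\<lambda>w. (\<lambda>i\<in>{..<n}. fst (w i), \<lambda>i\<in>{..<n}. snd (w i)))"
  (is "_ = distr ?P _ ?U")
proof -
  interpret sg2: pair_prob_space std_gauss std_gauss by unfold_locales
  interpret PP: product_sigma_finite "\<lambda>_::nat. std_gauss \<Otimes>\<^sub>M std_gauss" by unfold_locales
  interpret Q: prob_space ?P by (rule prob_space_PiM) unfold_locales
  note U[measurable] = measurable_unzip[of n]
  show ?thesis
  proof (rule gauss_pair_eqI)
    show "finite_measure (distr ?P (gauss_sq n) ?U)"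
      by (rule prob_space.finite_measure[OF Q.prob_space_distr[OF U]])
    fix A B :: "nat \<Rightarrow> real set"
    assume A: "\<And>i. i < n \<Longrightarrow> A i \<in> sets borel" and B: "\<And>i. i < n \<Longrightarrow> B i \<in> sets borel"
    have "?U -` (PiE {..<n} A \<times> PiE {..<n} B) \<inter> space ?P = PiE {..<n} (\<lambda>i. A i \<times> B i)"
    proof (rule set_eqI)
      fix w
      have "w \<in> ?U -` (PiE {..<n} A \<times> PiE {..<n} B) \<longleftrightarrow> (\<forall>i<n. fst (w i) \<in> A i \<and> snd (w i) \<in> B i)"
        unfolding vimage_eq mem_Times_iff by (simp add: restrict_PiE_iff) blast
      moreover have "w \<in> space ?P \<longleftrightarrow> w \<in> extensional {..<n}"
        by (simp add: space_PiM space_pair_measure PiE_iff)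
      moreover have "w \<in> PiE {..<n} (\<lambda>i. A i \<times> B i) \<longleftrightarrow> w \<in> extensional {..<n} \<and> (\<forall>i<n. fst (w i) \<in> A i \<and> snd (w i) \<in> B i)"
        by (simp add: PiE_iff mem_Times_iff) blast
      ultimately show "w \<in> ?U -` (PiE {..<n} A \<times> PiE {..<n} B) \<inter> space ?P \<longleftrightarrow> w \<in> PiE {..<n} (\<lambda>i. A i \<times> B i)"
        by blast
    qed
    then have "emeasure (distr ?P (gauss_sq n) ?U) (PiE {..<n} A \<times> PiE {..<n} B)
        = emeasure ?P (PiE {..<n} (\<lambda>i. A i \<times> B i))"
      using A B by (subst emeasure_distr[OF U]) (simp_all add: pair_measureI)
    also have "\<dots> = (\<Prod>i<n. emeasure (std_gauss \<Otimes>\<^sub>M std_gauss) (A i \<times> B i))"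
      using A B by (subst PP.emeasure_PiM) auto
    also have "\<dots> = (\<Prod>i<n. emeasure std_gauss (A i)) * (\<Prod>i<n. emeasure std_gauss (B i))"
      using A B by (simp add: std_gauss.emeasure_pair_measure_Times prod.distrib)
    finally show "emeasure (distr ?P (gauss_sq n) ?U) (PiE {..<n} A \<times> PiE {..<n} B) = \<dots>" .
  qed simp
qed

text \<open>The planar reflection acts on each pair of coordinates separately. It commutes with the
  regrouping of pairs into two vectors, and a product of invariant measures is invariant.\<close>

lemma gauss_rotation:
  assumes ab: "a\<^sup>2 + b\<^sup>2 = 1" and a: "a \<noteq> 0"
  shows "distr (gauss_sq n) (gauss_sq n)
      (\<lambda>p. (lincomb n a b (fst p) (snd p), lincomb n b (-a) (fst p) (snd p))) = gauss_sq n"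
  (is "distr ?G ?G ?R = ?G")
proof -
  let ?s = "std_gauss \<Otimes>\<^sub>M std_gauss"
  let ?P = "PiM {..<n} (\<lambda>_. ?s)"
  let ?U = "\<lambda>w. (\<lambda>i\<in>{..<n}. fst (w i), \<lambda>i\<in>{..<n}. snd (w i))"
  let ?r = "\<lambda>p. (a * fst p + b * snd p, b * fst p - a * snd p)"
  interpret sg2: pair_prob_space std_gauss std_gauss by unfold_locales
  note U[measurable] = measurable_unzip[of n]
  have r: "?r \<in> measurable ?s ?s"
    by (rule measurable_Pair) auto
  have [measurable]: "?R \<in> measurable ?G ?G" by measurable
  have c[measurable]: "compose {..<n} ?r \<in> measurable ?P ?P"
    unfolding compose_def
    by (intro measurable_restrict measurable_compose[OF _ r] measurable_component_singleton)
  have "distr ?G ?G ?R = distr (distr ?P ?G ?U) ?G ?R"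
    using gauss_pair_unzip[of n] by simp
  also have "\<dots> = distr ?P ?G (?R \<circ> ?U)" by (subst distr_distr) auto
  also have "?R \<circ> ?U = ?U \<circ> compose {..<n} ?r"
    by (auto simp: fun_eq_iff lincomb_def compose_def)
  also have "distr ?P ?G \<dots> = distr (distr ?P ?P (compose {..<n} ?r)) ?G ?U"
    by (subst distr_distr) auto
  also have "distr ?P ?P (compose {..<n} ?r) = PiM {..<n} (\<lambda>_. distr ?s ?s ?r)"
    using r by (intro distr_PiM_finite_prob_space') (auto intro: sg2.prob_space_axioms)
  also have "distr ?s ?s ?r = ?s" by (rule std_gauss_rotation[OF ab a])
  finally show ?thesis unfolding gauss_pair_unzip[of n, symmetric] .
qed

section \<open>Translates of the Gaussian measure and the Cameron-Martin density\<close>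

definition tilt :: "nat \<Rightarrow> (nat \<Rightarrow> real) \<Rightarrow> (nat \<Rightarrow> real) \<Rightarrow> real" where
  "tilt n a x = exp (inner_k n a x - inner_k n a a / 2)"

lemma measurable_tilt [measurable]: "tilt n a \<in> borel_measurable (borel_vec n)"
  unfolding tilt_def inner_k_def by measurable

text \<open>Both measures are compared on boxes, where they split into one-dimensional
  factors.\<close>

lemma gauss_shift:
  "distr (gauss n) (gauss n) (\<lambda>x. lincomb n 1 1 x a) = density (gauss n) (\<lambda>x. ennreal (tilt n a x))"
proof (rule borel_vec_measure_eqI)
  have [measurable]: "(\<lambda>x. lincomb n 1 1 x a) \<in> measurable (borel_vec n) (borel_vec n)"
    unfolding lincomb_def by measurable
  show "finite_measure (distr (gauss n) (gauss n) (\<lambda>x. lincomb n 1 1 x a))"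
    by (rule prob_space.finite_measure[OF gauss.prob_space_distr]) measurable
  fix A :: "nat \<Rightarrow> real set" assume A[measurable]: "\<And>i. i < n \<Longrightarrow> A i \<in> sets borel"
  have "(\<lambda>x. lincomb n 1 1 x a) -` PiE {..<n} A \<inter> space (gauss n) = PiE {..<n} (\<lambda>i. (\<lambda>x. x + a i) -` A i)"
    by (auto simp: PiE_iff lincomb_def)
  then have "emeasure (distr (gauss n) (gauss n) (\<lambda>x. lincomb n 1 1 x a)) (PiE {..<n} A)
      = emeasure (gauss n) (PiE {..<n} (\<lambda>i. (\<lambda>x. x + a i) -` A i))"
    using A by (subst emeasure_distr) auto
  also have "\<dots> = (\<Prod>i<n. emeasure (distr std_gauss std_gauss (\<lambda>x. x + a i)) (A i))"
    using A by (subst emeasure_gauss_box) (auto simp: emeasure_distr intro!: measurable_sets_borel[OF _ A])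
  also have "\<dots> = (\<Prod>i<n. \<integral>\<^sup>+x. ennreal (exp (a i * x - (a i)\<^sup>2 / 2)) * indicator (A i) x \<partial>std_gauss)"
    unfolding std_gauss_shift using A by (intro prod.cong refl emeasure_density) auto
  also have "\<dots> = (\<integral>\<^sup>+x. (\<Prod>i<n. ennreal (exp (a i * x i - (a i)\<^sup>2 / 2)) * indicator (A i) (x i)) \<partial>gauss n)"
    unfolding gauss_def using A by (subst std_gauss_prod.product_nn_integral_prod) auto
  also have "\<dots> = (\<integral>\<^sup>+x. ennreal (tilt n a x) * indicator (PiE {..<n} A) x \<partial>gauss n)"
  proof (rule nn_integral_cong)
    fix x assume x: "x \<in> space (gauss n)"
    have "(\<Prod>i<n. ennreal (exp (a i * x i - (a i)\<^sup>2 / 2))) = ennreal (tilt n a x)"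
      by (simp add: prod_ennreal tilt_def inner_k_def exp_sum[symmetric] sum_subtractf sum_divide_distrib power2_eq_square)
    moreover have "(\<Prod>i<n. indicator (A i) (x i) :: ennreal) = indicator (PiE {..<n} A) x"
      using x by (auto simp: indicator_def PiE_iff prod_zero_iff)
    ultimately show "(\<Prod>i<n. ennreal (exp (a i * x i - (a i)\<^sup>2 / 2)) * indicator (A i) (x i))
        = ennreal (tilt n a x) * indicator (PiE {..<n} A) x"
      by (simp add: prod.distrib)
  qed
  also have "\<dots> = emeasure (density (gauss n) (\<lambda>x. ennreal (tilt n a x))) (PiE {..<n} A)"
    using A by (subst emeasure_density) auto
  finally show "emeasure (distr (gauss n) (gauss n) (\<lambda>x. lincomb n 1 1 x a)) (PiE {..<n} A) = \<dots>" .
qed auto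

section \<open>The Ornstein--Uhlenbeck operators\<close>

text \<open>A bound at every point, rather than membership in an \<open>L^2\<close> class, keeps all
  integrals finite without side conditions and lets the operators below be evaluated at each single
  point.\<close>

definition bdd_meas :: "nat \<Rightarrow> ((nat \<Rightarrow> real) \<Rightarrow> real) \<Rightarrow> bool" where
  "bdd_meas n \<phi> \<longleftrightarrow> \<phi> \<in> borel_measurable (borel_vec n) \<and>
     (\<exists>C. \<forall>x \<in> vecs n. \<bar>\<phi> x\<bar> \<le> C)"

lemma bdd_measI:
  "\<phi> \<in> borel_measurable (borel_vec n) \<Longrightarrow> (\<And>x. x \<in> vecs n \<Longrightarrow> \<bar>\<phi> x\<bar> \<le> C) \<Longrightarrow> bdd_meas n \<phi>"
  unfolding bdd_meas_def by blast

lemma bdd_meas_measurable: "bdd_meas n \<phi> \<Longrightarrow> \<phi> \<in> borel_measurable (borel_vec n)"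
  by (simp add: bdd_meas_def)

lemma bdd_measE:
  assumes "bdd_meas n \<phi>"
  obtains C where "C \<ge> 0" "\<And>x. x \<in> vecs n \<Longrightarrow> \<bar>\<phi> x\<bar> \<le> C"
proof -
  obtain C where "\<And>x. x \<in> vecs n \<Longrightarrow> \<bar>\<phi> x\<bar> \<le> C" using assms unfolding bdd_meas_def by blast
  then have "x \<in> vecs n \<Longrightarrow> \<bar>\<phi> x\<bar> \<le> max 0 C" for x by fastforce
  then show thesis using that[of "max 0 C"] by simp
qed

lemma bdd_meas_const [intro, simp]: "bdd_meas n (\<lambda>_. c)"
  by (rule bdd_measI) auto

lemma bdd_meas_add [intro]: 
  assumes "bdd_meas n \<phi>" "bdd_meas n \<psi>" shows "bdd_meas n (\<lambda>x. \<phi> x + \<psi> x)"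
proof -
  obtain C D where "\<And>x. x \<in> vecs n \<Longrightarrow> \<bar>\<phi> x\<bar> \<le> C" "\<And>x. x \<in> vecs n \<Longrightarrow> \<bar>\<psi> x\<bar> \<le> D"
    using assms bdd_measE by metis
  then show ?thesis using assms[THEN bdd_meas_measurable]
    by (intro bdd_measI[where C="C+D"]) (simp, meson abs_triangle_ineq add_mono order_trans)
qed

lemma bdd_meas_mult [intro]: 
  assumes "bdd_meas n \<phi>" "bdd_meas n \<psi>" shows "bdd_meas n (\<lambda>x. \<phi> x * \<psi> x)"
proof -
  obtain C D where "\<And>x. x \<in> vecs n \<Longrightarrow> \<bar>\<phi> x\<bar> \<le> C" "C \<ge> 0" "\<And>x. x \<in> vecs n \<Longrightarrow> \<bar>\<psi> x\<bar> \<le> D"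
    using assms bdd_measE by metis
  then show ?thesis using assms[THEN bdd_meas_measurable] by (intro bdd_measI[where C="C*D"]) (auto simp: abs_mult intro!: mult_mono)
qed

lemma bdd_meas_minus [intro]: "bdd_meas n \<phi> \<Longrightarrow> bdd_meas n (\<lambda>x. - \<phi> x)"
  using bdd_meas_mult[of n "\<lambda>_. -1" \<phi>] by simp

lemma bdd_meas_diff [intro]: "bdd_meas n \<phi> \<Longrightarrow> bdd_meas n \<psi> \<Longrightarrow> bdd_meas n (\<lambda>x. \<phi> x - \<psi> x)"
  using bdd_meas_add[of n \<phi> "\<lambda>x. - \<psi> x"] by auto

lemma bdd_meas_abs [intro]: "bdd_meas n \<phi> \<Longrightarrow> bdd_meas n (\<lambda>x. \<bar>\<phi> x\<bar>)"
  unfolding bdd_meas_def by auto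

lemma bdd_meas_sum [intro]: "(\<And>i. i \<in> I \<Longrightarrow> bdd_meas n (\<phi> i)) \<Longrightarrow> bdd_meas n (\<lambda>x. \<Sum>i\<in>I. \<phi> i x)"
  by (induction I rule: infinite_finite_induct) auto

lemma measurable_lincomb_left [measurable]: "(\<lambda>x. lincomb n a b x w) \<in> measurable (borel_vec n) (borel_vec n)"
  unfolding lincomb_def by measurable

lemma measurable_lincomb_right [measurable]: "(\<lambda>x. lincomb n a b w x) \<in> measurable (borel_vec n) (borel_vec n)"
  unfolding lincomb_def by measurable

lemma bdd_meas_shift [intro]:
  assumes "bdd_meas n \<phi>" shows "bdd_meas n (\<lambda>x. \<phi> (lincomb n a b x w))"
proof -
  obtain C where "\<And>x. x \<in> vecs n \<Longrightarrow> \<bar>\<phi> x\<bar> \<le> C" using assms bdd_measE by metis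
  then show ?thesis
    by (intro bdd_measI[where C=C] measurable_compose[OF measurable_lincomb_left bdd_meas_measurable[OF assms]]) auto
qed

lemma bdd_meas_integrable: 
  assumes "bdd_meas n \<phi>" shows "integrable (gauss n) \<phi>"
proof -
  obtain C where "\<And>x. x \<in> vecs n \<Longrightarrow> \<bar>\<phi> x\<bar> \<le> C" using assms bdd_measE by metis
  then show ?thesis using bdd_meas_measurable[OF assms]
    by (intro gauss.integrable_const_bound[where B=C]) (auto simp: measurable_cong_sets[OF sets_gauss refl])
qed

lemma integrable_gauss2:
  fixes g :: "_ \<Rightarrow> real"
  assumes [measurable]: "g \<in> borel_measurable (borel_vec n \<Otimes>\<^sub>M borel_vec n)"
    and "\<And>x z. x \<in> vecs n \<Longrightarrow> z \<in> vecs n \<Longrightarrow> \<bar>g (x, z)\<bar> \<le> C"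
  shows "integrable (gauss_sq n) g"
  using assms(2) by (intro gauss2.P.integrable_const_bound[where B=C]) (auto simp: space_pair_measure)

lemma integral_gauss_fst:
  assumes "bdd_meas n \<phi>"
  shows "(\<integral>p. \<phi> (fst p) \<partial>gauss_sq n) = (\<integral>x. \<phi> x \<partial>gauss n)"
proof -
  obtain C where C: "\<And>x. x \<in> vecs n \<Longrightarrow> \<bar>\<phi> x\<bar> \<le> C" using assms bdd_measE by metis
  have "integrable (gauss_sq n) (\<lambda>p. \<phi> (fst p))"
    using C by (intro integrable_gauss2[where C=C] measurable_compose[OF measurable_fst bdd_meas_measurable[OF assms]]) auto
  from gauss2.integral_fst'[OF this] show ?thesis using gauss.prob_space[of n] by simp
qed

lemma lincomb_rotate:
  assumes "a\<^sup>2 + b\<^sup>2 = 1" "x \<in> vecs n"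
  shows "lincomb n a b (lincomb n a b x z) (lincomb n b (-a) x z) = x"
proof (rule vec_eqI)
  fix i assume "i < n"
  have "a * (a * x i + b * z i) + b * (b * x i + (-a) * z i) = (a\<^sup>2 + b\<^sup>2) * x i"
    by (simp add: power2_eq_square algebra_simps)
  then show "lincomb n a b (lincomb n a b x z) (lincomb n b (-a) x z) i = x i"
    using assms \<open>i < n\<close> by simp
qed (use assms in auto)

lemma integral_gauss_rotation:
  fixes g :: "_ \<Rightarrow> real"
  assumes "a\<^sup>2 + b\<^sup>2 = 1" "a \<noteq> 0" and [measurable]: "g \<in> borel_measurable (borel_vec n \<Otimes>\<^sub>M borel_vec n)"
  shows "(\<integral>p. g (lincomb n a b (fst p) (snd p), lincomb n b (-a) (fst p) (snd p)) \<partial>gauss_sq n)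
    = (\<integral>p. g p \<partial>gauss_sq n)"
proof -
  have "(\<integral>p. g p \<partial>gauss_sq n) = (\<integral>p. g p \<partial>distr (gauss_sq n) (gauss_sq n)
      (\<lambda>p. (lincomb n a b (fst p) (snd p), lincomb n b (-a) (fst p) (snd p))))"
    by (simp add: gauss_rotation[OF assms(1,2)])
  also have "\<dots> = (\<integral>p. g (lincomb n a b (fst p) (snd p), lincomb n b (-a) (fst p) (snd p)) \<partial>gauss_sq n)"
    by (rule integral_distr) measurable
  finally show ?thesis by simp
qed

lemma distr_gauss_lincomb:
  assumes "a\<^sup>2 + b\<^sup>2 = 1" "a \<noteq> 0"
  shows "distr (gauss_sq n) (gauss n) (\<lambda>p. lincomb n a b (fst p) (snd p)) = gauss n"
proof -
  have "distr (gauss_sq n) (gauss n) (\<lambda>p. lincomb n a b (fst p) (snd p)) =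
    distr (distr (gauss_sq n) (gauss_sq n)
      (\<lambda>p. (lincomb n a b (fst p) (snd p), lincomb n b (-a) (fst p) (snd p)))) (gauss n) fst"
    by (subst distr_distr) (measurable, simp add: comp_def)
  also have "\<dots> = distr (gauss_sq n) (gauss n) fst"
    by (simp add: gauss_rotation[OF assms])
  also have "\<dots> = gauss n"
    by (rule gauss.distr_pair_fst)
  finally show ?thesis .
qed

lemma integral_gauss_lincomb:
  fixes \<phi> :: "_ \<Rightarrow> real"
  assumes "a\<^sup>2 + b\<^sup>2 = 1" "a \<noteq> 0" and [measurable]: "\<phi> \<in> borel_measurable (borel_vec n)"
  shows "(\<integral>p. \<phi> (lincomb n a b (fst p) (snd p)) \<partial>gauss_sq n) = (\<integral>x. \<phi> x \<partial>gauss n)"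
  by (subst (3) distr_gauss_lincomb[OF assms(1,2), symmetric]) (rule integral_distr[symmetric]; measurable)

text \<open>Mehler's formula for the Ornstein--Uhlenbeck semigroup, parametrized by the correlation
  \<open>r\<close> instead of the time. It defines a function at every \<open>x\<close>, not a class
  modulo null sets.\<close>

definition ou :: "nat \<Rightarrow> real \<Rightarrow> ((nat \<Rightarrow> real) \<Rightarrow> real) \<Rightarrow> (nat \<Rightarrow> real) \<Rightarrow> real" where
  "ou n r \<phi> x = (\<integral>z. \<phi> (lincomb n r (sqrt (1 - r\<^sup>2)) x z) \<partial>gauss n)"

lemma measurable_ou [measurable]:
  assumes [measurable]: "\<phi> \<in> borel_measurable (borel_vec n)"
  shows "ou n r \<phi> \<in> borel_measurable (borel_vec n)"
  unfolding ou_def[abs_def] by (rule gauss.borel_measurable_lebesgue_integral) measurable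

lemma ou_integrable: 
  assumes "bdd_meas n \<phi>" shows "integrable (gauss n) (\<lambda>z. \<phi> (lincomb n a b x z))"
proof -
  obtain C where "\<And>x. x \<in> vecs n \<Longrightarrow> \<bar>\<phi> x\<bar> \<le> C" using assms bdd_measE by metis
  then show ?thesis
    by (intro bdd_meas_integrable bdd_measI[where C=C]
        measurable_compose[OF measurable_lincomb_right bdd_meas_measurable[OF assms]]) auto
qed

lemma abs_integral_gauss_le:
  fixes g :: "_ \<Rightarrow> real"
  assumes "\<And>x. x \<in> vecs n \<Longrightarrow> \<bar>g x\<bar> \<le> C"
  shows "\<bar>\<integral>x. g x \<partial>gauss n\<bar> \<le> C"
proof (cases "integrable (gauss n) g")
  case True
  have "\<bar>\<integral>x. g x \<partial>gauss n\<bar> \<le> (\<integral>x. \<bar>g x\<bar> \<partial>gauss n)" 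
    using integral_norm_bound[of "gauss n" g] by simp
  also have "\<dots> \<le> C"
    using assms True by (intro gauss.integral_le_const AE_I2) auto
  finally show ?thesis .
next
  case False
  then show ?thesis using assms[of "\<lambda>i\<in>{..<n}. 0"] by (simp add: not_integrable_integral_eq)
qed

lemma ou_bound:
  assumes "\<And>x. x \<in> vecs n \<Longrightarrow> \<bar>\<phi> x\<bar> \<le> C"
  shows "\<bar>ou n r \<phi> x\<bar> \<le> C"
  unfolding ou_def using assms by (intro abs_integral_gauss_le) auto

lemma bdd_meas_ou [intro]: "bdd_meas n \<phi> \<Longrightarrow> bdd_meas n (ou n r \<phi>)"
  using bdd_measE[of n \<phi>] by (metis bdd_measI ou_bound measurable_ou bdd_meas_measurable)

definition stab :: "nat \<Rightarrow> real \<Rightarrow> ((nat \<Rightarrow> real) \<Rightarrow> real) \<Rightarrow> ((nat \<Rightarrow> real) \<Rightarrow> real) \<Rightarrow> real" where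
  "stab n r \<phi> \<psi> = (\<integral>x. \<phi> x * ou n r \<psi> x \<partial>gauss n)"

lemma integrable_pair:
  assumes "bdd_meas n \<phi>" "bdd_meas n \<psi>"
  shows "integrable (gauss_sq n) (\<lambda>p. \<phi> (lincomb n c d (fst p) (snd p)) * \<psi> (lincomb n a b (fst p) (snd p)))"
    and "integrable (gauss_sq n) (\<lambda>p. \<phi> (fst p) * \<psi> (lincomb n a b (fst p) (snd p)))"
proof -
  obtain C D where CD: "\<And>x. x \<in> vecs n \<Longrightarrow> \<bar>\<phi> x\<bar> \<le> C" "C \<ge> 0" "\<And>x. x \<in> vecs n \<Longrightarrow> \<bar>\<psi> x\<bar> \<le> D"
    using assms bdd_measE by metis
  note [measurable] = assms[THEN bdd_meas_measurable]
  show "integrable (gauss_sq n) (\<lambda>p. \<phi> (lincomb n c d (fst p) (snd p)) * \<psi> (lincomb n a b (fst p) (snd p)))"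
    by (rule integrable_gauss2[where C="C*D"], measurable) (use CD in \<open>auto simp: abs_mult intro!: mult_mono\<close>)
  show "integrable (gauss_sq n) (\<lambda>p. \<phi> (fst p) * \<psi> (lincomb n a b (fst p) (snd p)))"
    by (rule integrable_gauss2[where C="C*D"], measurable) (use CD in \<open>auto simp: abs_mult intro!: mult_mono\<close>)
qed

lemma stab_pair:
  assumes "bdd_meas n \<phi>" "bdd_meas n \<psi>"
  shows "stab n r \<phi> \<psi> = (\<integral>p. \<phi> (fst p) * \<psi> (lincomb n r (sqrt (1 - r\<^sup>2)) (fst p) (snd p)) \<partial>gauss_sq n)"
  using gauss2.integral_fst'[OF integrable_pair(2)[OF assms]]
  by (simp add: stab_def ou_def)

lemma sq_sum_sqrt: "0 < r \<Longrightarrow> r \<le> 1 \<Longrightarrow> r\<^sup>2 + (sqrt (1 - r\<^sup>2))\<^sup>2 = (1::real)"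
  by (simp add: power_le_one)

text \<open>A correlated pair is exchangeable: the reflection sends \<open>(x, z)\<close> to
  \<open>(y, z')\<close> with \<open>y = r x + ?s z\<close>, and the same combination of
  \<open>y\<close> and \<open>z'\<close> gives back \<open>x\<close>. The reflected integral is
  therefore the original one with the two points exchanged.\<close>

lemma stab_sym:
  assumes "bdd_meas n \<phi>" "bdd_meas n \<psi>" "0 < r" "r \<le> 1"
  shows "stab n r \<phi> \<psi> = stab n r \<psi> \<phi>"
proof -
  let ?s = "sqrt (1 - r\<^sup>2)"
  note rs = sq_sum_sqrt[OF assms(3,4)]
  note [measurable] = assms(1,2)[THEN bdd_meas_measurable]
  have "stab n r \<psi> \<phi> = (\<integral>p. \<psi> (fst p) * \<phi> (lincomb n r ?s (fst p) (snd p)) \<partial>gauss_sq n)"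
    by (rule stab_pair) fact+
  also have "\<dots> = (\<integral>p. \<psi> (lincomb n r ?s (fst p) (snd p)) *
      \<phi> (lincomb n r ?s (lincomb n r ?s (fst p) (snd p)) (lincomb n ?s (-r) (fst p) (snd p))) \<partial>gauss_sq n)"
    by (subst integral_gauss_rotation[OF rs, symmetric,
          where g="\<lambda>p. \<psi> (fst p) * \<phi> (lincomb n r ?s (fst p) (snd p))"]) (use assms(3) in simp_all)
  also have "\<dots> = (\<integral>p. \<phi> (fst p) * \<psi> (lincomb n r ?s (fst p) (snd p)) \<partial>gauss_sq n)"
    by (intro Bochner_Integration.integral_cong refl) 
      (simp add: space_pair_measure mem_Times_iff lincomb_rotate[OF rs] mult.commute)
  also have "\<dots> = stab n r \<phi> \<psi>" by (rule stab_pair[symmetric]) fact+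
  finally show ?thesis by simp
qed

text \<open>The two noises combine to \<open>r ?s z + ?s z'\<close>, of variance
  \<open>1 - r^4\<close>. Divided by \<open>?t\<close> this is a unit combination of independent
  standard Gaussians, hence standard Gaussian. Squares of operators suffice, because every parameter
  below is reached by taking square roots.\<close>

lemma ou_ou:
  assumes "bdd_meas n \<phi>" "0 < r" "r < 1"
  shows "ou n r (ou n r \<phi>) x = ou n (r\<^sup>2) \<phi> x"
proof -
  let ?s = "sqrt (1 - r\<^sup>2)" and ?t = "sqrt (1 - (r\<^sup>2)\<^sup>2)"
  have r2: "r\<^sup>2 < 1" using assms by (simp add: power_less_one_iff)
  have r4: "(r\<^sup>2)\<^sup>2 < 1" using r2 assms power_less_one_iff[of "r\<^sup>2" 2] by simp
  have t: "?t > 0" "?t \<noteq> 0" using r4 by auto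
  have s: "?s > 0" using r2 by simp
  note [measurable] = assms(1)[THEN bdd_meas_measurable]
  obtain C where C: "\<And>x. x \<in> vecs n \<Longrightarrow> \<bar>\<phi> x\<bar> \<le> C" using assms bdd_measE by metis
  let ?g = "\<lambda>p. \<phi> (lincomb n r ?s (lincomb n r ?s x (fst p)) (snd p))"
  have g: "integrable (gauss_sq n) ?g"
    by (rule integrable_gauss2[where C=C], measurable) (use C in auto)
  have "(r * ?s)\<^sup>2 + ?s\<^sup>2 = (1 + r\<^sup>2) * (1 - r\<^sup>2)" 
    using r2 by (simp add: power_mult_distrib algebra_simps)
  also have "\<dots> = 1 - (r\<^sup>2)\<^sup>2" by (simp add: algebra_simps power2_eq_square)
  also have "\<dots> = ?t\<^sup>2" using r4 by simp
  finally have q: "(r * ?s / ?t)\<^sup>2 + (?s / ?t)\<^sup>2 = 1"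
    using t by (simp add: power_divide add_divide_distrib[symmetric])
  have nz: "r * ?s / ?t \<noteq> 0" using assms s t by simp
  have "ou n r (ou n r \<phi>) x = (\<integral>p. ?g p \<partial>gauss_sq n)"
    using gauss2.integral_fst'[OF g] by (simp add: ou_def)
  also have "\<dots> = (\<integral>p. \<phi> (lincomb n (r\<^sup>2) ?t x (lincomb n (r * ?s / ?t) (?s / ?t) (fst p) (snd p))) \<partial>gauss_sq n)"
    by (intro Bochner_Integration.integral_cong refl arg_cong[where f=\<phi>] vec_eqI[of _ n])
       (use t(2) in \<open>auto simp: field_simps power2_eq_square\<close>)
  also have "\<dots> = ou n (r\<^sup>2) \<phi> x"
    unfolding ou_def by (rule integral_gauss_lincomb[OF q nz, where \<phi>="\<lambda>y. \<phi> (lincomb n (r\<^sup>2) ?t x y)"]) measurable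
  finally show ?thesis .
qed

lemma stab_eq_ou_ou:
  assumes "bdd_meas n \<phi>" "bdd_meas n \<psi>" "0 < r" "r < 1"
  shows "stab n (r\<^sup>2) \<phi> \<psi> = (\<integral>x. ou n r \<phi> x * ou n r \<psi> x \<partial>gauss n)"
proof -
  have "stab n (r\<^sup>2) \<phi> \<psi> = stab n r \<phi> (ou n r \<psi>)"
    unfolding stab_def using ou_ou[OF assms(2-4)] by simp
  also have "\<dots> = stab n r (ou n r \<psi>) \<phi>"
    using assms by (intro stab_sym) auto
  finally show ?thesis unfolding stab_def by (simp add: mult.commute)
qed

text \<open>The operator with parameter \<open>r\<close> is the square of the self-adjoint one with
  parameter \<open>sqrt r\<close>, so the form is a squared \<open>L^2\<close> norm.\<close>

lemma stab_nonneg: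
  assumes "bdd_meas n \<phi>" "0 < r" "r < 1"
  shows "0 \<le> stab n r \<phi> \<phi>"
proof -
  have "stab n r \<phi> \<phi> = (\<integral>x. ou n (sqrt r) \<phi> x * ou n (sqrt r) \<phi> x \<partial>gauss n)"
    using stab_eq_ou_ou[of n \<phi> \<phi> "sqrt r"] assms by simp
  then show ?thesis by (simp add: integral_nonneg_AE)
qed

lemma gauss_square_le:
  assumes "bdd_meas n \<phi>"
  shows "(\<integral>x. \<phi> x \<partial>gauss n)\<^sup>2 \<le> (\<integral>x. (\<phi> x)\<^sup>2 \<partial>gauss n)"
proof -
  have i: "integrable (gauss n) \<phi>" "integrable (gauss n) (\<lambda>x. (\<phi> x)\<^sup>2)"
    using assms by (auto simp: power2_eq_square intro!: bdd_meas_integrable)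
  have "0 \<le> gauss.variance n \<phi>" by (rule gauss.variance_positive)
  then show ?thesis using gauss.variance_eq[OF i] by simp
qed

text \<open>Jensen's inequality in the integral over the noise, followed by invariance of the
  Gaussian measure.\<close>

lemma ou_L2_contraction:
  assumes "bdd_meas n \<phi>" "0 < r" "r < 1"
  shows "(\<integral>x. (ou n r \<phi> x)\<^sup>2 \<partial>gauss n) \<le> (\<integral>x. (\<phi> x)\<^sup>2 \<partial>gauss n)"
proof -
  let ?s = "sqrt (1 - r\<^sup>2)"
  note [measurable] = assms(1)[THEN bdd_meas_measurable]
  have b2: "bdd_meas n (\<lambda>x. (\<phi> x)\<^sup>2)" using assms by (auto simp: power2_eq_square)
  have "(ou n r \<phi> x)\<^sup>2 \<le> ou n r (\<lambda>x. (\<phi> x)\<^sup>2) x" for x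
  proof -
    obtain C where C: "\<And>x. x \<in> vecs n \<Longrightarrow> \<bar>\<phi> x\<bar> \<le> C" using assms bdd_measE by metis
    then have "bdd_meas n (\<lambda>z. \<phi> (lincomb n r ?s x z))"
      by (intro bdd_measI[where C=C]
          measurable_compose[OF measurable_lincomb_right bdd_meas_measurable[OF assms(1)]]) auto
    then show ?thesis unfolding ou_def by (rule gauss_square_le)
  qed
  then have "(\<integral>x. (ou n r \<phi> x)\<^sup>2 \<partial>gauss n) \<le> (\<integral>x. 1 * ou n r (\<lambda>x. (\<phi> x)\<^sup>2) x \<partial>gauss n)"
    using assms b2 by (intro integral_mono) (auto simp: power2_eq_square intro!: bdd_meas_integrable)
  also have "\<dots> = stab n r (\<lambda>_. 1) (\<lambda>x. (\<phi> x)\<^sup>2)" by (simp add: stab_def)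
  also have "\<dots> = (\<integral>x. (\<phi> x)\<^sup>2 \<partial>gauss n)"
    using integral_gauss_lincomb[OF sq_sum_sqrt, of r "\<lambda>x. (\<phi> x)\<^sup>2" n] assms b2
    by (subst stab_pair) auto
  finally show ?thesis .
qed

text \<open>One of the two factors with parameter \<open>sqrt r\<close> is dropped by contraction.
  This later turns smallness of the stability of \<open>u_t - u\<close> into smallness of an
  increment of \<open>N\<close>.\<close>

lemma ou_L2_le_stab:
  assumes "bdd_meas n \<phi>" "0 < r" "r < 1"
  shows "(\<integral>x. (ou n r \<phi> x)\<^sup>2 \<partial>gauss n) \<le> stab n r \<phi> \<phi>"
proof -
  have s: "0 < sqrt r" "sqrt r < 1" "(sqrt r)\<^sup>2 = r" using assms by auto
  have "(\<integral>x. (ou n r \<phi> x)\<^sup>2 \<partial>gauss n) = (\<integral>x. (ou n (sqrt r) (ou n (sqrt r) \<phi>) x)\<^sup>2 \<partial>gauss n)"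
    using ou_ou[OF assms(1) s(1,2)] s(3) by simp
  also have "\<dots> \<le> (\<integral>x. (ou n (sqrt r) \<phi> x)\<^sup>2 \<partial>gauss n)"
    using assms s by (intro ou_L2_contraction) auto
  also have "\<dots> = stab n r \<phi> \<phi>"
    using stab_eq_ou_ou[OF assms(1,1) s(1,2)] s(3) by (simp add: power2_eq_square)
  finally show ?thesis .
qed

lemma ou_diff:
  assumes "bdd_meas n \<phi>" "bdd_meas n \<psi>"
  shows "ou n r (\<lambda>x. \<phi> x - \<psi> x) y = ou n r \<phi> y - ou n r \<psi> y"
  unfolding ou_def using assms by (intro Bochner_Integration.integral_diff ou_integrable)

lemma stab_diff_right:
  assumes "bdd_meas n \<phi>" "bdd_meas n \<psi>" "bdd_meas n \<eta>"
  shows "stab n r \<eta> (\<lambda>x. \<phi> x - \<psi> x) = stab n r \<eta> \<phi> - stab n r \<eta> \<psi>"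
  unfolding stab_def ou_diff[OF assms(1,2)] right_diff_distrib using assms
  by (intro Bochner_Integration.integral_diff bdd_meas_integrable) auto

lemma stab_diff_left:
  assumes "bdd_meas n \<phi>" "bdd_meas n \<psi>" "bdd_meas n \<eta>"
  shows "stab n r (\<lambda>x. \<phi> x - \<psi> x) \<eta> = stab n r \<phi> \<eta> - stab n r \<psi> \<eta>"
  unfolding stab_def left_diff_distrib using assms
  by (intro Bochner_Integration.integral_diff bdd_meas_integrable) auto

lemma stab_diff_diff:
  assumes "bdd_meas n \<phi>" "bdd_meas n \<psi>" "0 < r" "r \<le> 1"
  shows "stab n r (\<lambda>x. \<phi> x - \<psi> x) (\<lambda>x. \<phi> x - \<psi> x)
    = stab n r \<phi> \<phi> - 2 * stab n r \<phi> \<psi> + stab n r \<psi> \<psi>"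
  using assms stab_sym[OF assms] by (simp add: stab_diff_left stab_diff_right bdd_meas_diff)

lemma ou_shift:
  assumes "r \<noteq> 0"
  shows "ou n r (\<lambda>y. \<phi> (lincomb n 1 t y w)) x = ou n r \<phi> (lincomb n 1 (t / r) x w)"
  unfolding ou_def
  by (intro Bochner_Integration.integral_cong refl arg_cong[where f=\<phi>] vec_eqI[of _ n])
     (use assms in \<open>auto simp: field_simps\<close>)

lemma AE_gauss_shift:
  assumes "AE z in gauss n. P z"
  shows "AE z in gauss n. P (lincomb n 1 1 z a)"
proof -
  have "AE z in density (gauss n) (\<lambda>x. ennreal (tilt n a x)). P z"
    using assms by (subst AE_density) (measurable, auto)
  then have "AE z in distr (gauss n) (gauss n) (\<lambda>x. lincomb n 1 1 x a). P z"
    unfolding gauss_shift .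
  then show ?thesis by (rule AE_distrD[rotated]) measurable
qed

text \<open>The point \<open>x\<close> is arbitrary, not generic. Fubini provides one good point
  \<open>x0\<close>; passing from \<open>x0\<close> to \<open>x\<close> translates the noise, and
  translations preserve null sets by Cameron-Martin. Hence changing \<open>\<phi>\<close> on a null
  set alters \<open>ou n r \<phi>\<close> at no point.\<close>

lemma AE_gauss_affine:
  assumes "AE y in gauss n. P y" "0 < r" "r < 1" 
  shows "AE z in gauss n. P (lincomb n r (sqrt (1 - r\<^sup>2)) x z)"
proof -
  let ?s = "sqrt (1 - r\<^sup>2)"
  have s: "?s > 0" using assms by (simp add: power_less_one_iff)
  have "AE y in distr (gauss_sq n) (gauss n) (\<lambda>p. lincomb n r ?s (fst p) (snd p)). P y"
    using assms by (subst distr_gauss_lincomb[OF sq_sum_sqrt]) auto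
  then have "AE p in gauss_sq n. P (lincomb n r ?s (fst p) (snd p))"
    by (rule AE_distrD[rotated]) measurable
  from gauss2.AE_pair[OF this] have "AE x in gauss n. AE z in gauss n. P (lincomb n r ?s x z)"
    by simp
  then obtain x0 where "AE z in gauss n. P (lincomb n r ?s x0 z)"
    using gauss.AE_False[of n] AE_mp eventually_mono by (metis (mono_tags, lifting))
  from AE_gauss_shift[OF this, of "\<lambda>i. r * (x i - x0 i) / ?s"]
  have "AE z in gauss n. P (lincomb n r ?s x0 (lincomb n 1 1 z (\<lambda>i. r * (x i - x0 i) / ?s)))" .
  moreover have "lincomb n r ?s x0 (lincomb n 1 1 z (\<lambda>i. r * (x i - x0 i) / ?s)) = lincomb n r ?s x z" for z
    using s by (intro vec_eqI[of _ n]) (auto simp: field_simps)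
  ultimately show ?thesis by simp
qed

lemma ou_cong_AE:
  assumes "AE y in gauss n. \<phi> y = \<psi> y" "0 < r" "r < 1" 
    and [measurable]: "\<phi> \<in> borel_measurable (borel_vec n)" "\<psi> \<in> borel_measurable (borel_vec n)"
  shows "ou n r \<phi> x = ou n r \<psi> x"
  unfolding ou_def using AE_gauss_affine[OF assms(1-3), of x] by (intro integral_cong_AE) auto

section \<open>Equicontinuity and injectivity\<close>

lemma integral_gauss_shift:
  fixes g :: "_ \<Rightarrow> real"
  assumes [measurable]: "g \<in> borel_measurable (borel_vec n)"
  shows "(\<integral>x. g (lincomb n 1 1 x a) \<partial>gauss n) = (\<integral>x. tilt n a x * g x \<partial>gauss n)"
proof -
  have "(\<integral>x. g (lincomb n 1 1 x a) \<partial>gauss n) = (\<integral>x. g x \<partial>distr (gauss n) (gauss n) (\<lambda>x. lincomb n 1 1 x a))"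
    by (rule integral_distr[symmetric]) measurable
  also have "\<dots> = (\<integral>x. tilt n a x * g x \<partial>gauss n)"
    unfolding gauss_shift by (subst integral_density) (auto simp: tilt_def)
  finally show ?thesis .
qed

lemma integrable_tilt: "integrable (gauss n) (tilt n a)" and integral_tilt: "(\<integral>x. tilt n a x \<partial>gauss n) = 1"
proof -
  have pos: "tilt n a x \<ge> 0" for x by (simp add: tilt_def)
  have "(\<integral>\<^sup>+x. ennreal (tilt n a x) \<partial>gauss n) = emeasure (density (gauss n) (\<lambda>x. ennreal (tilt n a x))) (space (gauss n))"
    by (subst emeasure_density) (auto intro!: nn_integral_cong)
  also have "\<dots> = emeasure (distr (gauss n) (gauss n) (\<lambda>x. lincomb n 1 1 x a)) (space (gauss n))"
    by (simp only: gauss_shift)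
  also have "\<dots> = 1" 
    using prob_space.emeasure_space_1[OF gauss.prob_space_distr[of "\<lambda>x. lincomb n 1 1 x a" n "gauss n"]] by simp
  finally have nn: "(\<integral>\<^sup>+x. ennreal (tilt n a x) \<partial>gauss n) = 1" .
  then show "integrable (gauss n) (tilt n a)"
    using pos by (intro integrableI_nonneg) auto
  show "(\<integral>x. tilt n a x \<partial>gauss n) = 1"
    using nn pos by (subst integral_eq_nn_integral) auto
qed

lemma tilt_scale: "tilt n (\<lambda>i. 2 * d i) z = (tilt n d z)\<^sup>2 * exp (- inner_k n d d)"
proof -
  have "inner_k n (\<lambda>i. 2 * d i) z = 2 * inner_k n d z" "inner_k n (\<lambda>i. 2 * d i) (\<lambda>i. 2 * d i) = 4 * inner_k n d d"
    by (simp_all add: inner_k_def sum_distrib_left mult_ac)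
  then show ?thesis
    unfolding tilt_def power2_eq_square exp_add[symmetric] by (simp add: algebra_simps)
qed

lemma integrable_tilt_sq: "integrable (gauss n) (\<lambda>z. (tilt n d z)\<^sup>2)"
  and integral_tilt_sq: "(\<integral>z. (tilt n d z)\<^sup>2 \<partial>gauss n) = exp (inner_k n d d)"
proof -
  have e: "(tilt n d z)\<^sup>2 = exp (inner_k n d d) * tilt n (\<lambda>i. 2 * d i) z" for z
    unfolding tilt_scale by (simp add: exp_minus)
  show "integrable (gauss n) (\<lambda>z. (tilt n d z)\<^sup>2)"
    unfolding e by (intro integrable_mult_right integrable_tilt)
  show "(\<integral>z. (tilt n d z)\<^sup>2 \<partial>gauss n) = exp (inner_k n d d)"
    unfolding e by (simp add: integral_tilt)
qed

text \<open>Cauchy-Schwarz; the second moment of \<open>tilt n d - 1\<close> is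
  \<open>exp |d|^2 - 1\<close>.\<close>

lemma integral_abs_tilt_le: "(\<integral>z. \<bar>tilt n d z - 1\<bar> \<partial>gauss n) \<le> sqrt (exp (inner_k n d d) - 1)"
proof -
  have i: "integrable (gauss n) (\<lambda>z. \<bar>tilt n d z - 1\<bar>)"
    using integrable_tilt by (intro integrable_abs Bochner_Integration.integrable_diff) auto
  have e: "(\<bar>tilt n d z - 1\<bar>)\<^sup>2 = (tilt n d z)\<^sup>2 - 2 * tilt n d z + 1" for z
    by (simp add: power2_eq_square algebra_simps)
  have i2: "integrable (gauss n) (\<lambda>z. (\<bar>tilt n d z - 1\<bar>)\<^sup>2)"
    unfolding e using integrable_tilt integrable_tilt_sq by (intro Bochner_Integration.integrable_add Bochner_Integration.integrable_diff) auto
  have "(\<integral>z. (\<bar>tilt n d z - 1\<bar>)\<^sup>2 \<partial>gauss n) = exp (inner_k n d d) - 1"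
    unfolding e using integrable_tilt integrable_tilt_sq gauss.prob_space[of n]
    by (simp add: integral_tilt integral_tilt_sq)
  then have "(\<integral>z. \<bar>tilt n d z - 1\<bar> \<partial>gauss n)\<^sup>2 \<le> exp (inner_k n d d) - 1"
    using gauss.variance_positive[of n "\<lambda>z. \<bar>tilt n d z - 1\<bar>"] gauss.variance_eq[OF i i2] by simp
  then show ?thesis by (rule real_le_rsqrt)
qed

text \<open>Moving \<open>x\<close> to \<open>y\<close> amounts to translating the noise by
  \<open>d\<close>, so the difference is the integral of \<open>\<phi>\<close> against
  \<open>tilt n d - 1\<close>. The modulus sees \<open>\<phi>\<close> only through its bound
  \<open>C\<close>, which gives equicontinuity along a sequence.\<close>

lemma ou_modulus:
  assumes "bdd_meas n \<phi>" "\<And>x. x \<in> vecs n \<Longrightarrow> \<bar>\<phi> x\<bar> \<le> C" "0 < r" "r < 1"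
  shows "\<bar>ou n r \<phi> y - ou n r \<phi> x\<bar> \<le> C * sqrt (exp (r\<^sup>2 / (1 - r\<^sup>2) * (\<Sum>i<n. (y i - x i)\<^sup>2)) - 1)"
proof -
  let ?s = "sqrt (1 - r\<^sup>2)"
  have r2: "1 - r\<^sup>2 > 0" using assms by (simp add: power_less_one_iff)
  then have s: "?s > 0" by simp
  define d where "d i = r * (y i - x i) / ?s" for i
  have d2: "inner_k n d d = r\<^sup>2 / (1 - r\<^sup>2) * (\<Sum>i<n. (y i - x i)\<^sup>2)"
  proof -
    have "d i * d i = r\<^sup>2 / (1 - r\<^sup>2) * (y i - x i)\<^sup>2" for i
      using r2 by (simp add: d_def power2_eq_square)
    then show ?thesis by (simp add: inner_k_def sum_distrib_left)
  qed
  have m[measurable]: "(\<lambda>z. \<phi> (lincomb n r ?s x z)) \<in> borel_measurable (borel_vec n)"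
    by (rule measurable_compose[OF measurable_lincomb_right bdd_meas_measurable[OF assms(1)]])
  have "lincomb n r ?s y z = lincomb n r ?s x (lincomb n 1 1 z d)" for z
    using s by (intro vec_eqI[of _ n]) (auto simp: d_def field_simps)
  then have y: "ou n r \<phi> y = (\<integral>z. tilt n d z * \<phi> (lincomb n r ?s x z) \<partial>gauss n)"
    unfolding ou_def using integral_gauss_shift[OF m, of d] by simp
  have C0: "C \<ge> 0" by (rule order_trans[OF abs_ge_zero assms(2)[OF lincomb_in_space]])
  have b: "\<bar>\<phi> (lincomb n r ?s x z)\<bar> \<le> C" for z by (rule assms(2)[OF lincomb_in_space])
  have it: "integrable (gauss n) (\<lambda>z. tilt n d z * \<phi> (lincomb n r ?s x z))"
  proof (rule Bochner_Integration.integrable_bound[OF integrable_mult_right[OF integrable_tilt[of n d], of C]])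
    show "AE z in gauss n. norm (tilt n d z * \<phi> (lincomb n r ?s x z)) \<le> norm (C * tilt n d z)"
      using b C0 by (intro AE_I2) (auto simp: tilt_def abs_mult)
  qed (measurable)
  have ix: "integrable (gauss n) (\<lambda>z. \<phi> (lincomb n r ?s x z))" by (rule ou_integrable) fact
  have "ou n r \<phi> y - ou n r \<phi> x = (\<integral>z. (tilt n d z - 1) * \<phi> (lincomb n r ?s x z) \<partial>gauss n)"
    unfolding y unfolding ou_def left_diff_distrib mult_1_left
    by (rule Bochner_Integration.integral_diff[OF it ix, symmetric])
  then have "\<bar>ou n r \<phi> y - ou n r \<phi> x\<bar> \<le> (\<integral>z. \<bar>(tilt n d z - 1) * \<phi> (lincomb n r ?s x z)\<bar> \<partial>gauss n)"
    using integral_norm_bound[of "gauss n" "\<lambda>z. (tilt n d z - 1) * \<phi> (lincomb n r ?s x z)"] by simp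
  also have "\<dots> \<le> (\<integral>z. C * \<bar>tilt n d z - 1\<bar> \<partial>gauss n)"
  proof (rule integral_mono)
    show "integrable (gauss n) (\<lambda>z. \<bar>(tilt n d z - 1) * \<phi> (lincomb n r ?s x z)\<bar>)"
      using it ix by (auto simp: left_diff_distrib)
    show "integrable (gauss n) (\<lambda>z. C * \<bar>tilt n d z - 1\<bar>)"
      using integrable_tilt by auto
    show "\<bar>(tilt n d z - 1) * \<phi> (lincomb n r ?s x z)\<bar> \<le> C * \<bar>tilt n d z - 1\<bar>" for z
      using mult_right_mono[OF b[of z] abs_ge_zero[of "tilt n d z - 1"]] by (simp add: abs_mult mult.commute)
  qed
  also have "\<dots> \<le> C * sqrt (exp (inner_k n d d) - 1)"
    using integral_abs_tilt_le[of n d] C0 by (simp add: mult_left_mono)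
  finally show ?thesis unfolding d2 .
qed

text \<open>Tychonoff's theorem on a countable product of compact intervals takes the place of a
  diagonal argument.\<close>

lemma bounded_coordinates_subseq:
  fixes a :: "nat \<Rightarrow> nat \<Rightarrow> real"
  assumes "\<And>j i. \<bar>a j i\<bar> \<le> C i"
  obtains l r where "strict_mono (r :: nat \<Rightarrow> nat)" "\<And>i. (\<lambda>j. a (r j) i) \<longlonglongrightarrow> l i"
proof -
  have "compactin (product_topology (\<lambda>_::nat. euclidean :: real topology) UNIV) (PiE UNIV (\<lambda>i. {-C i..C i}))"
    by (subst compactin_PiE) auto
  then have "compact (PiE UNIV (\<lambda>i. {-C i..C i}) :: (nat \<Rightarrow> real) set)"
    unfolding euclidean_product_topology by simp
  then have "seq_compact (PiE UNIV (\<lambda>i. {-C i..C i}) :: (nat \<Rightarrow> real) set)"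
    by (rule compact_imp_seq_compact)
  moreover have "\<forall>j. a j \<in> PiE UNIV (\<lambda>i. {-C i..C i})"
  proof (intro allI PiE_I)
    show "a j i \<in> {- C i..C i}" for j i using assms[of j i] by (simp add: abs_le_iff)
  qed simp
  ultimately obtain l r where r: "strict_mono r" "(a \<circ> r) \<longlonglongrightarrow> l"
    unfolding seq_compact_def by blast
  have "(\<lambda>j. a (r j) i) \<longlonglongrightarrow> l i" for i
  proof -
    have "isCont (\<lambda>x::nat \<Rightarrow> real. x i) l"
      using continuous_on_product_coordinates[of i] continuous_on_eq_continuous_at open_UNIV by blast
    from isCont_tendsto_compose[OF this r(2)] show ?thesis by (simp add: comp_def)
  qed
  then show thesis using that r by blast
qed

text \<open>The sets \<open>A\<close> for which the claim holds form a sigma-algebra, so it is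
  enough to check a generating family. For a countable union, the part outside finitely many of the
  sets is small uniformly in \<open>j\<close>, because every \<open>Y j\<close> has the law of
  \<open>X\<close>.\<close>

lemma L1_indicator_convergence:
  fixes Y :: "nat \<Rightarrow> 'a \<Rightarrow> 'b"
  assumes "prob_space M" and X[measurable]: "X \<in> measurable M N" and Y[measurable]: "\<And>j. Y j \<in> measurable M N"
    and eq: "\<And>j. distr M N (Y j) = distr M N X"
    and G: "sets N = sigma_sets (space N) G" "G \<subseteq> Pow (space N)"
    and conv: "\<And>A. A \<in> G \<Longrightarrow> (\<lambda>j. \<integral>p. \<bar>indicator A (Y j p) - indicator A (X p)\<bar> \<partial>M) \<longlonglongrightarrow> (0::real)"
    and A: "A \<in> sets N"
  shows "(\<lambda>j. \<integral>p. \<bar>indicator A (Y j p) - indicator A (X p)\<bar> \<partial>M) \<longlonglongrightarrow> (0::real)"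
proof -
  interpret M: prob_space M by fact
  have int: "integrable M (\<lambda>p. \<bar>indicator A (Y j p) - indicator A (X p) :: real\<bar>)" if "A \<in> sets N" for A j
    using that by (intro M.integrable_const_bound[where B=1]) (auto simp: indicator_def)
  have ind: "integrable M (\<lambda>p. indicator A (Z p) :: real)" "(\<integral>p. indicator A (Z p) \<partial>M) = measure (distr M N Z) A"
    if "A \<in> sets N" "Z \<in> measurable M N" for A Z
  proof -
    note [measurable] = that
    show "integrable M (\<lambda>p. indicator A (Z p) :: real)"
      by (intro M.integrable_const_bound[where B=1]) (auto simp: indicator_def)
    have "(\<integral>p. indicator A (Z p) \<partial>M) = (\<integral>x. (indicator A x :: real) \<partial>distr M N Z)"
      by (subst integral_distr) auto
    then show "(\<integral>p. indicator A (Z p) \<partial>M) = measure (distr M N Z) A"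
      using sets.sets_into_space[OF that(1)] by (simp add: Int_absorb1)
  qed
  have "A \<in> sigma_sets (space N) G" using A G by simp
  then show ?thesis
  proof induction
    case (Basic a) then show ?case by (rule conv)
  next
    case Empty then show ?case by simp
  next
    case (Compl a)
    have "(\<integral>p. \<bar>indicator (space N - a) (Y j p) - indicator (space N - a) (X p)\<bar> \<partial>M) =
      (\<integral>p. \<bar>indicator a (Y j p) - indicator a (X p) :: real\<bar> \<partial>M)" for j
      using measurable_space[OF X] measurable_space[OF Y]
      by (intro Bochner_Integration.integral_cong) (auto simp: indicator_def)
    then show ?case using Compl by simp
  next
    case (Union a)
    have a[measurable]: "a i \<in> sets N" for i using Union(1) G by simp
    define B where "B m = (\<Union>i<m. a i)" for m
    define U where "U = (\<Union>i. a i)"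
    have [measurable]: "U \<in> sets N" "B m \<in> sets N" for m unfolding U_def B_def by measurable
    let ?m = "measure (distr M N X)"
    interpret D: prob_space "distr M N X" by (rule M.prob_space_distr) measurable
    have "(\<lambda>m. ?m (B m)) \<longlonglongrightarrow> ?m (\<Union>m. B m)"
      by (rule D.finite_Lim_measure_incseq) (auto simp: B_def incseq_def intro: less_le_trans)
    moreover have "(\<Union>m. B m) = U" by (auto simp: B_def U_def)
    ultimately have lim: "(\<lambda>m. ?m (B m)) \<longlonglongrightarrow> ?m U" by simp
    have "\<exists>J. \<forall>j\<ge>J. norm ((\<integral>p. \<bar>indicator U (Y j p) - indicator U (X p) :: real\<bar> \<partial>M) - 0) < e" if e: "e > 0" for e :: real
    proof -
      \<comment> \<open>The truncation index \<open>m\<close> depends on the law of \<open>X\<close>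
        alone. The two tail terms below then contribute less than \<open>e/4\<close> each, and the
        finite sum less than \<open>e/2\<close>.\<close>
      from LIMSEQ_D[OF lim, of "e/4"] e obtain m where m: "\<bar>?m (B m) - ?m U\<bar> < e/4" by fastforce
      have sub: "B m \<subseteq> U" by (auto simp: B_def U_def)
      have "?m (U - B m) = ?m U - ?m (B m)" using sub by (intro D.finite_measure_Diff) auto
      then have diff: "?m (U - B m) < e/4" using m by linarith
      have "(\<lambda>j. \<Sum>i<m. \<integral>p. \<bar>indicator (a i) (Y j p) - indicator (a i) (X p) :: real\<bar> \<partial>M) \<longlonglongrightarrow> (\<Sum>i<m. 0)"
        by (intro tendsto_sum Union.IH)
      then have lim0: "(\<lambda>j. \<Sum>i<m. \<integral>p. \<bar>indicator (a i) (Y j p) - indicator (a i) (X p) :: real\<bar> \<partial>M) \<longlonglongrightarrow> 0"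
        by simp
      obtain J where J: "\<And>j. j \<ge> J \<Longrightarrow> \<bar>\<Sum>i<m. \<integral>p. \<bar>indicator (a i) (Y j p) - indicator (a i) (X p) :: real\<bar> \<partial>M\<bar> < e/2"
        using LIMSEQ_D[OF lim0, of "e/2"] e by (auto simp only: half_gt_zero real_norm_def diff_0_right)
      have "norm ((\<integral>p. \<bar>indicator U (Y j p) - indicator U (X p) :: real\<bar> \<partial>M) - 0) < e" if "j \<ge> J" for j
      proof -
        \<comment> \<open>If exactly one of the two points lies in \<open>U\<close>, then either it
          lies in some \<open>a i\<close> with \<open>i < m\<close>, where the indicators differ, or
          it lies in \<open>U - B m\<close>.\<close>
        have pt: "\<bar>indicator U y - indicator U x :: real\<bar> \<le>
          (\<Sum>i<m. \<bar>indicator (a i) y - indicator (a i) x\<bar>) + indicator (U - B m) y + indicator (U - B m) x" for x y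
        proof (cases "y \<in> U \<longleftrightarrow> x \<in> U")
          case True then show ?thesis by (auto simp: indicator_def intro!: sum_nonneg add_nonneg_nonneg)
        next
          case False
          show ?thesis
          proof (cases "x \<in> B m \<or> y \<in> B m")
            case True
            then obtain i where i: "i < m" "x \<in> a i \<or> y \<in> a i" by (auto simp: B_def)
            with False have "\<not> (x \<in> a i \<and> y \<in> a i)" by (auto simp: U_def)
            with i have "1 \<le> \<bar>indicator (a i) y - indicator (a i) x :: real\<bar>" by (auto simp: indicator_def)
            also have "\<dots> \<le> (\<Sum>i<m. \<bar>indicator (a i) y - indicator (a i) x :: real\<bar>)"
              using i by (intro member_le_sum) auto
            finally show ?thesis using False by (auto simp: indicator_def split: if_splits)
          next
            case False
            then show ?thesis by (auto simp: indicator_def intro!: sum_nonneg add_nonneg_nonneg)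
          qed
        qed
        have "(\<integral>p. \<bar>indicator U (Y j p) - indicator U (X p) :: real\<bar> \<partial>M) \<le>
          (\<integral>p. (\<Sum>i<m. \<bar>indicator (a i) (Y j p) - indicator (a i) (X p)\<bar>) + indicator (U - B m) (Y j p) + indicator (U - B m) (X p) \<partial>M)"
          by (intro integral_mono pt Bochner_Integration.integrable_add Bochner_Integration.integrable_sum int ind) auto
        also have "\<dots> = (\<Sum>i<m. \<integral>p. \<bar>indicator (a i) (Y j p) - indicator (a i) (X p) :: real\<bar> \<partial>M) + ?m (U - B m) + ?m (U - B m)"
        proof -
          have "integrable M (\<lambda>p. \<Sum>i<m. \<bar>indicator (a i) (Y j p) - indicator (a i) (X p) :: real\<bar>)"
            by (intro Bochner_Integration.integrable_sum int) auto
          moreover have "integrable M (\<lambda>p. indicator (U - B m) (Y j p) :: real)" "integrable M (\<lambda>p. indicator (U - B m) (X p) :: real)"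
            by (rule ind; measurable)+
          ultimately show ?thesis
            using ind(2)[of "U - B m" "Y j"] ind(2)[of "U - B m" X] int
            by (simp add: Bochner_Integration.integral_sum eq)
        qed
        also have "\<dots> < e" using J[OF that] diff by linarith
        finally show ?thesis by simp
      qed
      then show ?thesis by (intro exI[of _ J] allI impI)
    qed
    then have "(\<lambda>j. \<integral>p. \<bar>indicator U (Y j p) - indicator U (X p) :: real\<bar> \<partial>M) \<longlonglongrightarrow> 0"
      by (intro LIMSEQ_I)
    then show ?case unfolding U_def .
  qed
qed


lemma AE_gauss_coordinate_neq:
  assumes "i < n" shows "AE x in gauss n. x i \<noteq> c"
proof -
  have "AE x in std_gauss. x \<noteq> c"
    by (subst AE_density) (use AE_lborel_singleton[of c] in auto)
  then show ?thesis
    unfolding gauss_def using assms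
    by (intro AE_PiM_component[where P="\<lambda>x. x \<noteq> c"]) (auto intro: std_gauss.prob_space_axioms)
qed

text \<open>The correlated point converges coordinatewise to \<open>fst p\<close>, but indicators
  may fail to follow at boundary points. Half-lines are safe, since a Gaussian coordinate almost
  surely avoids the end point. The sigma-algebra argument is then used twice: for Borel sets of the
  line, and for measurable sets of vectors.\<close>

lemma ou_indicator_convergence:
  assumes r: "\<And>j. 0 < r j" "\<And>j. r j < 1" "r \<longlonglongrightarrow> 1" and A: "A \<in> sets (borel_vec n)"
  shows "(\<lambda>j. \<integral>p. \<bar>indicator A (lincomb n (r j) (sqrt (1 - (r j)\<^sup>2)) (fst p) (snd p)) - indicator A (fst p)\<bar>
     \<partial>gauss_sq n) \<longlonglongrightarrow> (0::real)"
proof -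
  let ?P = "gauss_sq n"
  define Y where "Y j p = lincomb n (r j) (sqrt (1 - (r j)\<^sup>2)) (fst p) (snd p)" for j and p :: "(nat \<Rightarrow> real) \<times> (nat \<Rightarrow> real)"
  have Y[measurable]: "Y j \<in> measurable ?P (borel_vec n)" for j unfolding Y_def by measurable
  have dY: "distr ?P (borel_vec n) (Y j) = gauss n" for j
  proof -
    have "distr ?P (borel_vec n) (Y j) = distr ?P (gauss n) (Y j)" by (intro distr_cong) auto
    also have "\<dots> = gauss n"
      unfolding Y_def[abs_def] using r(1)[of j] r(2)[of j] by (intro distr_gauss_lincomb sq_sum_sqrt) auto
    finally show ?thesis .
  qed
  have dX: "distr ?P (borel_vec n) fst = gauss n"
  proof -
    have "distr ?P (borel_vec n) fst = distr ?P (gauss n) fst" by (intro distr_cong) auto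
    then show ?thesis using gauss.distr_pair_fst by simp
  qed
  have prob: "prob_space ?P" by unfold_locales
  have s0: "(\<lambda>j. sqrt (1 - (r j)\<^sup>2)) \<longlonglongrightarrow> 0"
    using r(3) by (auto intro!: tendsto_eq_intros)
  have single: "(\<lambda>j. \<integral>p. \<bar>indicator B (Y j p i) - indicator B (fst p i)\<bar> \<partial>?P) \<longlonglongrightarrow> (0::real)"
    if i: "i < n" and B: "B \<in> sets borel" for i B
  proof (rule L1_indicator_convergence[where G="range (\<lambda>c::real. {..c})", OF prob _ _ _ _ _ _ B])
    show fi: "(\<lambda>p. fst p i) \<in> borel_measurable ?P" 
      using i by (intro measurable_nth[where f=fst]) auto
    show Yi: "(\<lambda>p. Y j p i) \<in> borel_measurable ?P" for j using i by (intro measurable_nth[OF Y])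
    have c: "(\<lambda>x. x i) \<in> measurable (borel_vec n) borel" using i by (intro measurable_nth[where f="\<lambda>x. x"]) auto
    have "distr ?P borel (\<lambda>p. Y j p i) = distr (distr ?P (borel_vec n) (Y j)) borel (\<lambda>x. x i)" for j
      by (subst distr_distr[OF c Y]) (simp add: comp_def)
    moreover have "distr ?P borel (\<lambda>p. fst p i) = distr (distr ?P (borel_vec n) fst) borel (\<lambda>x. x i)"
      by (subst distr_distr[OF c]) (auto simp: comp_def)
    ultimately show "distr ?P borel (\<lambda>p. Y j p i) = distr ?P borel (\<lambda>p. fst p i)" for j
      unfolding dY dX by simp
    show "sets (borel :: real measure) = sigma_sets (space borel) (range (\<lambda>c. {..c}))"
      by (subst borel_eq_atMost) simp
    fix S :: "real set" assume "S \<in> range (\<lambda>c. {..c})"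
    then obtain c where S: "S = {..c}" by auto
    have "AE p in ?P. fst p i \<noteq> c"
    proof -
      have "AE x in distr ?P (borel_vec n) fst. x i \<noteq> c" unfolding dX by (rule AE_gauss_coordinate_neq[OF i])
      then show ?thesis by (rule AE_distrD[rotated]) measurable
    qed
    then have ae: "AE p in ?P. (\<lambda>j. \<bar>indicator S (Y j p i) - indicator S (fst p i) :: real\<bar>) \<longlonglongrightarrow> 0"
    proof eventually_elim
      case (elim p)
      have lim: "(\<lambda>j. Y j p i) \<longlonglongrightarrow> fst p i"
        unfolding Y_def using i s0 r(3) by (auto intro!: tendsto_eq_intros)
      have "eventually (\<lambda>j. \<bar>indicator S (Y j p i) - indicator S (fst p i) :: real\<bar> = 0) sequentially"
      proof (cases "fst p i < c")
        case True
        then have "eventually (\<lambda>j. Y j p i < c) sequentially" by (rule order_tendstoD(2)[OF lim])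
        then show ?thesis by eventually_elim (use True in \<open>auto simp: S\<close>)
      next
        case False
        then have "c < fst p i" using elim by simp
        then have "eventually (\<lambda>j. c < Y j p i) sequentially" by (rule order_tendstoD(1)[OF lim])
        then show ?thesis by eventually_elim (use False elim in \<open>auto simp: S\<close>)
      qed
      then show ?case by (rule tendsto_eventually)
    qed
    have "(\<lambda>j. \<integral>p. \<bar>indicator S (Y j p i) - indicator S (fst p i)\<bar> \<partial>?P) \<longlonglongrightarrow> (\<integral>p. (0::real) \<partial>?P)"
      by (rule integral_dominated_convergence[where w="\<lambda>_. 1"])
         (use ae fi Yi in \<open>auto simp: S indicator_def intro!: AE_I2\<close>)
    then show "(\<lambda>j. \<integral>p. \<bar>indicator S (Y j p i) - indicator S (fst p i)\<bar> \<partial>?P) \<longlonglongrightarrow> (0::real)" by simp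
  qed auto
  have "(\<lambda>j. \<integral>p. \<bar>indicator A (Y j p) - indicator A (fst p)\<bar> \<partial>?P) \<longlonglongrightarrow> (0::real)"
  proof (rule L1_indicator_convergence[where G="{{f \<in> vecs n. f i \<in> B} | i B. i \<in> {..<n} \<and> B \<in> sets borel}", OF prob _ Y _ _ _ _ A])
    show "sets (borel_vec n) = sigma_sets (space (borel_vec n)) {{f \<in> vecs n. f i \<in> B} | i B. i \<in> {..<n} \<and> B \<in> sets borel}"
      by (subst sets_PiM_single) simp
    fix S assume "S \<in> {{f \<in> vecs n. f i \<in> B} | i B. i \<in> {..<n} \<and> B \<in> sets (borel :: real measure)}"
    then obtain i B where S: "S = {f \<in> vecs n. f i \<in> B}" "i < n" "B \<in> sets borel" by auto
    have "(\<integral>p. \<bar>indicator S (Y j p) - indicator S (fst p)\<bar> \<partial>?P) = (\<integral>p. \<bar>indicator B (Y j p i) - indicator B (fst p i)\<bar> \<partial>?P :: real)" for j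
      by (intro Bochner_Integration.integral_cong) (auto simp: S Y_def space_pair_measure indicator_def)
    then show "(\<lambda>j. \<integral>p. \<bar>indicator S (Y j p) - indicator S (fst p)\<bar> \<partial>?P) \<longlonglongrightarrow> (0::real)"
      using single[OF S(2,3)] by simp
  qed (auto simp: dX dY)
  then show ?thesis unfolding Y_def .
qed

section \<open>Injectivity of the operator\<close>

lemma bdd_meas_indicator: "A \<in> sets (borel_vec n) \<Longrightarrow> bdd_meas n (indicator A)"
  by (rule bdd_measI[where C=1]) (auto simp: indicator_def)

text \<open>At parameter \<open>r^2\<close> the form is the squared norm of
  \<open>ou n r \<phi>\<close>, which therefore vanishes almost everywhere. A zero of the form thus
  passes from a parameter to its square root.\<close>

lemma stab_zero_iterate:
  assumes b: "bdd_meas n \<phi>" and r: "0 < r" "r < 1" and z: "stab n (r\<^sup>2) \<phi> \<phi> = 0" and c: "bdd_meas n \<psi>"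
  shows "stab n r \<psi> \<phi> = 0"
proof -
  have "(\<integral>x. (ou n r \<phi> x)\<^sup>2 \<partial>gauss n) = 0"
    using z stab_eq_ou_ou[OF b b r] by (simp add: power2_eq_square)
  moreover have "integrable (gauss n) (\<lambda>x. (ou n r \<phi> x)\<^sup>2)"
    using b by (auto simp: power2_eq_square intro!: bdd_meas_integrable)
  ultimately have "AE x in gauss n. (ou n r \<phi> x)\<^sup>2 = 0"
    by (subst (asm) integral_nonneg_eq_0_iff_AE) auto
  then have "AE x in gauss n. \<psi> x * ou n r \<phi> x = 0" by eventually_elim simp
  then show ?thesis unfolding stab_def by (rule integral_eq_zero_AE)
qed

text \<open>Along the iterated square roots \<open>R j\<close>, which increase to \<open>1\<close>,
  the form vanishes against every partner. The operators with these parameters tend to the identity,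
  so \<open>\<phi>\<close> has integral \<open>0\<close> over every measurable set. This strict
  positivity turns equality of energies into equality of functions, without a Hermite
  expansion.\<close>

lemma stab_eq_0_imp_AE:
  assumes b: "bdd_meas n \<phi>" and r: "0 < r" "r < 1" and z: "stab n r \<phi> \<phi> = 0"
  shows "AE x in gauss n. \<phi> x = 0"
proof -
  define R where "R j = r powr (1 / 2 ^ j)" for j :: nat
  have R: "0 < R j" "R j < 1" for j
    unfolding R_def using r by (auto simp: powr01_less_one)
  have R2: "(R (Suc j))\<^sup>2 = R j" for j
    unfolding R_def using r by (simp add: powr_realpow[symmetric] powr_powr field_simps)
  have Rlim: "R \<longlonglongrightarrow> 1"
  proof -
    have "(\<lambda>j. (1/2::real) ^ j) \<longlonglongrightarrow> 0" by (rule LIMSEQ_power_zero) simp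
    then have "(\<lambda>j. r powr ((1/2::real) ^ j)) \<longlonglongrightarrow> r powr 0" using r by (intro tendsto_powr) auto
    then show ?thesis using r by (simp add: R_def[abs_def] power_divide)
  qed
  have z0: "stab n (R j) \<phi> \<phi> = 0" for j
  proof (induction j)
    case 0 then show ?case using z r by (simp add: R_def)
  next
    case (Suc j) then show ?case using stab_zero_iterate[OF b R(1,2)[of "Suc j"] _ b] R2 by simp
  qed
  have zero: "stab n (R j) \<phi> \<psi> = 0" if "bdd_meas n \<psi>" for j \<psi>
  proof -
    have "stab n (R (Suc j)) \<psi>' \<phi> = 0" if "bdd_meas n \<psi>'" for \<psi>' j
      using stab_zero_iterate[OF b R(1,2)[of "Suc j"] _ that] R2 z0[of j] by simp
    note 1 = this
    have "stab n (R j) \<phi> \<psi> = stab n ((R (Suc j))\<^sup>2) \<psi> \<phi>"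
      using stab_sym[OF b that, of "R j"] R[of j] R2 by simp
    also have "\<dots> = (\<integral>x. ou n (R (Suc j)) \<psi> x * ou n (R (Suc j)) \<phi> x \<partial>gauss n)"
      using R[of "Suc j"] by (intro stab_eq_ou_ou that b)
    also have "\<dots> = stab n (R (Suc j)) (ou n (R (Suc j)) \<psi>) \<phi>" by (simp add: stab_def)
    also have "\<dots> = 0" using that by (intro 1) auto
    finally show ?thesis .
  qed
  obtain C where C: "C \<ge> 0" "\<And>x. x \<in> vecs n \<Longrightarrow> \<bar>\<phi> x\<bar> \<le> C" using bdd_measE[OF b] by metis
  have int0: "(\<integral>x. \<phi> x * indicator A x \<partial>gauss n) = 0" if A: "A \<in> sets (borel_vec n)" for A
  proof -
    let ?P = "gauss_sq n"
    let ?Y = "\<lambda>j p. lincomb n (R j) (sqrt (1 - (R j)\<^sup>2)) (fst p) (snd p)"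
    have bA: "bdd_meas n (\<lambda>x. indicator A x)" by (rule bdd_meas_indicator[OF A])
    note [measurable] = A bdd_meas_measurable[OF b]
    \<comment> \<open>Since \<open>stab n (R j) \<phi> (indicator A)\<close> is \<open>0\<close>, it
      may be subtracted freely; what remains is the difference of the indicator at two correlated
      points.\<close>
    have "\<bar>\<integral>x. \<phi> x * indicator A x \<partial>gauss n\<bar> \<le> C * (\<integral>p. \<bar>indicator A (?Y j p) - indicator A (fst p)\<bar> \<partial>?P)" for j
    proof -
      have i1: "integrable ?P (\<lambda>p. \<phi> (fst p) * indicator A (?Y j p))" by (rule integrable_pair(2)[OF b bA])
      have i2: "integrable ?P (\<lambda>p. \<phi> (fst p) * indicator A (fst p))"
        by (rule integrable_gauss2[where C=C], measurable) (use C in \<open>auto simp: indicator_def\<close>)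
      have "(\<integral>x. \<phi> x * indicator A x \<partial>gauss n) = (\<integral>p. \<phi> (fst p) * indicator A (fst p) \<partial>?P) - stab n (R j) \<phi> (indicator A)"
        using zero[OF bA, of j] integral_gauss_fst[of n "\<lambda>x. \<phi> x * indicator A x"] b bA by (simp add: bdd_meas_mult)
      also have "\<dots> = (\<integral>p. \<phi> (fst p) * indicator A (fst p) - \<phi> (fst p) * indicator A (?Y j p) \<partial>?P)"
        using i1 i2 stab_pair[OF b bA, of "R j"] by simp
      finally have e: "(\<integral>x. \<phi> x * indicator A x \<partial>gauss n) = \<dots>" .
      have "\<bar>\<integral>x. \<phi> x * indicator A x \<partial>gauss n\<bar> \<le> (\<integral>p. \<bar>\<phi> (fst p) * indicator A (fst p) - \<phi> (fst p) * indicator A (?Y j p)\<bar> \<partial>?P)"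
        unfolding e using integral_norm_bound[of ?P "\<lambda>p. \<phi> (fst p) * indicator A (fst p) - \<phi> (fst p) * indicator A (?Y j p)"] by simp
      also have "\<dots> \<le> (\<integral>p. C * \<bar>indicator A (?Y j p) - indicator A (fst p)\<bar> \<partial>?P)"
      proof (rule integral_mono)
        show "integrable ?P (\<lambda>p. \<bar>\<phi> (fst p) * indicator A (fst p) - \<phi> (fst p) * indicator A (?Y j p)\<bar>)"
          using i1 i2 by auto
        show "integrable ?P (\<lambda>p. C * \<bar>indicator A (?Y j p) - indicator A (fst p)\<bar>)"
          by (rule integrable_gauss2[where C=C], measurable) (use C in \<open>auto simp: indicator_def\<close>)
        fix p assume "p \<in> space ?P"
        then have "\<bar>\<phi> (fst p)\<bar> \<le> C" using C by (auto simp: space_pair_measure)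
        then show "\<bar>\<phi> (fst p) * indicator A (fst p) - \<phi> (fst p) * indicator A (?Y j p)\<bar> \<le> C * \<bar>indicator A (?Y j p) - indicator A (fst p)\<bar>"
          by (auto simp: indicator_def)
      qed
      finally show ?thesis by simp
    qed
    moreover have "(\<lambda>j. C * (\<integral>p. \<bar>indicator A (?Y j p) - indicator A (fst p)\<bar> \<partial>?P)) \<longlonglongrightarrow> C * 0"
      by (intro tendsto_mult tendsto_const ou_indicator_convergence R Rlim A)
    ultimately have "\<bar>\<integral>x. \<phi> x * indicator A x \<partial>gauss n\<bar> \<le> C * 0"
      by (intro LIMSEQ_le_const) auto
    then show ?thesis by simp
  qed
  note [measurable] = bdd_meas_measurable[OF b]
  have neg: "AE x in gauss n. \<psi> x \<le> 0" if \<psi>: "bdd_meas n \<psi>" and 0: "\<And>A. A \<in> sets (borel_vec n) \<Longrightarrow> (\<integral>x. \<psi> x * indicator A x \<partial>gauss n) = 0" for \<psi>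
  proof -
    note [measurable] = bdd_meas_measurable[OF \<psi>]
    let ?A = "{x \<in> space (borel_vec n). \<psi> x > 0}"
    have A: "?A \<in> sets (borel_vec n)" by measurable
    have "integrable (gauss n) (\<lambda>x. \<psi> x * indicator ?A x)"
      using \<psi> bdd_meas_indicator[OF A] by (intro bdd_meas_integrable) auto
    moreover have "AE x in gauss n. 0 \<le> \<psi> x * indicator ?A x" by (auto simp: indicator_def)
    ultimately have "AE x in gauss n. \<psi> x * indicator ?A x = 0"
      using 0[OF A] integral_nonneg_eq_0_iff_AE by blast
    then show ?thesis
      by (rule AE_mp) (auto simp: indicator_def intro!: AE_I2)
  qed
  have "AE x in gauss n. \<phi> x \<le> 0" using b int0 by (rule neg)
  moreover have "AE x in gauss n. - \<phi> x \<le> 0" using b int0 by (intro neg) auto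
  ultimately show ?thesis by eventually_elim auto
qed

section \<open>Duality for the linearized problem\<close>

abbreviation vnorm :: "nat \<Rightarrow> (nat \<Rightarrow> real) \<Rightarrow> real" where
  "vnorm k v \<equiv> L2_set v {..<k}"

lemma vnorm_sq: "(vnorm k v)\<^sup>2 = inner_k k v v"
  by (simp add: L2_set_def inner_k_def power2_eq_square sum_nonneg)

lemma inner_k_le_vnorm: "inner_k k u v \<le> vnorm k u * vnorm k v"
proof -
  have "inner_k k u v \<le> (\<Sum>i<k. \<bar>u i\<bar> * \<bar>v i\<bar>)"
    unfolding inner_k_def by (intro sum_mono) (metis abs_ge_self abs_mult)
  also have "\<dots> \<le> vnorm k u * vnorm k v" by (rule L2_set_mult_ineq)
  finally show ?thesis .
qed

lemma vnorm_le_1_iff: "inner_k k v v \<le> 1 \<longleftrightarrow> vnorm k v \<le> 1"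
  unfolding vnorm_sq[symmetric] by (simp add: abs_square_le_1 L2_set_nonneg)

lemma inner_k_ball_le:
  assumes "inner_k k v v \<le> 1" shows "inner_k k u v \<le> vnorm k u"
proof -
  have "inner_k k u v \<le> vnorm k u * vnorm k v" by (rule inner_k_le_vnorm)
  also have "\<dots> \<le> vnorm k u * 1"
    using assms by (intro mult_left_mono) (auto simp: vnorm_le_1_iff L2_set_nonneg)
  finally show ?thesis by simp
qed

lemma abs_nth_le_vnorm: "i < k \<Longrightarrow> \<bar>v i\<bar> \<le> vnorm k v"
  using member_le_L2_set[of "{..<k}" i "\<lambda>i. \<bar>v i\<bar>"] by (simp add: L2_set_def)

lemma vnorm_cong: "(\<And>i. i < k \<Longrightarrow> u i = v i) \<Longrightarrow> vnorm k u = vnorm k v"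
  by (rule L2_set_cong) auto

lemma vnorm_diff_triangle: "vnorm k v \<le> vnorm k u + vnorm k (\<lambda>i. u i - v i)"
proof -
  have "vnorm k v = vnorm k (\<lambda>i. u i + (v i - u i))" by simp
  also have "\<dots> \<le> vnorm k u + vnorm k (\<lambda>i. v i - u i)" by (rule L2_set_triangle_ineq)
  also have "vnorm k (\<lambda>i. v i - u i) = vnorm k (\<lambda>i. u i - v i)"
    by (simp add: L2_set_def power2_commute)
  finally show ?thesis .
qed

lemma vnorm_scale: "vnorm k (\<lambda>i. c * v i) = \<bar>c\<bar> * vnorm k v"
  by (simp add: L2_set_def power_mult_distrib sum_distrib_left[symmetric] real_sqrt_mult)

lemma vnorm_eq_0: "vnorm k v = 0 \<longleftrightarrow> (\<forall>i<k. v i = 0)"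
  by (subst L2_set_eq_0_iff) auto

lemma tendsto_vnorm:
  "(\<And>i. i < k \<Longrightarrow> ((\<lambda>j. f j i) \<longlongrightarrow> l i) F) \<Longrightarrow> ((\<lambda>j. vnorm k (f j)) \<longlongrightarrow> vnorm k l) F"
  unfolding L2_set_def by (intro tendsto_real_sqrt tendsto_sum tendsto_power) auto

lemma bdd_meas_vnorm:
  fixes F :: "(nat \<Rightarrow> real) \<Rightarrow> nat \<Rightarrow> real"
  assumes "\<And>i. i < k \<Longrightarrow> bdd_meas n (\<lambda>x. F x i)"
  shows "bdd_meas n (\<lambda>x. vnorm k (F x))"
proof -
  have "\<exists>C. \<forall>x\<in>vecs n. \<bar>F x i\<bar> \<le> C" if "i < k" for i
    using assms[OF that] unfolding bdd_meas_def by blast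
  then obtain C where C: "\<And>i x. i < k \<Longrightarrow> x\<in>vecs n \<Longrightarrow> \<bar>F x i\<bar> \<le> C i" by metis
  have "vnorm k (F x) \<le> (\<Sum>i<k. C i)" if "x\<in>vecs n" for x
    using L2_set_le_sum_abs[of "F x" "{..<k}"] sum_mono[of "{..<k}" "\<lambda>i. \<bar>F x i\<bar>" C] C that by fastforce
  moreover have "(\<lambda>x. vnorm k (F x)) \<in> borel_measurable (borel_vec n)"
    unfolding L2_set_def using assms[THEN bdd_meas_measurable] by (auto intro!: borel_measurable_sum)
  ultimately show ?thesis by (intro bdd_measI) (auto simp: L2_set_nonneg)
qed

lemma integral_vnorm_tendsto:
  assumes m: "\<And>j i. i < k \<Longrightarrow> (\<lambda>x. H j x i) \<in> borel_measurable (borel_vec n)"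
    and m': "\<And>i. i < k \<Longrightarrow> (\<lambda>x. H' x i) \<in> borel_measurable (borel_vec n)"
    and C: "\<And>j i x. i < k \<Longrightarrow> x \<in> vecs n \<Longrightarrow> \<bar>H j x i\<bar> \<le> C"
    and lim: "\<And>i x. i < k \<Longrightarrow> x \<in> vecs n \<Longrightarrow> (\<lambda>j. H j x i) \<longlonglongrightarrow> H' x i"
  shows "(\<lambda>j. \<integral>x. vnorm k (H j x) \<partial>gauss n) \<longlonglongrightarrow> (\<integral>x. vnorm k (H' x) \<partial>gauss n)"
proof (rule integral_dominated_convergence[where w="\<lambda>_. real k * C"])
  show "(\<lambda>x. vnorm k (H' x)) \<in> borel_measurable (gauss n)" "\<And>j. (\<lambda>x. vnorm k (H j x)) \<in> borel_measurable (gauss n)"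
    unfolding L2_set_def using m m' by (auto intro!: borel_measurable_sum simp: measurable_cong_sets[OF sets_gauss refl])
  show "AE x in gauss n. (\<lambda>j. vnorm k (H j x)) \<longlonglongrightarrow> vnorm k (H' x)"
    using lim by (intro AE_I2 tendsto_vnorm) auto
  show "AE x in gauss n. norm (vnorm k (H j x)) \<le> real k * C" for j
  proof (rule AE_I2)
    fix x assume x: "x \<in> space (gauss n)"
    have "vnorm k (H j x) \<le> (\<Sum>i<k. \<bar>H j x i\<bar>)" by (rule L2_set_le_sum_abs)
    also have "\<dots> \<le> (\<Sum>i<k. C)" using C x by (intro sum_mono) auto
    finally show "norm (vnorm k (H j x)) \<le> real k * C" by (simp add: L2_set_nonneg)
  qed
qed simp

lemma vnorm_sub_scale_sq:
  "(vnorm k (\<lambda>i. y i - t * e i))\<^sup>2 = (vnorm k y)\<^sup>2 - 2 * t * inner_k k y e + t\<^sup>2 * (vnorm k e)\<^sup>2"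
  unfolding vnorm_sq inner_k_def
  by (simp add: sum_subtractf sum.distrib sum_distrib_left algebra_simps power2_eq_square)

lemma bdd_meas_uniform_bound:
  fixes F :: "(nat \<Rightarrow> real) \<Rightarrow> nat \<Rightarrow> real"
  assumes "\<And>i. i < k \<Longrightarrow> bdd_meas n (\<lambda>x. F x i)"
  obtains C where "C \<ge> 0" "\<And>i x. i < k \<Longrightarrow> x \<in> vecs n \<Longrightarrow> \<bar>F x i\<bar> \<le> C"
proof -
  obtain C where C: "C \<ge> 0" "\<And>x. x \<in> vecs n \<Longrightarrow> \<bar>vnorm k (F x)\<bar> \<le> C"
    using bdd_measE[OF bdd_meas_vnorm[of k n F]] assms by metis
  then have "i < k \<Longrightarrow> x \<in> vecs n \<Longrightarrow> \<bar>F x i\<bar> \<le> C" for i x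
    using abs_nth_le_vnorm[where i=i and k=k and v="F x"] by fastforce
  then show thesis using that C by blast
qed

text \<open>Multiplying the difference of norms by their sum leaves a polynomial numerator over a
  denominator that tends to \<open>2 |y|\<close>.\<close>

lemma norm_difference_quotient_limit:
  assumes "vnorm k y \<noteq> 0"
  shows "(\<lambda>j. (vnorm k (\<lambda>i. y i - (1 / real (Suc j)) * e i) - vnorm k y) / (1 / real (Suc j)))
    \<longlonglongrightarrow> - inner_k k y e / vnorm k y"
proof -
  let ?Y = "vnorm k y"
  have Y: "?Y > 0" using assms L2_set_nonneg[of y "{..<k}"] by linarith
  have t0: "(\<lambda>j. 1 / real (Suc j)) \<longlonglongrightarrow> 0" using LIMSEQ_inverse_real_of_nat by (simp add: inverse_eq_divide)
  have n: "(\<lambda>j. vnorm k (\<lambda>i. y i - (1 / real (Suc j)) * e i)) \<longlonglongrightarrow> ?Y"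
  proof (rule tendsto_vnorm)
    have "(\<lambda>j. y i - (1 / real (Suc j)) * e i) \<longlonglongrightarrow> y i - 0 * e i" for i
      by (intro tendsto_intros t0)
    then show "(\<lambda>j. y i - (1 / real (Suc j)) * e i) \<longlonglongrightarrow> y i" for i by simp
  qed
  have eq: "(vnorm k (\<lambda>i. y i - t * e i) - ?Y) / t = (- 2 * inner_k k y e + t * (vnorm k e)\<^sup>2) / (vnorm k (\<lambda>i. y i - t * e i) + ?Y)"
    if t: "t > 0" for t
  proof -
    let ?A = "vnorm k (\<lambda>i. y i - t * e i)"
    have "?A + ?Y > 0" using Y L2_set_nonneg by (simp add: add_nonneg_pos)
    moreover have "(?A - ?Y) * (?A + ?Y) = t * (- 2 * inner_k k y e + t * (vnorm k e)\<^sup>2)"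
      using vnorm_sub_scale_sq[where k=k and y=y and t=t and e=e] by (simp add: algebra_simps power2_eq_square)
    ultimately show ?thesis using t by (simp add: field_simps)
  qed
  have "(\<lambda>j. (- 2 * inner_k k y e + (1 / real (Suc j)) * (vnorm k e)\<^sup>2) / (vnorm k (\<lambda>i. y i - (1 / real (Suc j)) * e i) + ?Y))
      \<longlonglongrightarrow> (- 2 * inner_k k y e + 0 * (vnorm k e)\<^sup>2) / (?Y + ?Y)"
    using Y by (intro tendsto_intros t0 n) auto
  moreover have "(- 2 * inner_k k y e + 0 * (vnorm k e)\<^sup>2) / (?Y + ?Y) = - inner_k k y e / ?Y"
    using Y by (simp add: field_simps)
  ultimately show ?thesis by (simp only: eq[OF divide_pos_pos[OF zero_less_one of_nat_0_less_iff[THEN iffD2, OF zero_less_Suc]]])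
qed

text \<open>The functional \<open>\<Phi>\<close> is coercive, as
  \<open>|\<nu>| \<le> \<Phi> 0 + \<Phi> \<nu>\<close>. A minimizing sequence is therefore bounded,
  and dominated convergence passes to the limit along a subsequence.\<close>

lemma dual_minimizer_exists:
  assumes G: "\<And>i. i < k \<Longrightarrow> bdd_meas n (\<lambda>x. G x i)"
  shows "\<exists>\<nu>. \<forall>\<mu>. (\<integral>x. vnorm k (\<lambda>i. G x i - \<nu> i) \<partial>gauss n) \<le> (\<integral>x. vnorm k (\<lambda>i. G x i - \<mu> i) \<partial>gauss n)"
proof -
  define \<Phi> where "\<Phi> \<nu> = (\<integral>x. vnorm k (\<lambda>i. G x i - \<nu> i) \<partial>gauss n)" for \<nu>
  have int: "integrable (gauss n) (\<lambda>x. vnorm k (\<lambda>i. G x i - \<nu> i))" for \<nu>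
    using G by (intro bdd_meas_integrable bdd_meas_vnorm bdd_meas_diff) auto
  have pos: "0 \<le> \<Phi> \<nu>" for \<nu> unfolding \<Phi>_def by (simp add: L2_set_nonneg)
  define I where "I = Inf (range \<Phi>)"
  have bb: "bdd_below (range \<Phi>)" using pos by (auto intro!: bdd_belowI)
  have I: "I \<le> \<Phi> \<nu>" for \<nu> unfolding I_def using bb by (intro cInf_lower) auto
  have "\<exists>\<nu>. \<Phi> \<nu> < I + 1 / real (Suc j)" for j
  proof -
    have "Inf (range \<Phi>) < I + 1 / real (Suc j)" unfolding I_def by simp
    then show ?thesis using bb by (subst (asm) cInf_less_iff) auto
  qed
  then obtain a where a: "\<And>j. \<Phi> (a j) < I + 1 / real (Suc j)" by metis
  have nb: "vnorm k \<nu> \<le> \<Phi> (\<lambda>_. 0) + \<Phi> \<nu>" for \<nu>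
  proof -
    have "vnorm k \<nu> \<le> vnorm k (\<lambda>i. G x i - 0) + vnorm k (\<lambda>i. G x i - \<nu> i)" for x
      using vnorm_diff_triangle[where v=\<nu> and u="G x" and k=k] by simp
    then have "(\<integral>x. vnorm k \<nu> \<partial>gauss n) \<le> (\<integral>x. vnorm k (\<lambda>i. G x i - 0) + vnorm k (\<lambda>i. G x i - \<nu> i) \<partial>gauss n)"
      by (intro integral_mono Bochner_Integration.integrable_add int) auto
    then show ?thesis using int[of "\<lambda>_. 0"] int[of \<nu>] gauss.prob_space[of n] by (simp add: \<Phi>_def)
  qed
  \<comment> \<open>Coordinates from \<open>k\<close> on do not enter \<open>vnorm k\<close>.
    Setting them to \<open>0\<close> bounds the sequence in every coordinate, as the compactness
    lemma asks.\<close>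
  define b where "b j i = (if i < k then a j i else 0)" for j i
  have \<Phi>b: "\<Phi> (b j) = \<Phi> (a j)" for j
    unfolding \<Phi>_def b_def by (intro Bochner_Integration.integral_cong refl vnorm_cong) auto
  have bbd: "\<bar>b j i\<bar> \<le> \<Phi> (\<lambda>_. 0) + I + 1" for j i
  proof (cases "i < k")
    case True
    have "1 / real (Suc j) \<le> 1" by simp
    then have "\<bar>a j i\<bar> \<le> \<Phi> (\<lambda>_. 0) + I + 1"
      using abs_nth_le_vnorm[OF True, of "a j"] nb[of "a j"] a[of j] by linarith
    then show ?thesis using True by (simp add: b_def)
  next
    case False
    have "0 \<le> I" unfolding I_def using pos by (intro cInf_greatest) auto
    then show ?thesis using False pos[of "\<lambda>_. 0"] by (simp add: b_def)
  qed
  obtain l r where r: "strict_mono (r :: nat \<Rightarrow> nat)" and l: "\<And>i. (\<lambda>j. b (r j) i) \<longlonglongrightarrow> l i"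
    using bounded_coordinates_subseq[of b "\<lambda>_. \<Phi> (\<lambda>_. 0) + I + 1"] bbd by metis
  obtain C where C: "\<And>i x. i < k \<Longrightarrow> x \<in> vecs n \<Longrightarrow> \<bar>G x i\<bar> \<le> C"
    using bdd_meas_uniform_bound[of k n G] G by metis
  have "(\<lambda>j. \<Phi> (b (r j))) \<longlonglongrightarrow> \<Phi> l"
    unfolding \<Phi>_def
  proof (rule integral_vnorm_tendsto[where C="C + (\<Phi> (\<lambda>_. 0) + I + 1)"])
    show "(\<lambda>x. G x i - b (r j) i) \<in> borel_measurable (borel_vec n)" "(\<lambda>x. G x i - l i) \<in> borel_measurable (borel_vec n)" if "i < k" for i j
      using G[OF that, THEN bdd_meas_measurable] by auto
    show "\<bar>G x i - b (r j) i\<bar> \<le> C + (\<Phi> (\<lambda>_. 0) + I + 1)" if "i < k" "x \<in> vecs n" for i j x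
      using C[OF that] bbd[of "r j" i] by linarith
    show "(\<lambda>j. G x i - b (r j) i) \<longlonglongrightarrow> G x i - l i" for i x
      by (intro tendsto_intros l)
  qed
  moreover have "(\<lambda>j. \<Phi> (b (r j))) \<longlonglongrightarrow> I"
  proof (rule tendsto_sandwich[of "\<lambda>_. I" _ _ "\<lambda>j. I + 1 / real (Suc (r j))"])
    have "(\<lambda>j. 1 / real (Suc j)) \<longlonglongrightarrow> 0" using LIMSEQ_inverse_real_of_nat by (simp add: inverse_eq_divide)
    from LIMSEQ_subseq_LIMSEQ[OF this r] have "(\<lambda>j. 1 / real (Suc (r j))) \<longlonglongrightarrow> 0" by (simp add: comp_def)
    from tendsto_add[OF tendsto_const this, of I]
    show "(\<lambda>j. I + 1 / real (Suc (r j))) \<longlonglongrightarrow> I" by simp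
  qed (use I a \<Phi>b in \<open>auto intro!: always_eventually less_imp_le\<close>)
  ultimately have "\<Phi> l = I" using LIMSEQ_unique by blast
  then have "\<forall>\<mu>. \<Phi> l \<le> \<Phi> \<mu>" using I by simp
  then show ?thesis unfolding \<Phi>_def by (intro exI[of _ l])
qed

text \<open>Equality in Cauchy-Schwarz at every point makes \<open>u\<close> a maximizer of the
  linear functional; stationarity of the minimizer \<open>\<nu>\<close> is what makes mean zero
  possible. The last property, that \<open>u\<close> depends only on the values of \<open>G\<close>,
  later transfers invariance from \<open>N\<close> to \<open>u\<close>.\<close>

lemma dual_maximizer:
  assumes G: "\<And>i. i < k \<Longrightarrow> bdd_meas n (\<lambda>x. G x i)"
  obtains \<nu> u where "ball_valued n k u" "mean_zero n k u"
    "\<And>x. inner_k k (\<lambda>i. G x i - \<nu> i) (u x) = vnorm k (\<lambda>i. G x i - \<nu> i)"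
    "\<And>x y. (\<And>i. i < k \<Longrightarrow> G x i = G y i) \<Longrightarrow> u x = u y"
proof -
  obtain \<nu> where min: "\<And>\<mu>. (\<integral>x. vnorm k (\<lambda>i. G x i - \<nu> i) \<partial>gauss n) \<le> (\<integral>x. vnorm k (\<lambda>i. G x i - \<mu> i) \<partial>gauss n)"
    using dual_minimizer_exists[of k n G] G by blast
  define y where "y x i = G x i - \<nu> i" for x i
  define Y where "Y x = vnorm k (y x)" for x
  have ybm: "bdd_meas n (\<lambda>x. y x i)" if "i < k" for i unfolding y_def using G[OF that] by auto
  have Ybm: "bdd_meas n Y" unfolding Y_def[abs_def] using ybm by (rule bdd_meas_vnorm)
  have Ypos: "Y x \<ge> 0" for x unfolding Y_def by (rule L2_set_nonneg)
  note [measurable] = bdd_meas_measurable[OF Ybm]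
  \<comment> \<open>Division by zero gives \<open>V x i = 0\<close> where \<open>Y x = 0\<close>, so
    \<open>a\<close> below collects the mean of the unit vectors over the set where \<open>Y\<close>
    is positive.\<close>
  define V where "V x i = y x i / Y x" for x i
  have Vbm: "bdd_meas n (\<lambda>x. V x i)" if "i < k" for i
  proof (rule bdd_measI[where C=1])
    show "(\<lambda>x. V x i) \<in> borel_measurable (borel_vec n)"
      unfolding V_def using bdd_meas_measurable[OF ybm[OF that]] by measurable
    show "\<bar>V x i\<bar> \<le> 1" for x
      using abs_nth_le_vnorm[OF that, of "y x"] Ypos[of x] by (auto simp: V_def Y_def[symmetric] divide_le_eq)
  qed
  define Z where "Z = {x \<in> space (borel_vec n). Y x = 0}"
  have Z[measurable]: "Z \<in> sets (borel_vec n)" unfolding Z_def by measurable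
  define p where "p = measure (gauss n) Z"
  have p0: "p \<ge> 0" by (simp add: p_def)
  define a where "a i = (\<integral>x. V x i \<partial>gauss n)" for i
  \<comment> \<open>One-sided directional derivative at the minimizer: where \<open>Y = 0\<close>
    the norm grows at rate \<open>|e|\<close>, elsewhere at the rate minus the product of
    \<open>V\<close> and \<open>e\<close>. The choice \<open>e = a\<close> will give
    \<open>|a| \<le> p\<close>.\<close>
  have foc: "inner_k k a e \<le> p * vnorm k e" for e
  proof -
    let ?q = "\<lambda>j x. (vnorm k (\<lambda>i. y x i - (1 / real (Suc j)) * e i) - Y x) / (1 / real (Suc j))"
    let ?l = "\<lambda>x. indicator Z x * vnorm k e - inner_k k (V x) e"
    have bq: "bdd_meas n (\<lambda>x. vnorm k (\<lambda>i. y x i - c * e i))" for c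
      using ybm by (intro bdd_meas_vnorm) auto
    have lm: "bdd_meas n ?l" 
      unfolding inner_k_def using Vbm bdd_meas_indicator[OF Z]
      by (intro bdd_meas_diff bdd_meas_mult bdd_meas_sum) auto
    have "(\<lambda>j. \<integral>x. ?q j x \<partial>gauss n) \<longlonglongrightarrow> (\<integral>x. ?l x \<partial>gauss n)"
    proof (rule integral_dominated_convergence[where w="\<lambda>_. vnorm k e"])
      show "?l \<in> borel_measurable (gauss n)" using bdd_meas_measurable[OF lm] by simp
      show "?q j \<in> borel_measurable (gauss n)" for j using bdd_meas_measurable[OF bq] by measurable
      show "AE x in gauss n. norm (?q j x) \<le> vnorm k e" for j
      proof (rule AE_I2)
        fix x
        define t where "t = 1 / real (Suc j)"
        have t: "t > 0" by (simp add: t_def)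
        have "vnorm k (\<lambda>i. y x i - t * e i) \<le> Y x + t * vnorm k e"
          using vnorm_diff_triangle[where v="\<lambda>i. y x i - t * e i" and u="y x" and k=k] t by (simp add: Y_def vnorm_scale)
        moreover have "Y x \<le> vnorm k (\<lambda>i. y x i - t * e i) + t * vnorm k e"
          using vnorm_diff_triangle[where v="y x" and u="\<lambda>i. y x i - t * e i" and k=k] vnorm_scale[where k=k and c="-t" and v=e] t by (simp add: Y_def)
        ultimately have "\<bar>vnorm k (\<lambda>i. y x i - t * e i) - Y x\<bar> \<le> t * vnorm k e" by linarith
        then show "norm (?q j x) \<le> vnorm k e" using t unfolding t_def[symmetric] by (simp add: divide_le_eq mult.commute) 
      qed
      show "AE x in gauss n. (\<lambda>j. ?q j x) \<longlonglongrightarrow> ?l x"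
      proof (rule AE_I2)
        fix x assume x: "x \<in> space (gauss n)"
        show "(\<lambda>j. ?q j x) \<longlonglongrightarrow> ?l x"
        proof (cases "Y x = 0")
          case True
          then have y0: "y x i = 0" if "i < k" for i using that by (auto simp: Y_def vnorm_eq_0)
          have "?q j x = vnorm k e" for j
          proof -
            have "vnorm k (\<lambda>i. y x i - (1 / real (Suc j)) * e i) = vnorm k (\<lambda>i. (- (1 / real (Suc j))) * e i)"
              by (rule vnorm_cong) (simp add: y0)
            also have "\<dots> = (1 / real (Suc j)) * vnorm k e" by (subst vnorm_scale) simp
            finally show ?thesis using True by (simp del: of_nat_Suc)
          qed
          moreover have "?l x = vnorm k e" using True x by (simp add: Z_def V_def inner_k_def)
          ultimately show ?thesis by simp
        next
          case False
          have "- inner_k k (y x) e / vnorm k (y x) = ?l x"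
            using False by (simp add: Z_def V_def inner_k_def Y_def sum_divide_distrib)
          then show ?thesis using norm_difference_quotient_limit[where k=k and y="y x" and e=e] False by (simp add: Y_def)
        qed
      qed
    qed simp
    moreover have "0 \<le> (\<integral>x. ?q j x \<partial>gauss n)" for j
    proof -
      let ?t = "1 / real (Suc j)"
      have "(\<integral>x. Y x \<partial>gauss n) \<le> (\<integral>x. vnorm k (\<lambda>i. y x i - ?t * e i) \<partial>gauss n)"
        using min[of "\<lambda>i. \<nu> i + ?t * e i"] unfolding Y_def y_def[abs_def] diff_diff_eq .
      then have "0 \<le> ((\<integral>x. vnorm k (\<lambda>i. y x i - ?t * e i) \<partial>gauss n) - (\<integral>x. Y x \<partial>gauss n)) / ?t"
        by (intro divide_nonneg_pos) auto
      also have "\<dots> = (\<integral>x. ?q j x \<partial>gauss n)"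
        by (subst integral_divide_zero)
          (simp only: Bochner_Integration.integral_diff[OF bdd_meas_integrable[OF bq] bdd_meas_integrable[OF Ybm]])
      finally show ?thesis .
    qed
    ultimately have "0 \<le> (\<integral>x. ?l x \<partial>gauss n)" by (intro LIMSEQ_le_const) auto
    also have "(\<integral>x. ?l x \<partial>gauss n) = p * vnorm k e - inner_k k a e"
    proof -
      have i1: "integrable (gauss n) (\<lambda>x. indicator Z x * vnorm k e)"
        using bdd_meas_indicator[OF Z] by (intro bdd_meas_integrable bdd_meas_mult) auto
      have i2: "integrable (gauss n) (\<lambda>x. V x i * e i)" if "i < k" for i
        using Vbm[OF that] by (intro bdd_meas_integrable bdd_meas_mult) auto
      have "(\<integral>x. inner_k k (V x) e \<partial>gauss n) = inner_k k a e"
        unfolding inner_k_def a_def using i2 by (subst Bochner_Integration.integral_sum) auto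
      moreover have "integrable (gauss n) (\<lambda>x. inner_k k (V x) e)"
        unfolding inner_k_def using i2 by (intro Bochner_Integration.integrable_sum) auto
      ultimately show ?thesis using i1 sets.sets_into_space[OF Z]
        by (simp add: p_def Int_absorb2)
    qed
    finally show ?thesis by simp
  qed
  have ap: "vnorm k a \<le> p"
  proof (cases "vnorm k a = 0")
    case False
    then have "vnorm k a > 0" using L2_set_nonneg[of a "{..<k}"] by linarith
    moreover have "vnorm k a * vnorm k a \<le> p * vnorm k a"
      using foc[of a] vnorm_sq[where k=k and v=a] by (simp add: power2_eq_square)
    ultimately show ?thesis by simp
  qed (use p0 in simp)
  \<comment> \<open>The constant \<open>- a / p\<close> on \<open>{Y = 0}\<close> cancels the mean
    \<open>a\<close> of \<open>V\<close>, and it lies in the ball because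
    \<open>|a| \<le> p\<close>. If \<open>p = 0\<close>, then \<open>a = 0\<close> in the first
    \<open>k\<close> coordinates and nothing has to be cancelled.\<close>
  define u where "u x = (\<lambda>i\<in>{..<k}. if Y x = 0 then - a i / p else V x i)" for x
  have u_nth: "u x i = (if Y x = 0 then - a i / p else V x i)" if "i < k" for x i using that by (simp add: u_def)
  show thesis
  proof (rule that[of u \<nu>])
    show "ball_valued n k u"
      unfolding ball_valued_def
    proof (intro conjI ballI)
      show "u \<in> measurable (borel_vec n) (borel_vec k)"
        unfolding u_def[abs_def]
      proof (rule measurable_restrict)
        fix i assume "i \<in> {..<k}"
        then have [measurable]: "(\<lambda>x. V x i) \<in> borel_measurable (borel_vec n)" using Vbm bdd_meas_measurable by auto
        show "(\<lambda>x. if Y x = 0 then - a i / p else V x i) \<in> borel_measurable (borel_vec n)" by measurable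
      qed
      fix x
      show "inner_k k (u x) (u x) \<le> 1"
      proof (cases "Y x = 0")
        case True
        have "vnorm k (u x) = vnorm k (\<lambda>i. (- 1 / p) * a i)" by (rule vnorm_cong) (simp add: u_nth True)
        also have "\<dots> = vnorm k a / p" using p0 by (subst vnorm_scale) simp
        also have "\<dots> \<le> 1" using ap p0 by (auto simp: divide_le_eq)
        finally show ?thesis by (simp add: vnorm_le_1_iff)
      next
        case False
        have "vnorm k (u x) = vnorm k (\<lambda>i. (1 / Y x) * y x i)" by (rule vnorm_cong) (simp add: u_nth False V_def)
        also have "\<dots> = 1" using False Ypos[of x] by (subst vnorm_scale) (simp add: Y_def)
        finally show ?thesis by (simp add: vnorm_le_1_iff)
      qed
    qed
    show "mean_zero n k u"
      unfolding mean_zero_def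
    proof (intro allI impI)
      fix i assume i: "i < k"
      have "(\<integral>x. u x i \<partial>gauss n) = (\<integral>x. V x i + indicator Z x * (- a i / p) \<partial>gauss n)"
        by (intro Bochner_Integration.integral_cong) (auto simp: u_nth[OF i] Z_def V_def)
      also have "\<dots> = a i + p * (- a i / p)"
        using bdd_meas_integrable[OF Vbm[OF i]] bdd_meas_integrable[OF bdd_meas_indicator[OF Z]] sets.sets_into_space[OF Z]
        by (subst Bochner_Integration.integral_add) (auto simp: a_def p_def Int_absorb2)
      also have "\<dots> = 0"
      proof (cases "p = 0")
        case True
        then have "\<bar>a i\<bar> \<le> 0" using ap abs_nth_le_vnorm[OF i, of a] by linarith
        then show ?thesis by simp
      qed simp
      finally show "(\<integral>x. u x i \<partial>gauss n) = 0" .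
    qed
    show "inner_k k (\<lambda>i. G x i - \<nu> i) (u x) = vnorm k (\<lambda>i. G x i - \<nu> i)" for x
    proof (cases "Y x = 0")
      case True
      then have "y x i = 0" if "i < k" for i using that by (auto simp: Y_def vnorm_eq_0)
      then have "inner_k k (y x) (u x) = 0" by (simp add: inner_k_def)
      then show ?thesis using True by (simp add: y_def[abs_def] Y_def)
    next
      case False
      have "inner_k k (y x) (u x) = inner_k k (y x) (y x) / Y x"
        by (simp add: inner_k_def u_nth False V_def sum_divide_distrib)
      also have "\<dots> = Y x" using False by (simp add: vnorm_sq[symmetric] Y_def power2_eq_square)
      finally show ?thesis by (simp add: y_def[abs_def] Y_def)
    qed
    show "u x = u x'" if "\<And>i. i < k \<Longrightarrow> G x i = G x' i" for x x'
    proof -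
      have "Y x = Y x'" unfolding Y_def y_def using that by (intro vnorm_cong) auto
      then show ?thesis unfolding u_def V_def y_def using that by (intro ext) (auto simp: restrict_def)
    qed
  qed
qed

section \<open>Existence of optimally stable functions\<close>

abbreviation vbdd :: "nat \<Rightarrow> nat \<Rightarrow> ((nat \<Rightarrow> real) \<Rightarrow> nat \<Rightarrow> real) \<Rightarrow> bool" where
  "vbdd n k F \<equiv> \<forall>i<k. bdd_meas n (\<lambda>x. F x i)"

definition ip :: "nat \<Rightarrow> nat \<Rightarrow> ((nat \<Rightarrow> real) \<Rightarrow> nat \<Rightarrow> real) \<Rightarrow> ((nat \<Rightarrow> real) \<Rightarrow> nat \<Rightarrow> real) \<Rightarrow> real" where
  "ip n k F G = (\<integral>x. inner_k k (F x) (G x) \<partial>gauss n)"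

definition vou :: "nat \<Rightarrow> real \<Rightarrow> ((nat \<Rightarrow> real) \<Rightarrow> nat \<Rightarrow> real) \<Rightarrow> (nat \<Rightarrow> real) \<Rightarrow> nat \<Rightarrow> real" where
  "vou n r F x i = ou n r (\<lambda>y. F y i) x"

lemma ball_valued_abs_le:
  assumes "ball_valued n k f" "i < k" "x \<in> vecs n"
  shows "\<bar>f x i\<bar> \<le> 1"
proof -
  have "vnorm k (f x) \<le> 1" using assms unfolding ball_valued_def vnorm_le_1_iff by auto
  then show ?thesis using abs_nth_le_vnorm[OF assms(2), of "f x"] by linarith
qed

lemma ball_valued_vbdd: "ball_valued n k f \<Longrightarrow> vbdd n k f"
proof (intro allI impI bdd_measI[where C=1])
  fix i assume f: "ball_valued n k f" and i: "i < k"
  show "(\<lambda>x. f x i) \<in> borel_measurable (borel_vec n)"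
    using f i unfolding ball_valued_def by (intro measurable_nth) auto
qed (rule ball_valued_abs_le)

lemma vbdd_diff: "vbdd n k F \<Longrightarrow> vbdd n k G \<Longrightarrow> vbdd n k (\<lambda>x i. F x i - G x i)"
  by auto

lemma vbdd_diff_const: "vbdd n k F \<Longrightarrow> vbdd n k (\<lambda>x i. F x i - c i)"
  by auto

lemma vbdd_vou: "vbdd n k F \<Longrightarrow> vbdd n k (vou n r F)"
  unfolding vou_def by auto

lemma vbdd_shift: "vbdd n k F \<Longrightarrow> vbdd n k (\<lambda>x. F (lincomb n a b x w))"
  by auto

lemma bdd_meas_inner: "vbdd n k F \<Longrightarrow> vbdd n k G \<Longrightarrow> bdd_meas n (\<lambda>x. inner_k k (F x) (G x))"
  unfolding inner_k_def by (intro bdd_meas_sum) auto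

lemma ip_sum:
  assumes "vbdd n k F" "vbdd n k G"
  shows "ip n k F G = (\<Sum>i<k. \<integral>x. F x i * G x i \<partial>gauss n)"
  unfolding ip_def inner_k_def using assms
  by (intro Bochner_Integration.integral_sum bdd_meas_integrable) auto

lemma ip_commute: "ip n k F G = ip n k G F"
  by (simp add: ip_def inner_k_def mult.commute)

lemma ip_diff_left:
  assumes "vbdd n k F" "vbdd n k F'" "vbdd n k G"
  shows "ip n k (\<lambda>x i. F x i - F' x i) G = ip n k F G - ip n k F' G"
  unfolding ip_def using bdd_meas_inner[OF assms(1,3)] bdd_meas_inner[OF assms(2,3)]
  by (subst Bochner_Integration.integral_diff[symmetric])
     (auto intro!: bdd_meas_integrable Bochner_Integration.integral_cong simp: inner_k_def left_diff_distrib sum_subtractf)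

lemma ip_diff_const:
  assumes "vbdd n k G" "vbdd n k u" "mean_zero n k u"
  shows "ip n k (\<lambda>x i. G x i - c i) u = ip n k G u"
proof -
  have "ip n k (\<lambda>x i. c i) u = (\<Sum>i<k. \<integral>x. c i * u x i \<partial>gauss n)"
    using assms by (intro ip_sum) auto
  also have "\<dots> = 0" using assms(3) by (simp add: mean_zero_def)
  finally show ?thesis 
    using ip_diff_left[where F=G and F'="\<lambda>x i. c i" and G=u and n=n and k=k] assms by auto
qed

lemma ip_le_vnorm:
  assumes "vbdd n k G" "ball_valued n k u"
  shows "ip n k G u \<le> (\<integral>x. vnorm k (G x) \<partial>gauss n)"
  unfolding ip_def
proof (rule integral_mono)
  show "integrable (gauss n) (\<lambda>x. inner_k k (G x) (u x))"
    using assms ball_valued_vbdd by (intro bdd_meas_integrable bdd_meas_inner) auto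
  show "integrable (gauss n) (\<lambda>x. vnorm k (G x))"
    using assms by (intro bdd_meas_integrable bdd_meas_vnorm) auto
  show "x \<in> space (gauss n) \<Longrightarrow> inner_k k (G x) (u x) \<le> vnorm k (G x)" for x
    using assms(2) by (intro inner_k_ball_le) (auto simp: ball_valued_def)
qed

lemma ip_vou:
  assumes "vbdd n k f" "vbdd n k g"
  shows "ip n k (vou n r f) g = (\<Sum>i<k. stab n r (\<lambda>x. g x i) (\<lambda>x. f x i))"
  using assms by (subst ip_sum) (auto simp: vou_def stab_def mult.commute bdd_meas_ou)

lemma ip_vou_sym:
  assumes "vbdd n k f" "vbdd n k g" "0 < r" "r \<le> 1"
  shows "ip n k (vou n r f) g = ip n k (vou n r g) f"
  unfolding ip_vou[OF assms(1,2)] ip_vou[OF assms(2,1)] using assms by (intro sum.cong stab_sym) auto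

lemma ip_vou_nonneg:
  assumes "vbdd n k f" "0 < r" "r < 1"
  shows "0 \<le> ip n k (vou n r f) f"
  unfolding ip_vou[OF assms(1,1)] using assms by (intro sum_nonneg stab_nonneg) auto

lemma ip_vou_diff:
  assumes "vbdd n k f" "vbdd n k g" "0 < r" "r \<le> 1"
  shows "ip n k (vou n r (\<lambda>x i. f x i - g x i)) (\<lambda>x i. f x i - g x i)
    = ip n k (vou n r f) f - 2 * ip n k (vou n r g) f + ip n k (vou n r g) g"
  unfolding ip_vou[OF vbdd_diff[OF assms(1,2)] vbdd_diff[OF assms(1,2)]] ip_vou[OF assms(1,1)]
    ip_vou[OF assms(2,1)] ip_vou[OF assms(2,2)]
  using assms by (simp add: stab_diff_diff sum.distrib sum_subtractf sum_distrib_left)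

lemma noise_stability_eq:
  assumes f: "ball_valued n k f"
  shows "noise_stability n k r f = ip n k (vou n r f) f"
proof -
  note fb = ball_valued_vbdd[OF f]
  let ?s = "sqrt (1 - r\<^sup>2)"
  have [measurable]: "f \<in> measurable (borel_vec n) (borel_vec k)" using f by (simp add: ball_valued_def)
  have eq: "(\<lambda>(x, z). (x, \<lambda>i\<in>{..<n}. r * x i + ?s * z i)) = (\<lambda>p. (fst p, lincomb n r ?s (fst p) (snd p)))"
    by (auto simp: lincomb_def)
  have "noise_stability n k r f = (\<integral>p. inner_k k (f (fst p)) (f (lincomb n r ?s (fst p) (snd p))) \<partial>gauss_sq n)"
    unfolding noise_stability_def corr_gauss_def eq by (subst integral_distr) auto
  also have "\<dots> = (\<Sum>i<k. \<integral>p. f (fst p) i * f (lincomb n r ?s (fst p) (snd p)) i \<partial>gauss_sq n)"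
    unfolding inner_k_def
    by (intro Bochner_Integration.integral_sum integrable_pair(2)[where \<phi>="\<lambda>x. f x _" and \<psi>="\<lambda>x. f x _"]) (use fb in auto)
  also have "\<dots> = (\<Sum>i<k. stab n r (\<lambda>x. f x i) (\<lambda>x. f x i))"
    using fb by (intro sum.cong refl stab_pair[symmetric]) auto
  finally show ?thesis using ip_vou[OF fb fb] by simp
qed

text \<open>The bound holds for the integrand itself, so it covers the endpoint \<open>r = 1\<close>
  as well, where it certifies an explicit optimal function.\<close>

lemma ip_vou_le_1:
  assumes f: "ball_valued n k f"
  shows "ip n k (vou n r f) f \<le> 1"
proof -
  have [measurable]: "f \<in> measurable (borel_vec n) (borel_vec k)" using f by (simp add: ball_valued_def)
  have "inner_k k (f x) (f y) \<le> 1" if "x \<in> vecs n" "y \<in> vecs n" for x y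
  proof -
    have "inner_k k (f x) (f y) \<le> vnorm k (f x)" using f that by (intro inner_k_ball_le) (auto simp: ball_valued_def)
    also have "\<dots> \<le> 1" using f that unfolding vnorm_le_1_iff[symmetric] by (auto simp: ball_valued_def)
    finally show ?thesis .
  qed
  then have b: "inner_k k (f x) (f (lincomb n r (sqrt (1 - r\<^sup>2)) x z)) \<le> 1" if "x \<in> vecs n" for x z
    using that by simp
  have fb: "vbdd n k f" by (rule ball_valued_vbdd[OF f])
  have "inner_k k (vou n r f x) (f x) \<le> 1" if x: "x \<in> vecs n" for x
  proof -
    have "inner_k k (vou n r f x) (f x) = (\<integral>z. inner_k k (f x) (f (lincomb n r (sqrt (1 - r\<^sup>2)) x z)) \<partial>gauss n)"
      unfolding inner_k_def vou_def ou_def using fb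
      by (subst Bochner_Integration.integral_sum) (auto simp: ou_integrable[where \<phi>="\<lambda>x. f x _"] mult.commute)
    also have "\<dots> \<le> 1"
    proof (rule gauss.integral_le_const)
      show "integrable (gauss n) (\<lambda>z. inner_k k (f x) (f (lincomb n r (sqrt (1 - r\<^sup>2)) x z)))"
        unfolding inner_k_def using fb
        by (intro Bochner_Integration.integrable_sum integrable_mult_right ou_integrable[where \<phi>="\<lambda>x. f x _"]) auto
    qed (use b[OF x] in auto)
    finally show ?thesis .
  qed
  then show ?thesis
    unfolding ip_def using fb vbdd_vou[OF fb]
    by (intro gauss.integral_le_const bdd_meas_integrable bdd_meas_inner AE_I2) auto
qed

lemma ball_valued_zero: "ball_valued n k (\<lambda>x. \<lambda>i\<in>{..<k}. 0)" and mean_zero_zero: "mean_zero n k (\<lambda>x. \<lambda>i\<in>{..<k}. 0)"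
  by (auto simp: ball_valued_def mean_zero_def inner_k_def)

section \<open>Compactness of images under the operator and existence of maximizers\<close>

lemma rational_approx_vec:
  assumes "(d::real) > 0"
  obtains q where "q \<in> PiE {..<n} (\<lambda>_. \<rat>)" "\<And>i. i < n \<Longrightarrow> \<bar>x i - q i\<bar> < d"
proof -
  have "\<exists>q\<in>\<rat>. \<bar>x i - q\<bar> < d" for i
  proof -
    obtain q where "q \<in> \<rat>" "x i < q" "q < x i + d" using Rats_dense_in_real[of "x i" "x i + d"] assms by auto
    then show ?thesis by (intro bexI[of _ q]) auto
  qed
  then obtain q where q: "\<And>i. q i \<in> \<rat>" "\<And>i. \<bar>x i - q i\<bar> < d" by metis
  show thesis by (rule that[of "restrict q {..<n}"]) (use q in auto)
qed

lemma ou_equicontinuous: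
  assumes "0 < r" "r < 1" "e > 0" 
  obtains d where "d > 0" "\<And>\<phi> x y. bdd_meas n \<phi> \<Longrightarrow> (\<And>x. x \<in> vecs n \<Longrightarrow> \<bar>\<phi> x\<bar> \<le> 1) \<Longrightarrow>
    (\<And>i. i < n \<Longrightarrow> \<bar>x i - y i\<bar> < d) \<Longrightarrow> \<bar>ou n r \<phi> x - ou n r \<phi> y\<bar> < e"
proof -
  let ?c = "r\<^sup>2 / (1 - r\<^sup>2)"
  have c: "?c \<ge> 0" using assms by (simp add: power_le_one)
  have "((\<lambda>d. sqrt (exp (?c * (real n * d\<^sup>2)) - 1)) \<longlongrightarrow> sqrt (exp (?c * (real n * 0\<^sup>2)) - 1)) (at_right 0)"
    by (intro tendsto_intros)
  then have "((\<lambda>d. sqrt (exp (?c * (real n * d\<^sup>2)) - 1)) \<longlongrightarrow> 0) (at_right 0)" by simp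
  from order_tendstoD(2)[OF this assms(3)]
  have "eventually (\<lambda>d. sqrt (exp (?c * (real n * d\<^sup>2)) - 1) < e \<and> d > 0) (at_right 0)"
    using eventually_at_right_less by (rule eventually_conj)
  then obtain d where d: "sqrt (exp (?c * (real n * d\<^sup>2)) - 1) < e" "d > 0"
    using eventually_happens'[OF trivial_limit_at_right_real] by blast
  show thesis
  proof (rule that[OF d(2)])
    fix \<phi> :: "(nat \<Rightarrow> real) \<Rightarrow> real" and x y :: "nat \<Rightarrow> real"
    assume b: "bdd_meas n \<phi>" "\<And>x. x \<in> vecs n \<Longrightarrow> \<bar>\<phi> x\<bar> \<le> 1" and xy: "\<And>i. i < n \<Longrightarrow> \<bar>x i - y i\<bar> < d"
    have "(\<Sum>i<n. (x i - y i)\<^sup>2) \<le> (\<Sum>i<n. d\<^sup>2)"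
      using xy d(2) by (intro sum_mono) (meson abs_le_square_iff abs_of_pos lessThan_iff less_imp_le order_trans abs_ge_self)
    then have s: "(\<Sum>i<n. (x i - y i)\<^sup>2) \<le> real n * d\<^sup>2" by simp
    have "\<bar>ou n r \<phi> x - ou n r \<phi> y\<bar> \<le> 1 * sqrt (exp (?c * (\<Sum>i<n. (x i - y i)\<^sup>2)) - 1)"
      by (rule ou_modulus[OF b assms(1,2)])
    also have "\<dots> \<le> sqrt (exp (?c * (real n * d\<^sup>2)) - 1)"
      using mult_left_mono[OF s c] by simp
    finally show "\<bar>ou n r \<phi> x - ou n r \<phi> y\<bar> < e" using d(1) by linarith
  qed
qed

text \<open>An Arzela-Ascoli argument: a subsequence that converges at all rational points is Cauchy
  everywhere by the uniform modulus of continuity.\<close>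

lemma ou_subsequence:
  assumes f: "\<And>j. ball_valued n k (f j)" and r: "0 < r" "r < 1"
  obtains s G where "strict_mono (s :: nat \<Rightarrow> nat)" "vbdd n k G"
    "\<And>i x. i < k \<Longrightarrow> x \<in> vecs n \<Longrightarrow> (\<lambda>j. vou n r (f (s j)) x i) \<longlonglongrightarrow> G x i"
proof -
  define Q where "Q = PiE {..<n} (\<lambda>_. \<rat> :: real set)"
  have cQ: "countable Q" unfolding Q_def by (intro countable_PiE) (auto simp: countable_rat)
  have neQ: "Q \<noteq> {}" unfolding Q_def by (auto simp: PiE_eq_empty_iff intro: Rats_0)
  \<comment> \<open>A rational point and a coordinate are coded together as one natural number, to
    fit the index set of the compactness lemma; coordinates from \<open>k\<close> on get the default
    \<open>0\<close>.\<close>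
  define a where "a j m = (if snd (prod_decode m) < k then vou n r (f j) (from_nat_into Q (fst (prod_decode m))) (snd (prod_decode m)) else 0)" for j m
  have fb: "bdd_meas n (\<lambda>x. f j x i)" "\<And>x. x \<in> vecs n \<Longrightarrow> \<bar>f j x i\<bar> \<le> 1" if "i < k" for i j
    using ball_valued_vbdd[OF f] ball_valued_abs_le[OF f] that by auto
  have vb: "\<bar>vou n r (f j) x i\<bar> \<le> 1" if "i < k" for i j x
    unfolding vou_def by (rule ou_bound) (use fb that in auto)
  have ab: "\<bar>a j m\<bar> \<le> 1" for j m using vb[of "snd (prod_decode m)"] by (simp add: a_def)
  obtain l s where s: "strict_mono (s :: nat \<Rightarrow> nat)" and l: "\<And>m. (\<lambda>j. a (s j) m) \<longlonglongrightarrow> l m"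
    using bounded_coordinates_subseq[of a "\<lambda>_. 1"] ab by metis
  have convQ: "Cauchy (\<lambda>j. vou n r (f (s j)) q i)" if q: "q \<in> Q" and i: "i < k" for q i
  proof -
    obtain m where m: "from_nat_into Q m = q" using from_nat_into_surj[OF cQ q] by blast
    have "(\<lambda>j. a (s j) (prod_encode (m, i))) = (\<lambda>j. vou n r (f (s j)) q i)"
      using i m by (simp add: a_def)
    with l[of "prod_encode (m, i)"] show ?thesis by (metis LIMSEQ_imp_Cauchy)
  qed
  have conv: "Cauchy (\<lambda>j. vou n r (f (s j)) x i)" if i: "i < k" for x i
  proof (rule metric_CauchyI)
    fix e :: real assume e: "e > 0"
    obtain d where d: "d > 0" "\<And>\<phi> x y. bdd_meas n \<phi> \<Longrightarrow> (\<And>x. x \<in> vecs n \<Longrightarrow> \<bar>\<phi> x\<bar> \<le> 1) \<Longrightarrow>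
      (\<And>i. i < n \<Longrightarrow> \<bar>x i - y i\<bar> < d) \<Longrightarrow> \<bar>ou n r \<phi> x - ou n r \<phi> y\<bar> < e/3"
      using ou_equicontinuous[OF r, of "e/3"] e by (metis divide_pos_pos zero_less_numeral)
    obtain q where q: "q \<in> Q" "\<And>i. i < n \<Longrightarrow> \<bar>x i - q i\<bar> < d"
      using rational_approx_vec[OF d(1), of n x] unfolding Q_def by metis
    have near: "\<bar>vou n r (f j) x i - vou n r (f j) q i\<bar> < e/3" for j
      unfolding vou_def by (rule d(2)[OF fb[OF i] q(2)])
    obtain M where M: "\<And>m m'. m \<ge> M \<Longrightarrow> m' \<ge> M \<Longrightarrow> dist (vou n r (f (s m)) q i) (vou n r (f (s m')) q i) < e/3"
      using metric_CauchyD[OF convQ[OF q(1) i], of "e/3"] e by auto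
    show "\<exists>M. \<forall>m\<ge>M. \<forall>m'\<ge>M. dist (vou n r (f (s m)) x i) (vou n r (f (s m')) x i) < e"
    proof (intro exI[of _ M] allI impI)
      fix m m' assume "m \<ge> M" "m' \<ge> M"
      from M[OF this] near[of "s m"] near[of "s m'"]
      show "dist (vou n r (f (s m)) x i) (vou n r (f (s m')) x i) < e" unfolding dist_real_def by linarith
    qed
  qed
  define G where "G x i = lim (\<lambda>j. vou n r (f (s j)) x i)" for x i
  have G: "(\<lambda>j. vou n r (f (s j)) x i) \<longlonglongrightarrow> G x i" if "i < k" for i x
    unfolding G_def using conv[OF that] by (simp add: real_Cauchy_convergent convergent_LIMSEQ_iff[symmetric])
  have "vbdd n k G"
  proof (intro allI impI bdd_measI[where C=1])
    fix i assume i: "i < k"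
    show "(\<lambda>x. G x i) \<in> borel_measurable (borel_vec n)"
      by (rule borel_measurable_LIMSEQ_real[OF G[OF i]])
         (use fb[OF i] in \<open>auto simp: vou_def intro!: bdd_meas_measurable bdd_meas_ou\<close>)
    show "\<bar>G x i\<bar> \<le> 1" for x
      by (rule LIMSEQ_le_const2[OF tendsto_rabs[OF G[OF i]]]) (use vb[OF i] in auto)
  qed
  then show thesis using that[OF s _ G] by simp
qed

lemma exists_optimally_stable_interior:
  assumes r: "0 < r" "r < 1"
  shows "\<exists>f. optimally_stable n k r f"
proof -
  define A where "A = {f. ball_valued n k f \<and> mean_zero n k f}"
  define E where "E f = ip n k (vou n r f) f" for f
  have ne: "A \<noteq> {}" 
    using ball_valued_zero[of n k] mean_zero_zero[of n k] unfolding A_def by blast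
  have bdd: "bdd_above (E ` A)" using ip_vou_le_1 by (intro bdd_aboveI[of _ 1]) (auto simp: A_def E_def)
  define S where "S = Sup (E ` A)"
  have S: "E f \<le> S" if "f \<in> A" for f unfolding S_def using that bdd by (intro cSup_upper) auto
  have "\<exists>f\<in>A. S - 1 / real (Suc j) < E f" for j
  proof -
    have "S - 1 / real (Suc j) < Sup (E ` A)" unfolding S_def by simp
    then show ?thesis using bdd ne by (subst (asm) less_cSup_iff) auto
  qed
  then obtain f where fA: "\<And>j. f j \<in> A" and fE: "\<And>j. S - 1 / real (Suc j) < E (f j)" by metis
  have f: "ball_valued n k (f j)" "mean_zero n k (f j)" for j using fA by (auto simp: A_def)
  obtain s G where s: "strict_mono (s :: nat \<Rightarrow> nat)" and Gb: "vbdd n k G"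
    and G: "\<And>i x. i < k \<Longrightarrow> x \<in> vecs n \<Longrightarrow> (\<lambda>j. vou n r (f (s j)) x i) \<longlonglongrightarrow> G x i"
    using ou_subsequence[of n k f r] f(1) r by metis
  note fb = ball_valued_vbdd[OF f(1)]
  obtain \<nu> u where u: "ball_valued n k u" "mean_zero n k u"
    "\<And>x. inner_k k (\<lambda>i. G x i - \<nu> i) (u x) = vnorm k (\<lambda>i. G x i - \<nu> i)"
    using dual_maximizer[of k n G] Gb by metis
  note ub = ball_valued_vbdd[OF u(1)]
  have Elim: "(\<lambda>j. E (f (s j))) \<longlonglongrightarrow> S"
  proof (rule tendsto_sandwich[of "\<lambda>j. S - 1 / real (Suc (s j))" _ _ "\<lambda>_. S"])
    have "(\<lambda>j. 1 / real (Suc j)) \<longlonglongrightarrow> 0" using LIMSEQ_inverse_real_of_nat by (simp add: inverse_eq_divide)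
    from LIMSEQ_subseq_LIMSEQ[OF this s] have "(\<lambda>j. 1 / real (Suc (s j))) \<longlonglongrightarrow> 0" by (simp add: comp_def)
    from tendsto_diff[OF tendsto_const this, of S]
    show "(\<lambda>j. S - 1 / real (Suc (s j))) \<longlonglongrightarrow> S" by simp
  qed (use S fA fE in \<open>auto intro!: always_eventually less_imp_le\<close>)
  have vb: "\<bar>vou n r (f j) x i\<bar> \<le> 1" if "i < k" for i j x
    unfolding vou_def by (rule ou_bound) (use ball_valued_abs_le[OF f(1)] that in auto)
  have lim: "(\<lambda>j. \<integral>x. vnorm k (\<lambda>i. vou n r (f (s j)) x i - G x i) \<partial>gauss n) \<longlonglongrightarrow> (\<integral>x. vnorm k (\<lambda>i. G x i - G x i) \<partial>gauss n)"
  proof -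
    obtain C where C: "\<And>i x. i < k \<Longrightarrow> x \<in> vecs n \<Longrightarrow> \<bar>G x i\<bar> \<le> C"
      using bdd_meas_uniform_bound[of k n G] Gb by metis
    show ?thesis
    proof (rule integral_vnorm_tendsto[where C="1 + C"])
      show "(\<lambda>x. vou n r (f (s j)) x i - G x i) \<in> borel_measurable (borel_vec n)" if "i < k" for i j
        using vbdd_diff[OF vbdd_vou[OF fb] Gb] that bdd_meas_measurable by blast
      show "\<bar>vou n r (f (s j)) x i - G x i\<bar> \<le> 1 + C" if "i < k" "x \<in> vecs n" for i j x
        using vb[OF that(1), of "s j" x] C[OF that] by linarith
      show "(\<lambda>j. vou n r (f (s j)) x i - G x i) \<longlonglongrightarrow> G x i - G x i" if "i < k" "x \<in> vecs n" for i x
        by (intro tendsto_intros G that)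
    qed auto
  qed
  then have lim0: "(\<lambda>j. \<integral>x. vnorm k (\<lambda>i. vou n r (f (s j)) x i - G x i) \<partial>gauss n) \<longlonglongrightarrow> 0"
    by (simp add: L2_set_def)
  \<comment> \<open>The pairing with a ball-valued function is at most an \<open>L^1\<close> norm,
    so \<open>\<epsilon> j\<close> bounds the error of exchanging \<open>T f_j\<close> and
    \<open>G\<close> uniformly over all such functions.\<close>
  define \<epsilon> where "\<epsilon> j = (\<integral>x. vnorm k (\<lambda>i. vou n r (f (s j)) x i - G x i) \<partial>gauss n)" for j
  have L: "ip n k (vou n r (f (s j))) v - ip n k G v \<le> \<epsilon> j" if "ball_valued n k v" for j v
    unfolding \<epsilon>_def using ip_diff_left[OF vbdd_vou[OF fb[of "s j"], of r] Gb ball_valued_vbdd[OF that]]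
      ip_le_vnorm[OF vbdd_diff[OF vbdd_vou[OF fb[of "s j"], of r] Gb] that] by simp
  have L': "ip n k G v - ip n k (vou n r (f (s j))) v \<le> \<epsilon> j" if "ball_valued n k v" for j v
  proof -
    have "(\<integral>x. vnorm k (\<lambda>i. G x i - vou n r (f (s j)) x i) \<partial>gauss n) = \<epsilon> j"
      unfolding \<epsilon>_def L2_set_def by (simp add: power2_commute)
    then show ?thesis using ip_diff_left[OF Gb vbdd_vou[OF fb[of "s j"], of r] ball_valued_vbdd[OF that]]
      ip_le_vnorm[OF vbdd_diff[OF Gb vbdd_vou[OF fb[of "s j"], of r]] that] by simp
  qed
  have max: "ip n k G v \<le> ip n k G u" if v: "ball_valued n k v" "mean_zero n k v" for v
  proof -
    have "ip n k G v = ip n k (\<lambda>x i. G x i - \<nu> i) v"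
      using ip_diff_const[OF Gb ball_valued_vbdd[OF v(1)] v(2)] by simp
    also have "\<dots> \<le> (\<integral>x. vnorm k (\<lambda>i. G x i - \<nu> i) \<partial>gauss n)"
      by (rule ip_le_vnorm[OF vbdd_diff_const[OF Gb] v(1)])
    also have "\<dots> = ip n k (\<lambda>x i. G x i - \<nu> i) u" unfolding ip_def u(3) ..
    also have "\<dots> = ip n k G u" by (rule ip_diff_const[OF Gb ub u(2)])
    finally show ?thesis .
  qed
  \<comment> \<open>Nonnegativity of the form on \<open>u - f_j\<close> gives \<open>E u\<close> at
    least twice the pairing of \<open>T f_j\<close> with \<open>u\<close>, minus
    \<open>E f_j\<close>. In that pairing \<open>T f_j\<close> is exchanged for \<open>G\<close>,
    then \<open>u\<close> for \<open>f_j\<close>, then \<open>G\<close> for \<open>T f_j\<close>;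
    the loss is \<open>2 \<epsilon>\<close>, doubled by the factor in front.\<close>
  have "E u \<ge> E (f (s j)) - 4 * \<epsilon> j" for j
  proof -
    have "0 \<le> E u - 2 * ip n k (vou n r (f (s j))) u + E (f (s j))"
      using ip_vou_nonneg[OF vbdd_diff[OF ub fb] r, of "s j"] ip_vou_diff[OF ub fb, of r "s j"] r by (simp add: E_def)
    moreover have "ip n k (vou n r (f (s j))) u \<ge> ip n k G u - \<epsilon> j" using L'[OF u(1), of j] by simp
    moreover have "ip n k G u \<ge> ip n k G (f (s j))" by (rule max[OF f])
    moreover have "ip n k G (f (s j)) \<ge> E (f (s j)) - \<epsilon> j" using L[OF f(1), of j "s j"] by (simp add: E_def)
    ultimately show ?thesis by linarith
  qed
  moreover have "(\<lambda>j. E (f (s j)) - 4 * \<epsilon> j) \<longlonglongrightarrow> S - 4 * 0"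
    unfolding \<epsilon>_def by (intro tendsto_intros Elim lim0)
  ultimately have "S - 4 * 0 \<le> E u" by (intro LIMSEQ_le_const2) auto
  then have "optimally_stable n k r u"
    unfolding optimally_stable_def using u(1,2) S by (auto simp: noise_stability_eq A_def E_def intro: order_trans)
  then show ?thesis by blast
qed

text \<open>At parameter \<open>0\<close> the operator returns the mean, so all admissible functions
  have stability \<open>0\<close>.\<close>

lemma exists_optimally_stable_0: "\<exists>f. optimally_stable n k 0 f"
proof -
  have "noise_stability n k 0 f = 0" if f: "ball_valued n k f" "mean_zero n k f" for f
  proof -
    have "vou n 0 f x i = 0" if "i < k" for x i
    proof -
      have "vou n 0 f x i = (\<integral>z. f z i \<partial>gauss n)"
        unfolding vou_def ou_def
        by (intro Bochner_Integration.integral_cong refl arg_cong[where f="\<lambda>z. f z i"] vec_eqI[of _ n]) auto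
      then show ?thesis using f(2) that by (simp add: mean_zero_def)
    qed
    then show ?thesis unfolding noise_stability_eq[OF f(1)] ip_def inner_k_def by simp
  qed
  then show ?thesis
    unfolding optimally_stable_def using ball_valued_zero mean_zero_zero by (metis order_refl)
qed

text \<open>At parameter \<open>1\<close> the operator is the identity and stability is the mean of
  \<open>|f|^2\<close>. The sign of the first coordinate attains the bound \<open>1\<close>; its
  value at \<open>0\<close> is set to \<open>1\<close> so that the norm is \<open>1\<close> at every
  point.\<close>

lemma exists_optimally_stable_1:
  assumes "1 \<le> n" "1 \<le> k"
  shows "\<exists>f. optimally_stable n k 1 f"
proof -
  define g :: "real \<Rightarrow> real" where "g t = (if t < 0 then -1 else 1)" for t
  have [measurable]: "g \<in> borel_measurable borel" unfolding g_def by measurable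
  define f :: "(nat \<Rightarrow> real) \<Rightarrow> nat \<Rightarrow> real" where "f x = (\<lambda>i\<in>{..<k}. if i = 0 then g (x 0) else 0)" for x
  have inner1: "inner_k k (f x) (f x) = 1" for x
  proof -
    have "inner_k k (f x) (f x) = (\<Sum>i<k. if i = 0 then 1 else 0)"
      unfolding inner_k_def by (intro sum.cong) (auto simp: f_def g_def)
    then show ?thesis using assms by simp
  qed
  have b: "ball_valued n k f"
    unfolding ball_valued_def
  proof (intro conjI ballI)
    show "f \<in> measurable (borel_vec n) (borel_vec k)"
      unfolding f_def[abs_def]
    proof (rule measurable_restrict)
      have "(\<lambda>x. g (x 0)) \<in> borel_measurable (borel_vec n)"
        using assms by (intro measurable_compose[OF measurable_nth[where f="\<lambda>x. x" and n=n]]) auto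
      then show "(\<lambda>x. if i = 0 then g (x 0) else 0) \<in> borel_measurable (borel_vec n)" for i :: nat by simp
    qed
  qed (simp add: inner1)
  have "(\<integral>x. g (x 0) \<partial>gauss n) = 0"
  proof -
    have d: "distr (gauss n) std_gauss (\<lambda>x. x 0) = std_gauss"
      unfolding gauss_def using assms by (intro distr_PiM_component) (auto intro: std_gauss.prob_space_axioms)
    have "(\<integral>x. g (x 0) \<partial>gauss n) = (\<integral>t. g t \<partial>distr (gauss n) std_gauss (\<lambda>x. x 0))"
      using assms by (subst integral_distr) (auto intro!: measurable_nth[where f="\<lambda>x. x" and n=n])
    also have "\<dots> = (\<integral>t. std_normal_density t * g t \<partial>lborel)"
      unfolding d by (subst integral_density) auto
    finally have 1: "(\<integral>x. g (x 0) \<partial>gauss n) = (\<integral>t. std_normal_density t * g t \<partial>lborel)" .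
    have "(\<integral>t. std_normal_density t * g t \<partial>lborel) = (\<integral>t. std_normal_density (0 + -1 * t) * g (0 + -1 * t) \<partial>lborel)"
      by (subst lborel_integral_real_affine[of "-1" _ 0]) auto
    also have "\<dots> = (\<integral>t. - (std_normal_density t * g t) \<partial>lborel)"
      by (intro integral_cong_AE) (use AE_lborel_singleton[of "0::real"] in \<open>auto simp: g_def std_normal_density_def elim!: AE_mp\<close>)
    finally show ?thesis unfolding 1 by simp
  qed
  then have m: "mean_zero n k f"
    unfolding mean_zero_def
  proof (intro allI impI)
    fix i assume "i < k"
    then show "(\<integral>x. f x i \<partial>gauss n) = 0"
      using \<open>(\<integral>x. g (x 0) \<partial>gauss n) = 0\<close> by (cases "i = 0") (simp_all add: f_def)
  qed
  have "noise_stability n k 1 f = 1"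
  proof -
    have "vou n 1 f x = f x" if x: "x \<in> vecs n" for x
    proof
      fix i
      have "lincomb n 1 0 x z = x" for z using x by (intro vec_eqI[of _ n]) auto
      then show "vou n 1 f x i = f x i" using gauss.prob_space[of n] by (simp add: vou_def ou_def)
    qed
    then have "ip n k (vou n 1 f) f = (\<integral>x. 1 \<partial>gauss n)"
      unfolding ip_def by (intro Bochner_Integration.integral_cong) (auto simp: inner1)
    then show ?thesis using noise_stability_eq[OF b] gauss.prob_space[of n] by simp
  qed
  then have "optimally_stable n k 1 f"
    unfolding optimally_stable_def using b m ip_vou_le_1[of n k _ 1] by (simp add: noise_stability_eq)
  then show ?thesis by blast
qed

section \<open>Uniqueness of the multiplier\<close>

lemma emeasure_std_gauss_interval_pos:
  assumes "a < b" shows "emeasure std_gauss {a<..<b} > 0"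
proof (rule ccontr)
  assume "\<not> emeasure std_gauss {a<..<b} > 0"
  then have "(\<integral>\<^sup>+x. ennreal (std_normal_density x) * indicator {a<..<b} x \<partial>lborel) = 0"
    by (simp add: emeasure_density)
  then have "AE x in lborel. ennreal (std_normal_density x) * indicator {a<..<b} x = 0"
    by (subst (asm) nn_integral_0_iff_AE) auto
  then have "AE x in lborel. x \<notin> {a<..<b}"
  proof eventually_elim
    case (elim x)
    have "ennreal (std_normal_density x) \<noteq> 0"
      using normal_density_pos[of 1 0 x] by (simp add: ennreal_eq_0_iff not_le)
    then show ?case using elim by (auto simp: indicator_def split: if_splits)
  qed
  then have "emeasure lborel {a<..<b} = 0"
    by (subst (asm) AE_iff_measurable[of "{a<..<b}"]) auto
  then show False using assms by simp
qed

text \<open>Boxes have positive measure, so the points with an almost sure property are dense. This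
  confronts an almost sure statement with continuity at a prescribed point.\<close>

lemma gauss_full_support:
  assumes "AE x in gauss n. P x" "d > 0"
  obtains x where "x \<in> vecs n" "P x" "\<And>i. i < n \<Longrightarrow> \<bar>x i - p i\<bar> < d"
proof (rule ccontr)
  assume no: "\<not> thesis"
  let ?B = "PiE {..<n} (\<lambda>i. {p i - d<..<p i + d})"
  have "emeasure (gauss n) ?B = (\<Prod>i<n. emeasure std_gauss {p i - d<..<p i + d})"
    by (rule emeasure_gauss_box) auto
  also have "\<dots> \<noteq> 0" 
  proof -
    have "emeasure std_gauss {p i - d<..<p i + d} \<noteq> 0" for i
      using emeasure_std_gauss_interval_pos[of "p i - d" "p i + d"] assms(2) by auto
    then show ?thesis by (simp del: emeasure_std_gauss_interval_pos)
  qed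
  finally have pos: "emeasure (gauss n) ?B \<noteq> 0" .
  have "AE x in gauss n. x \<notin> ?B"
    using assms(1)
  proof (rule AE_mp, intro AE_I2 impI notI)
    fix x assume "x \<in> space (gauss n)" "P x" "x \<in> ?B"
    moreover from this have "\<bar>x i - p i\<bar> < d" if "i < n" for i
    proof -
      have "p i - d < x i" "x i < p i + d" using \<open>x \<in> ?B\<close> that by (auto simp: PiE_iff)
      then show ?thesis by (simp add: abs_less_iff)
    qed
    ultimately show False using no that[of x] by auto
  qed
  moreover have "?B \<in> sets (gauss n)" by simp
  ultimately have "emeasure (gauss n) ?B = 0"
    using AE_iff_null_sets[of ?B "gauss n"] null_setsD1[of ?B "gauss n"] by blast
  with pos show False by simp
qed

text \<open>Equality case of Cauchy-Schwarz, stated without division so that it survives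
  \<open>v = 0\<close>: the square of \<open>v - |v| u\<close> expands to
  \<open>|v|^2 (|u|^2 - 1)\<close>, which is at most \<open>0\<close>.\<close>

lemma inner_k_eq_vnorm_imp:
  assumes "inner_k k v u = vnorm k v" "inner_k k u u \<le> 1" "i < k"
  shows "v i = vnorm k v * u i"
proof -
  have "(vnorm k (\<lambda>i. v i - vnorm k v * u i))\<^sup>2 = (vnorm k v)\<^sup>2 - 2 * vnorm k v * inner_k k v u + (vnorm k v)\<^sup>2 * (vnorm k u)\<^sup>2"
    by (rule vnorm_sub_scale_sq)
  also have "\<dots> = (vnorm k v)\<^sup>2 * (inner_k k u u - 1)"
    unfolding assms(1) vnorm_sq[where v=u, symmetric] by (simp add: power2_eq_square algebra_simps)
  also have "\<dots> \<le> 0" using assms(2) by (simp add: mult_nonneg_nonpos)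
  finally have "vnorm k (\<lambda>i. v i - vnorm k v * u i) = 0" by simp
  then show ?thesis using assms(3) by (auto simp: vnorm_eq_0)
qed

lemma integral_inner_const:
  assumes "vbdd n k u" "mean_zero n k u"
  shows "(\<integral>x. inner_k k c (u x) \<partial>gauss n) = 0"
proof -
  have "(\<integral>x. inner_k k c (u x) \<partial>gauss n) = (\<Sum>i<k. c i * (\<integral>x. u x i \<partial>gauss n))"
    unfolding inner_k_def using assms(1) bdd_meas_integrable by (subst Bochner_Integration.integral_sum) auto
  then show ?thesis using assms(2) by (simp add: mean_zero_def)
qed

text \<open>The data that remain once an optimal function has been replaced by the maximizer of its
  own linearization. Since \<open>dual\<close> and \<open>u_cong\<close> hold at every point,
  translates of \<open>u\<close> and \<open>N\<close> inherit them with no exceptional sets.\<close>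

locale stable_maximizer =
  fixes n k :: nat and r :: real and u :: "(nat \<Rightarrow> real) \<Rightarrow> nat \<Rightarrow> real" and lam :: "nat \<Rightarrow> real"
    and N :: "(nat \<Rightarrow> real) \<Rightarrow> nat \<Rightarrow> real"
  assumes r: "0 < r" "r < 1"
    and u: "ball_valued n k u" "mean_zero n k u"
    and max: "\<And>g. ball_valued n k g \<Longrightarrow> mean_zero n k g \<Longrightarrow> ip n k (vou n r g) g \<le> ip n k (vou n r u) u"
    and N_eq: "N = (\<lambda>x i. vou n r u x i - lam i)"
    and dual: "\<And>x. inner_k k (N x) (u x) = vnorm k (N x)"
    and u_cong: "\<And>x y. (\<And>i. i < k \<Longrightarrow> N x i = N y i) \<Longrightarrow> u x = u y"
begin

lemma ub: "vbdd n k u" by (rule ball_valued_vbdd[OF u(1)])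

lemma Nb: "vbdd n k N" unfolding N_eq by (intro vbdd_diff_const vbdd_vou ub)

lemma u_le_1: "x \<in> vecs n \<Longrightarrow> inner_k k (u x) (u x) \<le> 1"
  using u(1) by (simp add: ball_valued_def)

lemma N_equicontinuous:
  assumes "e > 0"
  obtains d where "d > 0" "\<And>i x y. i < k \<Longrightarrow> (\<And>l. l < n \<Longrightarrow> \<bar>x l - y l\<bar> < d) \<Longrightarrow> \<bar>N x i - N y i\<bar> < e"
proof -
  obtain d where d: "d > 0" "\<And>\<phi> x y. bdd_meas n \<phi> \<Longrightarrow> (\<And>x. x \<in> vecs n \<Longrightarrow> \<bar>\<phi> x\<bar> \<le> 1) \<Longrightarrow>
    (\<And>i. i < n \<Longrightarrow> \<bar>x i - y i\<bar> < d) \<Longrightarrow> \<bar>ou n r \<phi> x - ou n r \<phi> y\<bar> < e"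
    using ou_equicontinuous[OF r assms] by metis
  show thesis
  proof (rule that[OF d(1)])
    fix i x y assume i: "i < k" and xy: "\<And>l. l < n \<Longrightarrow> \<bar>x l - y l\<bar> < d"
    have "\<bar>ou n r (\<lambda>x. u x i) x - ou n r (\<lambda>x. u x i) y\<bar> < e"
      by (rule d(2)[OF _ ball_valued_abs_le[OF u(1) i] xy]) (use ub i in auto)
    then show "\<bar>N x i - N y i\<bar> < e" by (simp add: N_eq vou_def)
  qed
qed

lemma N_tendsto:
  assumes "i < k" "\<And>l. l < n \<Longrightarrow> ((\<lambda>j. y j l) \<longlongrightarrow> x l) F"
  shows "((\<lambda>j. N (y j) i) \<longlongrightarrow> N x i) F"
proof (rule tendstoI)
  fix e :: real assume "e > 0"
  then obtain d where d: "d > 0" "\<And>i x y. i < k \<Longrightarrow> (\<And>l. l < n \<Longrightarrow> \<bar>x l - y l\<bar> < d) \<Longrightarrow> \<bar>N x i - N y i\<bar> < e"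
    using N_equicontinuous by metis
  have "eventually (\<lambda>j. \<forall>l\<in>{..<n}. dist (y j l) (x l) < d) F"
    using assms(2) d(1) by (intro eventually_ball_finite) (auto dest: tendstoD)
  then show "eventually (\<lambda>j. dist (N (y j) i) (N x i) < e) F"
    by eventually_elim (use d(2)[OF assms(1)] in \<open>auto simp: dist_real_def\<close>)
qed

text \<open>A second multiplier \<open>\<nu>\<close> would force \<open>N \<cdot> \<nu>\<close> to avoid the interval between \<open>0\<close> and \<open>|\<nu>|\<^sup>2\<close>
  almost everywhere while taking values on both sides of it, contradicting continuity.\<close>

lemma multiplier_unique:
  assumes le: "(\<integral>x. vnorm k (\<lambda>i. N x i - \<nu> i) \<partial>gauss n) \<le> (\<integral>x. vnorm k (N x) \<partial>gauss n)"
  shows "vnorm k \<nu> = 0"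
proof (rule ccontr)
  assume "vnorm k \<nu> \<noteq> 0"
  then have pos: "vnorm k \<nu> > 0" using L2_set_nonneg[of \<nu> "{..<k}"] by linarith
  define A where "A = inner_k k \<nu> \<nu>"
  have A: "A > 0" using pos by (simp add: A_def vnorm_sq[symmetric])
  define q where "q x = inner_k k (N x) \<nu>" for x
  have q': "inner_k k (\<lambda>i. N x i - \<nu> i) \<nu> = q x - A" for x
    by (simp add: q_def A_def inner_k_def left_diff_distrib sum_subtractf)
  have Nn: "vbdd n k (\<lambda>x i. N x i - \<nu> i)" using Nb by (rule vbdd_diff_const)
  \<comment> \<open>Because \<open>u\<close> has mean zero, \<open>N - \<nu>\<close> and
    \<open>N\<close> have the same pairing with \<open>u\<close>, namely the expectation of
    \<open>|N|\<close>. The assumption then leaves no room in the pointwise bound of this pairing by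
    \<open>|N - \<nu>|\<close>.\<close>
  have "AE x in gauss n. vnorm k (\<lambda>i. N x i - \<nu> i) - inner_k k (\<lambda>i. N x i - \<nu> i) (u x) = 0"
  proof -
    have i1: "integrable (gauss n) (\<lambda>x. vnorm k (\<lambda>i. N x i - \<nu> i))"
      using Nn by (intro bdd_meas_integrable bdd_meas_vnorm) auto
    have i2: "integrable (gauss n) (\<lambda>x. inner_k k (\<lambda>i. N x i - \<nu> i) (u x))"
      using Nn ub by (intro bdd_meas_integrable bdd_meas_inner) auto
    have nn: "AE x in gauss n. 0 \<le> vnorm k (\<lambda>i. N x i - \<nu> i) - inner_k k (\<lambda>i. N x i - \<nu> i) (u x)"
      by (intro AE_I2) (use inner_k_ball_le[OF u_le_1] in auto)
    have "(\<integral>x. inner_k k (\<lambda>i. N x i - \<nu> i) (u x) \<partial>gauss n) = (\<integral>x. vnorm k (N x) \<partial>gauss n)"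
      using ip_diff_const[OF Nb ub u(2), of \<nu>] by (simp add: ip_def dual)
    then have "(\<integral>x. vnorm k (\<lambda>i. N x i - \<nu> i) - inner_k k (\<lambda>i. N x i - \<nu> i) (u x) \<partial>gauss n) \<le> 0"
      using le i1 i2 by simp
    moreover have "0 \<le> (\<integral>x. vnorm k (\<lambda>i. N x i - \<nu> i) - inner_k k (\<lambda>i. N x i - \<nu> i) (u x) \<partial>gauss n)"
      using nn by (rule integral_nonneg_AE)
    ultimately have "(\<integral>x. vnorm k (\<lambda>i. N x i - \<nu> i) - inner_k k (\<lambda>i. N x i - \<nu> i) (u x) \<partial>gauss n) = 0" by simp
    then show ?thesis
      using integral_nonneg_eq_0_iff_AE[OF Bochner_Integration.integrable_diff[OF i1 i2] nn] by simp
  qed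
  then have ae: "AE x in gauss n. x \<in> vecs n \<and> inner_k k (\<lambda>i. N x i - \<nu> i) (u x) = vnorm k (\<lambda>i. N x i - \<nu> i)"
    using AE_space[of "gauss n"] by eventually_elim auto
  have qu: "q x = vnorm k (N x) * inner_k k (u x) \<nu>" if "x \<in> vecs n" for x
  proof -
    have "q x = (\<Sum>i<k. (vnorm k (N x) * u x i) * \<nu> i)"
      unfolding q_def inner_k_def
      by (intro sum.cong refl) (use inner_k_eq_vnorm_imp[OF dual u_le_1[OF that]] in auto)
    then show ?thesis by (simp add: inner_k_def sum_distrib_left mult.assoc)
  qed
  have qu': "q x - A = vnorm k (\<lambda>i. N x i - \<nu> i) * inner_k k (u x) \<nu>"
    if "x \<in> vecs n" "inner_k k (\<lambda>i. N x i - \<nu> i) (u x) = vnorm k (\<lambda>i. N x i - \<nu> i)" for x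
  proof -
    have "q x - A = (\<Sum>i<k. (vnorm k (\<lambda>i. N x i - \<nu> i) * u x i) * \<nu> i)"
      unfolding q'[symmetric] inner_k_def
      by (intro sum.cong refl) (use inner_k_eq_vnorm_imp[OF that(2) u_le_1[OF that(1)]] in auto)
    then show ?thesis by (simp add: inner_k_def sum_distrib_left mult.assoc)
  qed
  \<comment> \<open>Both \<open>q\<close> and \<open>q - A\<close> are nonnegative multiples of the
    same number, the product of \<open>u\<close> and \<open>\<nu>\<close>, so they cannot have
    strictly opposite signs.\<close>
  have gap: "AE x in gauss n. \<not> (0 < q x \<and> q x < A)"
    using ae
  proof eventually_elim
    case (elim x)
    show ?case
    proof
      assume "0 < q x \<and> q x < A"
      then have "inner_k k (u x) \<nu> > 0" 
        using qu[of x] elim L2_set_nonneg[of "N x" "{..<k}"] by (metis not_less mult_nonneg_nonpos)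
      then have "q x - A \<ge> 0" using qu'[of x] elim by (simp add: L2_set_nonneg)
      then show False using \<open>0 < q x \<and> q x < A\<close> by simp
    qed
  qed
  have int: "integrable (gauss n) (\<lambda>x. inner_k k \<nu> (u x))"
    using ub by (intro bdd_meas_integrable bdd_meas_inner) auto
  have mean: "(\<integral>x. inner_k k \<nu> (u x) \<partial>gauss n) = 0" by (rule integral_inner_const[OF ub u(2)])
  have comm: "inner_k k (u x) \<nu> = inner_k k \<nu> (u x)" for x by (simp add: inner_k_def mult.commute)
  \<comment> \<open>If \<open>q\<close> stayed below \<open>A\<close>, the product of
    \<open>\<nu>\<close> and \<open>u\<close> would be negative almost everywhere, against its mean
    zero. The other side is treated in the same way.\<close>
  have "\<exists>p1\<in>vecs n. q p1 \<ge> A"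
  proof (rule ccontr)
    assume "\<not> ?thesis"
    then have lt: "q x < A" if "x \<in> vecs n" for x using that by (meson not_le)
    have "AE x in gauss n. inner_k k \<nu> (u x) < 0"
      using ae
    proof eventually_elim
      case (elim x)
      then have "q x - A < 0" using lt by simp
      then show ?case using qu'[of x] elim L2_set_nonneg[of "\<lambda>i. N x i - \<nu> i" "{..<k}"]
        by (metis comm mult_nonneg_nonneg not_le)
    qed
    from gauss.expectation_less[OF int this] show False using mean by simp
  qed
  then obtain p1 where p1: "p1 \<in> vecs n" "q p1 \<ge> A" by blast
  have "\<exists>p2\<in>vecs n. q p2 \<le> 0"
  proof (rule ccontr)
    assume "\<not> ?thesis"
    then have lt: "q x > 0" if "x \<in> vecs n" for x using that by (meson not_le)
    have "AE x in gauss n. 0 < inner_k k \<nu> (u x)"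
    proof (rule AE_I2)
      fix x assume "x \<in> space (gauss n)"
      then show "0 < inner_k k \<nu> (u x)" using qu[of x] lt[of x] L2_set_nonneg[of "N x" "{..<k}"]
        by (metis comm mult_nonneg_nonpos not_le space_gauss)
    qed
    from gauss.expectation_greater[OF int this] show False using mean by simp
  qed
  then obtain p2 where p2: "p2 \<in> vecs n" "q p2 \<le> 0" by blast
  \<comment> \<open>Along the segment from \<open>p1\<close> to \<open>p2\<close> the intermediate
    value theorem finds \<open>q = A / 2\<close>, the middle of the forbidden interval.\<close>
  let ?\<gamma> = "\<lambda>t. lincomb n (1 - t) t p1 p2"
  have "continuous_on {0..1} (\<lambda>t. q (?\<gamma> t))"
    unfolding continuous_on_def q_def inner_k_def
  proof (intro ballI tendsto_sum tendsto_mult tendsto_const)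
    fix t :: real and i assume "i \<in> {..<k}"
    then show "((\<lambda>t. N (?\<gamma> t) i) \<longlongrightarrow> N (?\<gamma> t) i) (at t within {0..1})"
      by (intro N_tendsto) (auto intro!: tendsto_intros)
  qed
  moreover have "?\<gamma> 0 = p1" by (rule vec_eqI[OF lincomb_in_space p1(1)]) simp
  moreover have "?\<gamma> 1 = p2" by (rule vec_eqI[OF lincomb_in_space p2(1)]) simp
  ultimately obtain t where t: "q (?\<gamma> t) = A / 2"
    using IVT2'[of "\<lambda>t. q (?\<gamma> t)" 1 "A/2" 0] p1 p2 A by auto
  \<comment> \<open>If every coordinate of \<open>N\<close> moves by less than \<open>e\<close>,
    then \<open>q\<close> moves by less than \<open>A / 2\<close>; the summand \<open>1\<close>
    keeps the denominator positive.\<close>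
  define e where "e = (A / 2) / (1 + (\<Sum>i<k. \<bar>\<nu> i\<bar>))"
  have s1: "1 + (\<Sum>i<k. \<bar>\<nu> i\<bar>) > 0" by (intro add_pos_nonneg sum_nonneg) auto
  have e: "e > 0" unfolding e_def using A s1 by simp
  obtain d where d: "d > 0" "\<And>i x y. i < k \<Longrightarrow> (\<And>l. l < n \<Longrightarrow> \<bar>x l - y l\<bar> < d) \<Longrightarrow> \<bar>N x i - N y i\<bar> < e"
    using N_equicontinuous[OF e] by metis
  obtain x where x: "\<not> (0 < q x \<and> q x < A)" "\<And>i. i < n \<Longrightarrow> \<bar>x i - ?\<gamma> t i\<bar> < d"
    using gauss_full_support[OF gap d(1), of "?\<gamma> t"] by metis
  have "q x - q (?\<gamma> t) = (\<Sum>i<k. (N x i - N (?\<gamma> t) i) * \<nu> i)"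
    by (simp add: q_def inner_k_def left_diff_distrib sum_subtractf)
  then have "\<bar>q x - q (?\<gamma> t)\<bar> \<le> (\<Sum>i<k. \<bar>N x i - N (?\<gamma> t) i\<bar> * \<bar>\<nu> i\<bar>)"
    using sum_abs[of "\<lambda>i. (N x i - N (?\<gamma> t) i) * \<nu> i" "{..<k}"] by (simp add: abs_mult)
  also have "\<dots> \<le> (\<Sum>i<k. e * \<bar>\<nu> i\<bar>)"
  proof (rule sum_mono)
    fix i assume "i \<in> {..<k}"
    then have "\<bar>N x i - N (?\<gamma> t) i\<bar> < e" by (intro d(2) x) auto
    then show "\<bar>N x i - N (?\<gamma> t) i\<bar> * \<bar>\<nu> i\<bar> \<le> e * \<bar>\<nu> i\<bar>" by (intro mult_right_mono) auto
  qed
  also have "\<dots> = e * (\<Sum>i<k. \<bar>\<nu> i\<bar>)" by (simp add: sum_distrib_left)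
  also have "\<dots> < e * (1 + (\<Sum>i<k. \<bar>\<nu> i\<bar>))" using e by (simp add: algebra_simps)
  also have "\<dots> = A / 2"
    using nonzero_divide_eq_eq[of "1 + (\<Sum>i<k. \<bar>\<nu> i\<bar>)" "A / 2" e] s1 e_def by linarith
  finally have "\<bar>q x - A / 2\<bar> < A / 2" unfolding t .
  then show False using x(1) by (simp only: abs_less_iff) linarith
qed

end

section \<open>Second-order expansion of exponentially weighted integrals\<close>

lemma abs_exp_remainder_le: "\<bar>exp u - 1 - u\<bar> \<le> u\<^sup>2 * exp \<bar>u\<bar>" for u :: real
proof -
  obtain t where t: "\<bar>t\<bar> \<le> \<bar>u\<bar>" "exp u = (\<Sum>m<2. u ^ m / fact m) + exp t / fact 2 * u ^ 2"
    using Maclaurin_exp_le[of u 2] by blast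
  have eq: "exp u - 1 - u = exp t / 2 * u\<^sup>2" using t(2) by (simp add: eval_nat_numeral)
  have "\<bar>exp u - 1 - u\<bar> = exp t / 2 * u\<^sup>2" unfolding eq by simp
  also have "\<dots> \<le> exp \<bar>u\<bar> * u\<^sup>2"
  proof (rule mult_right_mono)
    have "exp t \<le> exp \<bar>u\<bar>" using t(1) by simp
    then show "exp t / 2 \<le> exp \<bar>u\<bar>" using exp_gt_zero[of t] by linarith
  qed simp
  finally show ?thesis by (simp add: mult.commute)
qed

lemma sq_le_exp: "0 \<le> y \<Longrightarrow> y\<^sup>2 \<le> 2 * exp y" for y :: real
  using exp_lower_Taylor_quadratic[of y] by linarith

text \<open>Differentiation under the integral along the steps \<open>1 / (j + 1)\<close>. As
  \<open>X\<close> has all exponential moments, multiples of \<open>exp (2 X) + exp (-2 X)\<close>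
  plus a constant dominate the difference quotients. The term with \<open>K\<close> accounts for the
  normalization of a Cameron-Martin density.\<close>

lemma second_order_expansion:
  fixes M :: "'a measure" and H X :: "'a \<Rightarrow> real"
  assumes M: "prob_space M" and [measurable]: "H \<in> borel_measurable M" "X \<in> borel_measurable M"
    and C: "\<And>x. x \<in> space M \<Longrightarrow> \<bar>H x\<bar> \<le> C" and ex: "\<And>c. integrable M (\<lambda>x. exp (c * X x))" and K: "K \<ge> 0"
  shows "integrable M (\<lambda>x. H x * X x)" and "integrable M (\<lambda>x. H x * (X x)\<^sup>2)"
    and "(\<lambda>j. ((\<integral>x. H x * exp (1 / real (Suc j) * X x - (1 / real (Suc j))\<^sup>2 * K) \<partial>M) - (\<integral>x. H x \<partial>M)
        - 1 / real (Suc j) * (\<integral>x. H x * X x \<partial>M)) / (1 / real (Suc j))\<^sup>2)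
      \<longlonglongrightarrow> (\<integral>x. H x * ((X x)\<^sup>2 / 2 - K) \<partial>M)"
proof -
  interpret M: prob_space M by fact
  obtain x0 where "x0 \<in> space M" using M.not_empty by blast
  then have C0: "C \<ge> 0" using C[of x0] abs_ge_zero[of "H x0"] by linarith
  have dom: "integrable M (\<lambda>x. H x * Y x)"
    if [measurable]: "Y \<in> borel_measurable M" and "\<And>x. \<bar>Y x\<bar> \<le> c * (exp (2 * X x) + exp (-2 * X x)) + d" for Y c d
  proof (rule Bochner_Integration.integrable_bound[where f="\<lambda>x. C * (c * (exp (2 * X x) + exp (-2 * X x)) + d)"])
    show "integrable M (\<lambda>x. C * (c * (exp (2 * X x) + exp (-2 * X x)) + d))"
      by (intro integrable_mult_right Bochner_Integration.integrable_add ex) simp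
    show "AE x in M. norm (H x * Y x) \<le> norm (C * (c * (exp (2 * X x) + exp (-2 * X x)) + d))"
    proof (rule AE_I2)
      fix x assume x: "x \<in> space M"
      have "\<bar>H x * Y x\<bar> \<le> C * (c * (exp (2 * X x) + exp (-2 * X x)) + d)"
        unfolding abs_mult using C[OF x] that(2)[of x] C0 by (intro mult_mono) auto
      then show "norm (H x * Y x) \<le> norm (C * (c * (exp (2 * X x) + exp (-2 * X x)) + d))" by simp
    qed
  qed measurable
  have e2: "exp (2 * \<bar>y\<bar>) \<le> exp (2 * y) + exp (-2 * y)" for y :: real
    by (cases "y \<ge> 0") auto
  have "\<bar>y\<bar> \<le> exp (2 * y) + exp (-2 * y)" for y :: real
    using exp_ge_add_one_self[of "2 * \<bar>y\<bar>"] e2[of y] abs_ge_zero[of y] by linarith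
  then have x1: "\<bar>y\<bar> \<le> 1 * (exp (2 * y) + exp (-2 * y)) + 0" for y :: real by simp
  have "y\<^sup>2 \<le> 2 * exp (2 * \<bar>y\<bar>)" for y :: real
  proof -
    have "y\<^sup>2 \<le> 2 * exp \<bar>y\<bar>" using sq_le_exp[of "\<bar>y\<bar>"] by simp
    moreover have "exp \<bar>y\<bar> \<le> exp (2 * \<bar>y\<bar>)" by simp
    ultimately show ?thesis by linarith
  qed
  then have x2: "\<bar>y\<^sup>2\<bar> \<le> 2 * (exp (2 * y) + exp (-2 * y)) + 0" for y :: real
    using e2[of y] by (smt (verit) abs_of_nonneg zero_le_power2)
  show i1: "integrable M (\<lambda>x. H x * X x)" by (rule dom[OF _ x1]) measurable
  show i2: "integrable M (\<lambda>x. H x * (X x)\<^sup>2)" by (rule dom[OF _ x2]) measurable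
  have i0: "integrable M H" using C by (intro M.integrable_const_bound[where B=C]) auto
  define Q where "Q h y = (exp (h * y - h\<^sup>2 * K) - 1 - h * y) / h\<^sup>2" for h y :: real
  have Qlim: "(\<lambda>j. Q (1 / real (Suc j)) y) \<longlonglongrightarrow> y\<^sup>2 / 2 - K" for y
  proof -
    have "(\<lambda>j. Q (1 / real (Suc j)) y) \<longlonglongrightarrow> y * y / 2 - K"
      unfolding Q_def by real_asymp
    then show ?thesis by (simp add: power2_eq_square)
  qed
  \<comment> \<open>With \<open>v = h y - h^2 K\<close> the quotient is
    \<open>(exp v - 1 - v) / h^2 - K\<close>. The bound \<open>|v| \<le> h (|y| + K)\<close> cancels
    \<open>h^2\<close>, and the remaining polynomial factor is absorbed by doubling the
    exponent.\<close>
  have Qb: "\<bar>Q h y\<bar> \<le> 2 * exp (2 * K) * (exp (2 * y) + exp (-2 * y)) + K" if h: "0 < h" "h \<le> 1" for h y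
  proof -
    define v where "v = h * y - h\<^sup>2 * K"
    have v: "\<bar>v\<bar> \<le> h * (\<bar>y\<bar> + K)"
    proof -
      have "\<bar>v\<bar> \<le> h * \<bar>y\<bar> + h\<^sup>2 * K" unfolding v_def using h K by (simp add: abs_mult order_trans[OF abs_triangle_ineq4])
      moreover have "h\<^sup>2 * K \<le> h * K" using h K by (intro mult_right_mono) (auto simp: power2_eq_square mult_left_le)
      ultimately show ?thesis by (simp add: algebra_simps)
    qed
    have v': "\<bar>v\<bar> \<le> \<bar>y\<bar> + K"
      using v mult_right_mono[OF h(2), of "\<bar>y\<bar> + K"] K by simp
    have vs: "v\<^sup>2 \<le> h\<^sup>2 * (\<bar>y\<bar> + K)\<^sup>2"
      using power_mono[OF v, of 2] by (simp add: power_mult_distrib)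
    have "Q h y = (exp v - 1 - v) / h\<^sup>2 - K"
      unfolding Q_def v_def using h by (simp add: field_simps)
    then have "\<bar>Q h y\<bar> \<le> \<bar>exp v - 1 - v\<bar> / h\<^sup>2 + K"
      using h K by (simp add: order_trans[OF abs_triangle_ineq4])
    also have "\<bar>exp v - 1 - v\<bar> / h\<^sup>2 \<le> (\<bar>y\<bar> + K)\<^sup>2 * exp (\<bar>y\<bar> + K)"
    proof -
      have "\<bar>exp v - 1 - v\<bar> \<le> v\<^sup>2 * exp \<bar>v\<bar>" by (rule abs_exp_remainder_le)
      also have "\<dots> \<le> (h\<^sup>2 * (\<bar>y\<bar> + K)\<^sup>2) * exp (\<bar>y\<bar> + K)"
        using vs v' by (intro mult_mono) auto
      finally show ?thesis using h by (simp add: divide_le_eq mult_ac)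
    qed
    also have "\<dots> \<le> (2 * exp (\<bar>y\<bar> + K)) * exp (\<bar>y\<bar> + K)"
      using K by (intro mult_right_mono sq_le_exp) auto
    also have "\<dots> = 2 * exp (2 * K) * exp (2 * \<bar>y\<bar>)"
      by (simp add: exp_add[symmetric])
    also have "\<dots> \<le> 2 * exp (2 * K) * (exp (2 * y) + exp (-2 * y))"
      using e2 by (intro mult_left_mono) auto
    finally show ?thesis by simp
  qed
  have QM: "(\<lambda>x. Q h (X x)) \<in> borel_measurable M" for h unfolding Q_def by measurable
  have iQ: "integrable M (\<lambda>x. H x * Q (1 / real (Suc j)) (X x))" for j
    by (rule dom[OF QM Qb]) auto
  have "(\<lambda>j. \<integral>x. H x * Q (1 / real (Suc j)) (X x) \<partial>M) \<longlonglongrightarrow> (\<integral>x. H x * ((X x)\<^sup>2 / 2 - K) \<partial>M)"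
  proof (rule integral_dominated_convergence[where w="\<lambda>x. C * (2 * exp (2 * K) * (exp (2 * X x) + exp (-2 * X x)) + K)"])
    show "(\<lambda>x. H x * ((X x)\<^sup>2 / 2 - K)) \<in> borel_measurable M" by measurable
    show "(\<lambda>x. H x * Q (1 / real (Suc j)) (X x)) \<in> borel_measurable M" for j using QM by measurable
    show "integrable M (\<lambda>x. C * (2 * exp (2 * K) * (exp (2 * X x) + exp (-2 * X x)) + K))"
      by (intro integrable_mult_right Bochner_Integration.integrable_add ex) simp
    show "AE x in M. (\<lambda>j. H x * Q (1 / real (Suc j)) (X x)) \<longlonglongrightarrow> H x * ((X x)\<^sup>2 / 2 - K)"
      by (intro AE_I2 tendsto_mult tendsto_const Qlim)
    show "AE x in M. norm (H x * Q (1 / real (Suc j)) (X x)) \<le> C * (2 * exp (2 * K) * (exp (2 * X x) + exp (-2 * X x)) + K)" for j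
    proof (rule AE_I2)
      fix x assume x: "x \<in> space M"
      have h: "0 < 1 / real (Suc j)" "1 / real (Suc j) \<le> 1" by auto
      show "norm (H x * Q (1 / real (Suc j)) (X x)) \<le> C * (2 * exp (2 * K) * (exp (2 * X x) + exp (-2 * X x)) + K)"
        unfolding real_norm_def abs_mult[of "H x"] using C[OF x] Qb[OF h, of "X x"] C0 by (intro mult_mono) auto
    qed
  qed
  moreover have "(\<integral>x. H x * Q (1 / real (Suc j)) (X x) \<partial>M) =
    ((\<integral>x. H x * exp (1 / real (Suc j) * X x - (1 / real (Suc j))\<^sup>2 * K) \<partial>M) - (\<integral>x. H x \<partial>M)
        - 1 / real (Suc j) * (\<integral>x. H x * X x \<partial>M)) / (1 / real (Suc j))\<^sup>2" for j
  proof -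
    define h where "h = 1 / real (Suc j)"
    have h: "h > 0" by (simp add: h_def)
    have eq: "H x * exp (h * X x - h\<^sup>2 * K) = h\<^sup>2 * (H x * Q h (X x)) + H x + h * (H x * X x)" for x
      unfolding Q_def using h by (simp add: field_simps)
    have "(\<integral>x. H x * exp (h * X x - h\<^sup>2 * K) \<partial>M) = h\<^sup>2 * (\<integral>x. H x * Q h (X x) \<partial>M) + (\<integral>x. H x \<partial>M) + h * (\<integral>x. H x * X x \<partial>M)"
      unfolding eq using iQ[of j] i0 i1 unfolding h_def[symmetric] by simp
    then show ?thesis unfolding h_def[symmetric] using h by (simp add: field_simps)
  qed
  ultimately show "(\<lambda>j. ((\<integral>x. H x * exp (1 / real (Suc j) * X x - (1 / real (Suc j))\<^sup>2 * K) \<partial>M) - (\<integral>x. H x \<partial>M)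
        - 1 / real (Suc j) * (\<integral>x. H x * X x \<partial>M)) / (1 / real (Suc j))\<^sup>2)
      \<longlonglongrightarrow> (\<integral>x. H x * ((X x)\<^sup>2 / 2 - K) \<partial>M)" by (simp only:)
qed

section \<open>The second variation in a direction\<close>

lemma tilt_nonneg: "0 \<le> tilt n a x"
  by (simp add: tilt_def)

lemma gauss2_shift:
  "distr (gauss_sq n) (gauss_sq n) (\<lambda>p. (lincomb n 1 1 (fst p) a, lincomb n 1 1 (snd p) b))
    = density (gauss_sq n) (\<lambda>p. ennreal (tilt n a (fst p) * tilt n b (snd p)))"
proof -
  have m: "(\<lambda>x. lincomb n 1 1 x a) \<in> measurable (gauss n) (gauss n)" for a by measurable
  have ps: "prob_space (distr (gauss n) (gauss n) (\<lambda>x. lincomb n 1 1 x a))" for a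
    by (rule gauss.prob_space_distr[OF m])
  then have sf: "sigma_finite_measure (distr (gauss n) (gauss n) (\<lambda>x. lincomb n 1 1 x a))" for a
    using prob_space_imp_sigma_finite by blast
  have "distr (gauss_sq n) (gauss_sq n) (\<lambda>p. (lincomb n 1 1 (fst p) a, lincomb n 1 1 (snd p) b))
    = distr (gauss n) (gauss n) (\<lambda>x. lincomb n 1 1 x a) \<Otimes>\<^sub>M distr (gauss n) (gauss n) (\<lambda>x. lincomb n 1 1 x b)"
    by (subst pair_measure_distr[OF m m sf]) (simp add: case_prod_beta')
  also have "\<dots> = density (gauss_sq n) (\<lambda>(x, y). ennreal (tilt n a x) * ennreal (tilt n b y))"
    using sf[of b] unfolding gauss_shift
    by (intro pair_measure_density) (auto simp: gauss.sigma_finite_measure_axioms)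
  also have "\<dots> = density (gauss_sq n) (\<lambda>p. ennreal (tilt n a (fst p) * tilt n b (snd p)))"
    by (simp add: case_prod_beta' ennreal_mult tilt_def)
  finally show ?thesis .
qed

lemma integral_gauss2_shift:
  fixes g :: "_ \<Rightarrow> real"
  assumes [measurable]: "g \<in> borel_measurable (borel_vec n \<Otimes>\<^sub>M borel_vec n)"
  shows "(\<integral>p. g (lincomb n 1 1 (fst p) a, lincomb n 1 1 (snd p) b) \<partial>gauss_sq n)
    = (\<integral>p. g p * (tilt n a (fst p) * tilt n b (snd p)) \<partial>gauss_sq n)"
proof -
  have "(\<lambda>p. (lincomb n 1 1 (fst p) a, lincomb n 1 1 (snd p) b)) \<in> measurable (gauss_sq n) (gauss_sq n)"
    by measurable
  then have "(\<integral>p. g (lincomb n 1 1 (fst p) a, lincomb n 1 1 (snd p) b) \<partial>gauss_sq n)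
    = (\<integral>p. g p \<partial>distr (gauss_sq n) (gauss_sq n) (\<lambda>p. (lincomb n 1 1 (fst p) a, lincomb n 1 1 (snd p) b)))"
    by (subst integral_distr) auto
  also have "\<dots> = (\<integral>p. g p * (tilt n a (fst p) * tilt n b (snd p)) \<partial>gauss_sq n)"
    unfolding gauss2_shift by (subst integral_density) (measurable, auto simp: tilt_nonneg mult.commute)
  finally show ?thesis .
qed

lemma integrable_tilt2: "integrable (gauss_sq n) (\<lambda>p. tilt n a (fst p) * tilt n b (snd p))"
proof -
  let ?P = "gauss_sq n"
  let ?S = "\<lambda>p. (lincomb n 1 1 (fst p) a, lincomb n 1 1 (snd p) b)"
  have m: "?S \<in> measurable ?P ?P" by measurable
  have "(\<integral>\<^sup>+p. ennreal (tilt n a (fst p) * tilt n b (snd p)) \<partial>?P)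
     = emeasure (density ?P (\<lambda>p. ennreal (tilt n a (fst p) * tilt n b (snd p)))) (space ?P)"
  proof -
    have "(\<lambda>p. ennreal (tilt n a (fst p) * tilt n b (snd p))) \<in> borel_measurable ?P" by measurable
    from emeasure_density[OF this sets.top] show ?thesis by (simp cong: nn_integral_cong)
  qed
  also have "\<dots> = emeasure (distr ?P ?P ?S) (space ?P)" by (simp only: gauss2_shift)
  also have "\<dots> = 1" using prob_space.emeasure_space_1[OF gauss2.P.prob_space_distr[OF m]] by simp
  finally show ?thesis by (intro integrableI_nonneg) (measurable, auto simp: tilt_nonneg)
qed

lemma tilt_scaled: "tilt n (\<lambda>i. s * w i) x = exp (s * inner_k n w x - s\<^sup>2 * inner_k n w w / 2)"
proof -
  have "inner_k n (\<lambda>i. s * w i) x = s * inner_k n w x" "inner_k n (\<lambda>i. s * w i) (\<lambda>i. s * w i) = s\<^sup>2 * inner_k n w w"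
    by (simp_all add: inner_k_def sum_distrib_left power2_eq_square mult_ac)
  then show ?thesis by (simp add: tilt_def)
qed

lemma integrable_exp_inner: "integrable (gauss n) (\<lambda>x. exp (c * inner_k n w x))"
proof -
  have "exp (c * inner_k n w x) = exp (c\<^sup>2 * inner_k n w w / 2) * tilt n (\<lambda>i. c * w i) x" for x
    unfolding tilt_scaled exp_add[symmetric] by simp
  then show ?thesis using integrable_tilt[of n "\<lambda>i. c * w i"] by simp
qed

lemma integrable_exp2: "integrable (gauss_sq n) (\<lambda>p. exp (a * inner_k n w (fst p) + b * inner_k n w (snd p)))"
proof -
  have "exp (a * inner_k n w x + b * inner_k n w z) =
    exp (a\<^sup>2 * inner_k n w w / 2 + b\<^sup>2 * inner_k n w w / 2) * (tilt n (\<lambda>i. a * w i) x * tilt n (\<lambda>i. b * w i) z)" for x z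
    unfolding tilt_scaled exp_add[symmetric] by simp
  then show ?thesis using integrable_tilt2[of n "\<lambda>i. a * w i" "\<lambda>i. b * w i"] by simp
qed

lemma ip_cong:
  assumes "\<And>x i. x \<in> vecs n \<Longrightarrow> i < k \<Longrightarrow> F x i = F' x i"
    "\<And>x i. x \<in> vecs n \<Longrightarrow> i < k \<Longrightarrow> G x i = G' x i"
  shows "ip n k F G = ip n k F' G'"
  unfolding ip_def inner_k_def using assms by (intro Bochner_Integration.integral_cong sum.cong refl) auto

lemma ip_add_const:
  assumes "vbdd n k G" "vbdd n k v"
  shows "ip n k (\<lambda>x i. G x i + c i) v = ip n k G v + (\<Sum>i<k. c i * (\<integral>x. v x i \<partial>gauss n))"
proof -
  have "ip n k (\<lambda>x i. - c i) v = (\<Sum>i<k. \<integral>x. - c i * v x i \<partial>gauss n)"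
    using assms by (intro ip_sum) auto
  also have "\<dots> = - (\<Sum>i<k. c i * (\<integral>x. v x i \<partial>gauss n))" by (simp add: sum_negf)
  finally show ?thesis using ip_diff_left[where F=G and F'="\<lambda>x i. - c i" and G=v and n=n and k=k] assms by auto
qed

lemma lincomb_1_0: "x \<in> vecs n \<Longrightarrow> lincomb n 1 0 x w = x"
  by (rule vec_eqI[OF lincomb_in_space]) auto

text \<open>By Cameron-Martin, \<open>ker\<close> says that the mean of the translate of
  \<open>u\<close> by \<open>t w\<close> has zero derivative at \<open>t = 0\<close>. The condition
  is linear in \<open>w\<close>.\<close>

locale stable_direction = stable_maximizer +
  fixes w :: "nat \<Rightarrow> real"
  assumes ker: "\<And>i. i < k \<Longrightarrow> (\<integral>x. u x i * inner_k n w x \<partial>gauss n) = 0"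
begin

definition ut :: "real \<Rightarrow> (nat \<Rightarrow> real) \<Rightarrow> nat \<Rightarrow> real" where "ut t x = u (lincomb n 1 t x w)"
definition Nt :: "real \<Rightarrow> (nat \<Rightarrow> real) \<Rightarrow> nat \<Rightarrow> real" where "Nt t x = N (lincomb n 1 t x w)"
definition F :: "real \<Rightarrow> real \<Rightarrow> real" where "F s t = ip n k (Nt t) (ut s)"
definition m :: "real \<Rightarrow> nat \<Rightarrow> real" where "m t i = (\<integral>x. ut t x i \<partial>gauss n)"

lemma ut_ball: "ball_valued n k (ut t)"
proof -
  have [measurable]: "u \<in> measurable (borel_vec n) (borel_vec k)" using u by (simp add: ball_valued_def)
  have "ut t \<in> measurable (borel_vec n) (borel_vec k)" unfolding ut_def by measurable
  then show ?thesis unfolding ball_valued_def ut_def using u_le_1[OF lincomb_in_space] by auto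
qed

lemma utb: "vbdd n k (ut t)" by (rule ball_valued_vbdd[OF ut_ball])

lemma Ntb: "vbdd n k (Nt t)" unfolding Nt_def by (rule vbdd_shift[OF Nb])

lemma F_diag: "F t t = (\<integral>x. vnorm k (Nt t x) \<partial>gauss n)"
  unfolding F_def ip_def Nt_def ut_def dual ..

text \<open>At each point \<open>u_t\<close> is the best ball-valued partner of \<open>N_t\<close>,
  and no other translate can do better.\<close>

lemma F_le_diag: "F s t \<le> F t t"
  unfolding F_diag unfolding F_def by (rule ip_le_vnorm[OF Ntb ut_ball])

text \<open>Mehler's formula shrinks \<open>x\<close> by \<open>r\<close>, so a translation by
  \<open>t\<close> before the operator is one by \<open>t / r\<close> after it. This mismatch is
  what makes the second-order comparison conclusive for \<open>r < 1\<close>.\<close>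

lemma vou_ut: "vou n r (ut t) = (\<lambda>x i. Nt (t / r) x i + lam i)"
proof (intro ext)
  fix x i
  have "vou n r (ut t) x i = ou n r (\<lambda>y. u y i) (lincomb n 1 (t / r) x w)"
    unfolding vou_def ut_def using r by (intro ou_shift[where \<phi>="\<lambda>y. u y i"]) auto
  then show "vou n r (ut t) x i = Nt (t / r) x i + lam i" unfolding Nt_def unfolding N_eq vou_def by simp
qed

lemma vou_u: "vou n r u = (\<lambda>x i. N x i + lam i)" by (simp add: N_eq)

lemma ip_vou_ut: "vbdd n k v \<Longrightarrow> ip n k (vou n r (ut t)) v = ip n k (Nt (t / r)) v + (\<Sum>i<k. lam i * (\<integral>x. v x i \<partial>gauss n))"
  unfolding vou_ut by (rule ip_add_const[OF Ntb])

lemma ip_Nt_u: "ip n k (Nt t) u = F 0 t"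
  unfolding F_def by (rule ip_cong) (auto simp: ut_def lincomb_1_0)

lemma ip_N_ut: "ip n k N (ut s) = F s 0"
  unfolding F_def by (rule ip_cong) (auto simp: Nt_def lincomb_1_0)

lemma ip_N_u: "ip n k N u = F 0 0"
  unfolding F_def by (rule ip_cong) (auto simp: Nt_def ut_def lincomb_1_0)

lemma energy_ut: "ip n k (vou n r (ut t)) (ut t) = F t (t / r) + (\<Sum>i<k. lam i * m t i)"
  using ip_vou_ut[OF utb] by (simp add: F_def m_def)

lemma energy_u: "ip n k (vou n r u) u = F 0 0"
  unfolding vou_u ip_add_const[OF Nb ub] using u(2) by (simp add: ip_N_u mean_zero_def)

lemma cross_u_ut: "ip n k (vou n r u) (ut t) = F t 0 + (\<Sum>i<k. lam i * m t i)"
  unfolding vou_u ip_add_const[OF Nb utb] by (simp add: ip_N_ut m_def)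

text \<open>Self-adjointness evaluates the pairing of \<open>T u\<close> with \<open>u_t\<close> in
  two ways. The term with \<open>lam\<close> is thereby expressed through \<open>F\<close> and drops
  out of the comparison.\<close>

lemma lam_m: "F 0 (t / r) = F t 0 + (\<Sum>i<k. lam i * m t i)"
proof -
  have "ip n k (vou n r (ut t)) u = F 0 (t / r)"
    using ip_vou_ut[OF ub] u(2) by (simp add: ip_Nt_u mean_zero_def)
  then show ?thesis using ip_vou_sym[OF ub utb, of r t] r by (simp add: cross_u_ut)
qed

lemma stab_difference:
  "ip n k (vou n r (\<lambda>x i. ut t x i - u x i)) (\<lambda>x i. ut t x i - u x i) = F t (t / r) - F t 0 - F 0 (t / r) + F 0 0"
  using ip_vou_diff[OF utb ub, of r t] r energy_ut[of t] energy_u cross_u_ut[of t] lam_m[of t] by simp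

text \<open>The competitor \<open>g\<close> maximizes the functional of \<open>T u_t\<close>, so its
  pairing with \<open>T u_t\<close> is at least that of \<open>u_t\<close> up to a term with
  \<open>\<nu>\<close>. Positivity of the form on \<open>g - u_t\<close> and optimality of
  \<open>u\<close> against \<open>g\<close> give the second conclusion; the first is what later
  controls the size of \<open>\<nu>\<close>.\<close>

lemma competitor:
  obtains \<nu> where "(\<integral>x. vnorm k (\<lambda>i. Nt (t / r) x i - \<nu> i) \<partial>gauss n) \<le> (\<integral>x. vnorm k (Nt (t / r) x) \<partial>gauss n)"
    "F t 0 - F 0 0 + F t (t / r) - F 0 (t / r) \<le> 2 * (\<Sum>i<k. \<nu> i * m t i)"
proof -
  obtain \<nu> g where g: "ball_valued n k g" "mean_zero n k g"
    "\<And>x. inner_k k (\<lambda>i. Nt (t / r) x i - \<nu> i) (g x) = vnorm k (\<lambda>i. Nt (t / r) x i - \<nu> i)"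
    using dual_maximizer[of k n "Nt (t / r)"] Ntb by metis
  note gb = ball_valued_vbdd[OF g(1)]
  have eq: "(\<integral>x. vnorm k (\<lambda>i. Nt (t / r) x i - \<nu> i) \<partial>gauss n) = ip n k (Nt (t / r)) g"
    using ip_diff_const[OF Ntb gb g(2), of "t / r" \<nu>] by (simp add: ip_def g(3))
  have le: "(\<integral>x. vnorm k (\<lambda>i. Nt (t / r) x i - \<nu> i) \<partial>gauss n) \<le> (\<integral>x. vnorm k (Nt (t / r) x) \<partial>gauss n)"
    unfolding eq by (rule ip_le_vnorm[OF Ntb g(1)])
  have "0 \<le> ip n k (vou n r g) g - 2 * ip n k (vou n r (ut t)) g + ip n k (vou n r (ut t)) (ut t)"
    using ip_vou_nonneg[OF vbdd_diff[OF gb utb] r, of t] ip_vou_diff[OF gb utb, of r t] r by simp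
  moreover have "ip n k (vou n r g) g \<le> F 0 0" using max[OF g(1,2)] by (simp add: energy_u)
  moreover have "ip n k (vou n r (ut t)) g = ip n k (Nt (t / r)) g"
    using ip_vou_ut[OF gb] g(2) by (simp add: mean_zero_def)
  moreover have "ip n k (\<lambda>x i. Nt (t / r) x i - \<nu> i) (ut t) \<le> ip n k (Nt (t / r)) g"
    unfolding eq[symmetric] by (rule ip_le_vnorm[OF vbdd_diff_const[OF Ntb] ut_ball])
  moreover have "ip n k (\<lambda>x i. Nt (t / r) x i - \<nu> i) (ut t) = F t (t / r) - (\<Sum>i<k. \<nu> i * m t i)"
    using ip_add_const[OF Ntb utb, of "t / r" "\<lambda>i. - \<nu> i" t] by (simp add: F_def m_def sum_negf)
  ultimately have "F t 0 - F 0 0 + F t (t / r) - F 0 (t / r) \<le> 2 * (\<Sum>i<k. \<nu> i * m t i)"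
    using energy_ut[of t] lam_m[of t] by linarith
  with le show thesis by (rule that)
qed

text \<open>Once the translation has moved onto the density, the terms of order \<open>0\<close> and
  \<open>1\<close> vanish by mean zero and by \<open>ker\<close>.\<close>

lemma m_expansion:
  assumes i: "i < k"
  shows "\<exists>l. (\<lambda>j. m (1 / real (Suc j)) i / (1 / real (Suc j))\<^sup>2) \<longlonglongrightarrow> l"
proof -
  have [measurable]: "(\<lambda>x. u x i) \<in> borel_measurable (borel_vec n)" using ub i bdd_meas_measurable by auto
  have [measurable]: "(\<lambda>x. inner_k n w x) \<in> borel_measurable (borel_vec n)" unfolding inner_k_def by measurable
  have meq: "m t i = (\<integral>x. u x i * exp (t * inner_k n w x - t\<^sup>2 * (inner_k n w w / 2)) \<partial>gauss n)" for t
  proof -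
    have "ut t x i = u (lincomb n 1 1 x (\<lambda>l. t * w l)) i" for x
      unfolding ut_def by (intro arg_cong[where f="\<lambda>y. u y i"] vec_eqI[of _ n]) auto
    then have "m t i = (\<integral>x. tilt n (\<lambda>l. t * w l) x * u x i \<partial>gauss n)"
      unfolding m_def using integral_gauss_shift[of "\<lambda>x. u x i" n "\<lambda>l. t * w l"] by simp
    then show ?thesis by (simp add: tilt_scaled mult.commute)
  qed
  have w0: "0 \<le> inner_k n w w / 2" by (simp add: vnorm_sq[symmetric])
  have "(\<lambda>j. ((\<integral>x. u x i * exp (1 / real (Suc j) * inner_k n w x - (1 / real (Suc j))\<^sup>2 * (inner_k n w w / 2)) \<partial>gauss n) - (\<integral>x. u x i \<partial>gauss n)
        - 1 / real (Suc j) * (\<integral>x. u x i * inner_k n w x \<partial>gauss n)) / (1 / real (Suc j))\<^sup>2)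
      \<longlonglongrightarrow> (\<integral>x. u x i * ((inner_k n w x)\<^sup>2 / 2 - inner_k n w w / 2) \<partial>gauss n)"
    by (rule second_order_expansion(3)[where C=1, OF gauss.prob_space_axioms _ _ _ integrable_exp_inner w0])
       (use ball_valued_abs_le[OF u(1) i] in auto)
  then show ?thesis using ker[OF i] u(2) i unfolding meq[symmetric] mean_zero_def by auto
qed

text \<open>Written as an integral over \<open>x\<close> and the noise, \<open>F\<close> carries
  both translations as factors of the density. One set of coefficients serves all directions
  \<open>(\<alpha>, \<beta>)\<close>, so inequalities along different directions can be
  combined.\<close>

lemma F_expansion:
  "\<exists>l1 l2 a b d. \<forall>\<alpha> \<beta>. (\<lambda>j. (F (\<alpha> * (1 / real (Suc j))) (\<beta> * (1 / real (Suc j))) - F 0 0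
      - 1 / real (Suc j) * (\<alpha> * l1 + (\<beta> - \<alpha>) * l2)) / (1 / real (Suc j))\<^sup>2)
    \<longlonglongrightarrow> \<alpha>\<^sup>2 * a + \<alpha> * (\<beta> - \<alpha>) * b + (\<beta> - \<alpha>)\<^sup>2 * d"
proof -
  let ?P = "gauss_sq n"
  let ?s = "sqrt (1 - r\<^sup>2)"
  have s: "?s > 0" using r by (simp add: power_less_one_iff)
  \<comment> \<open>Translating \<open>u\<close> by \<open>s w\<close> and \<open>N\<close> by
    \<open>t w\<close> moves \<open>x\<close> by \<open>s w\<close>. The remaining
    \<open>r (t - s) w\<close> is absorbed by the noise, whose coefficient is \<open>?s\<close>;
    hence the factor \<open>r / ?s\<close>.\<close>
  define c where "c = r / ?s"
  define W where "W = inner_k n w w / 2"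
  have W: "W \<ge> 0" by (simp add: W_def vnorm_sq[symmetric])
  have um[measurable]: "i < k \<Longrightarrow> (\<lambda>x. u x i) \<in> borel_measurable (borel_vec n)" for i using ub bdd_meas_measurable by auto
  have wm[measurable]: "(\<lambda>x. inner_k n w x) \<in> borel_measurable (borel_vec n)" unfolding inner_k_def by measurable
  define H where "H p = (\<Sum>i<k. u (fst p) i * (u (lincomb n r ?s (fst p) (snd p)) i - lam i))" for p
  have H[measurable]: "H \<in> borel_measurable (borel_vec n \<Otimes>\<^sub>M borel_vec n)"
    unfolding H_def by (rule borel_measurable_sum) measurable
  define C where "C = (\<Sum>i<k. 1 + \<bar>lam i\<bar>)"
  have Hb: "\<bar>H p\<bar> \<le> C" if "fst p \<in> vecs n" for p
  proof -
    have "\<bar>H p\<bar> \<le> (\<Sum>i<k. \<bar>u (fst p) i * (u (lincomb n r ?s (fst p) (snd p)) i - lam i)\<bar>)"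
      unfolding H_def by (rule sum_abs)
    also have "\<dots> \<le> C" unfolding C_def
    proof (rule sum_mono)
      fix i assume i: "i \<in> {..<k}"
      have "\<bar>u (fst p) i\<bar> \<le> 1" "\<bar>u (lincomb n r ?s (fst p) (snd p)) i\<bar> \<le> 1"
        using ball_valued_abs_le[OF u(1)] i that by auto
      then have "\<bar>u (fst p) i\<bar> * \<bar>u (lincomb n r ?s (fst p) (snd p)) i - lam i\<bar> \<le> 1 * (1 + \<bar>lam i\<bar>)"
        by (intro mult_mono) auto
      then show "\<bar>u (fst p) i * (u (lincomb n r ?s (fst p) (snd p)) i - lam i)\<bar> \<le> 1 + \<bar>lam i\<bar>"
        by (simp add: abs_mult)
    qed
    finally show ?thesis .
  qed
  define X1 where "X1 p = inner_k n w (fst p)" for p :: "(nat \<Rightarrow> real) \<times> (nat \<Rightarrow> real)"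
  define X2 where "X2 p = c * inner_k n w (snd p)" for p :: "(nat \<Rightarrow> real) \<times> (nat \<Rightarrow> real)"
  have [measurable]: "X1 \<in> borel_measurable ?P" "X2 \<in> borel_measurable ?P" unfolding X1_def X2_def by measurable
  have ex: "integrable ?P (\<lambda>p. exp (e * (\<alpha> * X1 p + \<beta> * X2 p)))" for e \<alpha> \<beta>
    using integrable_exp2[of n "e * \<alpha>" w "e * \<beta> * c"] by (simp add: X1_def X2_def algebra_simps)
  have repr: "F s t = (\<integral>p. H p * exp (s * X1 p + (t - s) * X2 p - (s\<^sup>2 * W + (t - s)\<^sup>2 * (c\<^sup>2 * W))) \<partial>?P)" for s t
  proof -
    let ?a = "\<lambda>l. s * w l" and ?b = "\<lambda>l. (c * (t - s)) * w l"
    let ?g = "\<lambda>p. \<Sum>i<k. ut s (fst p) i * (u (lincomb n r ?s (lincomb n 1 t (fst p) w) (snd p)) i - lam i)"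
    have g: "?g p = H (lincomb n 1 1 (fst p) ?a, lincomb n 1 1 (snd p) ?b)" for p
    proof -
      have "lincomb n 1 s (fst p) w = lincomb n 1 1 (fst p) ?a" by (intro vec_eqI[of _ n]) auto
      moreover have "lincomb n r ?s (lincomb n 1 t (fst p) w) (snd p) = lincomb n r ?s (lincomb n 1 1 (fst p) ?a) (lincomb n 1 1 (snd p) ?b)"
        using s by (intro vec_eqI[of _ n]) (auto simp: c_def field_simps)
      ultimately show ?thesis by (simp add: H_def ut_def)
    qed
    have gm: "?g \<in> borel_measurable (borel_vec n \<Otimes>\<^sub>M borel_vec n)" unfolding g by measurable
    have "integrable ?P ?g"
    proof (rule integrable_gauss2[where C=C, OF gm])
      show "\<bar>?g (x, z)\<bar> \<le> C" for x z unfolding g by (rule Hb) simp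
    qed
    from gauss2.integral_fst'[OF this]
    have "(\<integral>p. ?g p \<partial>?P) = (\<integral>x. \<integral>z. ?g (x, z) \<partial>gauss n \<partial>gauss n)" by simp
    also have "\<dots> = F s t"
      unfolding F_def ip_def inner_k_def
    proof (intro Bochner_Integration.integral_cong refl)
      fix x
      have "(\<integral>z. ?g (x, z) \<partial>gauss n) = (\<Sum>i<k. \<integral>z. ut s x i * (u (lincomb n r ?s (lincomb n 1 t x w) z) i - lam i) \<partial>gauss n)"
        unfolding fst_conv snd_conv
      proof (rule Bochner_Integration.integral_sum)
        fix i assume "i \<in> {..<k}"
        then show "integrable (gauss n) (\<lambda>z. ut s x i * (u (lincomb n r ?s (lincomb n 1 t x w) z) i - lam i))"
          using ub by (intro integrable_mult_right Bochner_Integration.integrable_diff ou_integrable[where \<phi>="\<lambda>x. u x i"]) auto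
      qed
      also have "\<dots> = (\<Sum>i<k. Nt t x i * ut s x i)"
      proof (rule sum.cong)
        fix i assume "i \<in> {..<k}"
        then have "integrable (gauss n) (\<lambda>z. u (lincomb n r ?s (lincomb n 1 t x w) z) i)"
          using ub by (intro ou_integrable[where \<phi>="\<lambda>x. u x i"]) auto
        then show "(\<integral>z. ut s x i * (u (lincomb n r ?s (lincomb n 1 t x w) z) i - lam i) \<partial>gauss n) = Nt t x i * ut s x i"
          using gauss.prob_space[of n] unfolding Nt_def unfolding N_eq vou_def ou_def by simp
      qed simp
      finally show "(\<integral>z. ?g (x, z) \<partial>gauss n) = (\<Sum>i<k. Nt t x i * ut s x i)" .
    qed
    finally have "F s t = (\<integral>p. H (lincomb n 1 1 (fst p) ?a, lincomb n 1 1 (snd p) ?b) \<partial>?P)" unfolding g by simp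
    also have "\<dots> = (\<integral>p. H p * (tilt n ?a (fst p) * tilt n ?b (snd p)) \<partial>?P)"
      by (rule integral_gauss2_shift[OF H])
    also have "\<dots> = (\<integral>p. H p * exp (s * X1 p + (t - s) * X2 p - (s\<^sup>2 * W + (t - s)\<^sup>2 * (c\<^sup>2 * W))) \<partial>?P)"
      unfolding tilt_scaled exp_add[symmetric] X1_def X2_def W_def
      by (intro Bochner_Integration.integral_cong refl arg_cong2[where f="(*)"] arg_cong[where f=exp]) (simp add: power2_eq_square field_simps)
    finally show ?thesis .
  qed
  have F00: "F 0 0 = (\<integral>p. H p \<partial>?P)" using repr[of 0 0] by simp
  have HbP: "\<And>p. p \<in> space ?P \<Longrightarrow> \<bar>H p\<bar> \<le> C" using Hb by (auto simp: space_pair_measure)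
  have HM: "H \<in> borel_measurable ?P" by measurable
  have XM: "(\<lambda>p. \<alpha> * X1 p + \<beta> * X2 p) \<in> borel_measurable ?P" for \<alpha> \<beta> by measurable
  note so = second_order_expansion[OF gauss2.P.prob_space_axioms HM XM HbP ex]
  have i1: "integrable ?P (\<lambda>p. H p * X1 p)" "integrable ?P (\<lambda>p. H p * X2 p)"
    using so(1)[of 0 1 0] so(1)[of 0 0 1] by simp_all
  have i2: "integrable ?P (\<lambda>p. H p * (X1 p)\<^sup>2)" "integrable ?P (\<lambda>p. H p * (X2 p)\<^sup>2)"
    using so(2)[of 0 1 0] so(2)[of 0 0 1] by simp_all
  have i12: "integrable ?P (\<lambda>p. H p * (X1 p * X2 p))"
  proof -
    have eq: "H p * (X1 p * X2 p) = (H p * (1 * X1 p + 1 * X2 p)\<^sup>2 - H p * (X1 p)\<^sup>2 - H p * (X2 p)\<^sup>2) / 2" for p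
      by (simp add: power2_eq_square field_simps)
    show ?thesis unfolding eq
      by (intro integrable_divide Bochner_Integration.integrable_diff so(2)[of 0 1 1] i2) simp_all
  qed
  have iH: "integrable ?P H" using HbP by (intro gauss2.P.integrable_const_bound[where B=C]) auto
  define l1 l2 where "l1 = (\<integral>p. H p * X1 p \<partial>?P)" and "l2 = (\<integral>p. H p * X2 p \<partial>?P)"
  define a where "a = (\<integral>p. H p * (X1 p)\<^sup>2 \<partial>?P) / 2 - W * F 0 0"
  define b where "b = (\<integral>p. H p * (X1 p * X2 p) \<partial>?P)"
  define d where "d = (\<integral>p. H p * (X2 p)\<^sup>2 \<partial>?P) / 2 - c\<^sup>2 * W * F 0 0"
  show ?thesis
  proof (intro exI allI)
    fix \<alpha> \<beta>
    let ?K = "\<alpha>\<^sup>2 * W + (\<beta> - \<alpha>)\<^sup>2 * (c\<^sup>2 * W)"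
    let ?X = "\<lambda>p. \<alpha> * X1 p + (\<beta> - \<alpha>) * X2 p"
    have K: "?K \<ge> 0" using W by simp
    have Fh: "F (\<alpha> * h) (\<beta> * h) = (\<integral>p. H p * exp (h * ?X p - h\<^sup>2 * ?K) \<partial>?P)" for h
      unfolding repr
      by (intro Bochner_Integration.integral_cong refl arg_cong2[where f="(*)"] arg_cong[where f=exp]) (simp add: power2_eq_square algebra_simps)
    have L: "(\<integral>p. H p * ?X p \<partial>?P) = \<alpha> * l1 + (\<beta> - \<alpha>) * l2"
    proof -
      have "(\<integral>p. H p * ?X p \<partial>?P) = (\<integral>p. \<alpha> * (H p * X1 p) + (\<beta> - \<alpha>) * (H p * X2 p) \<partial>?P)"
        by (intro Bochner_Integration.integral_cong refl) (simp add: algebra_simps)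
      then show ?thesis using i1 by (simp add: l1_def l2_def)
    qed
    have Q: "(\<integral>p. H p * ((?X p)\<^sup>2 / 2 - ?K) \<partial>?P) = \<alpha>\<^sup>2 * a + \<alpha> * (\<beta> - \<alpha>) * b + (\<beta> - \<alpha>)\<^sup>2 * d"
    proof -
      have "(\<integral>p. H p * ((?X p)\<^sup>2 / 2 - ?K) \<partial>?P) =
        (\<integral>p. (\<alpha>\<^sup>2 / 2) * (H p * (X1 p)\<^sup>2) + (\<alpha> * (\<beta> - \<alpha>)) * (H p * (X1 p * X2 p)) + ((\<beta> - \<alpha>)\<^sup>2 / 2) * (H p * (X2 p)\<^sup>2) - ?K * H p \<partial>?P)"
        by (intro Bochner_Integration.integral_cong refl) (simp add: power2_eq_square field_simps)
      also have "\<dots> = (\<alpha>\<^sup>2 / 2) * (\<integral>p. H p * (X1 p)\<^sup>2 \<partial>?P) + (\<alpha> * (\<beta> - \<alpha>)) * b + ((\<beta> - \<alpha>)\<^sup>2 / 2) * (\<integral>p. H p * (X2 p)\<^sup>2 \<partial>?P) - ?K * F 0 0"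
        using i2 i12 iH by (simp add: b_def F00)
      finally show ?thesis by (simp add: a_def d_def algebra_simps)
    qed
    show "(\<lambda>j. (F (\<alpha> * (1 / real (Suc j))) (\<beta> * (1 / real (Suc j))) - F 0 0
      - 1 / real (Suc j) * (\<alpha> * l1 + (\<beta> - \<alpha>) * l2)) / (1 / real (Suc j))\<^sup>2)
      \<longlonglongrightarrow> \<alpha>\<^sup>2 * a + \<alpha> * (\<beta> - \<alpha>) * b + (\<beta> - \<alpha>)\<^sup>2 * d"
      unfolding Fh F00 L[symmetric] Q[symmetric] by (rule so(3)) (use K in auto)
  qed
qed

end

section \<open>Second-order comparison with the competitor\<close>

lemma quadratic_nonpos_imp_linear_zero:
  fixes p s :: real
  assumes "\<And>e. e * p + e\<^sup>2 * s \<le> 0"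
  shows "p = 0"
proof (rule ccontr)
  assume p: "p \<noteq> 0"
  \<comment> \<open>A step \<open>e = c p\<close> this small prevents the quadratic term from
    offsetting the positive linear one.\<close>
  define c where "c = 1 / (\<bar>s\<bar> + 1)"
  have c: "c > 0" "c * (\<bar>s\<bar> + 1) = 1" by (auto simp: c_def)
  have "(c * p) * p + (c * p)\<^sup>2 * s = c * p\<^sup>2 * (1 + c * s)" by (simp add: power2_eq_square algebra_simps)
  moreover have "c * s > - 1"
  proof -
    have "c * (- s) \<le> c * \<bar>s\<bar>" using c by (intro mult_left_mono) auto
    then have "- (c * s) \<le> c * \<bar>s\<bar>" by simp
    moreover have "c * \<bar>s\<bar> = 1 - c" using c(2) by (simp add: algebra_simps)
    ultimately show ?thesis using c(1) by linarith
  qed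
  ultimately have "(c * p) * p + (c * p)\<^sup>2 * s > 0" using c p by simp
  then show False using assms[of "c * p"] by linarith
qed

lemma inverse_Suc_tendsto_0: "(\<lambda>j. 1 / real (Suc j)) \<longlonglongrightarrow> 0"
  using LIMSEQ_inverse_real_of_nat by (simp add: inverse_eq_divide)

context stable_direction
begin

text \<open>The multipliers are bounded, so a subsequence staying away from \<open>0\<close> would
  have a limit point \<open>l\<close> at which \<open>|N - l|\<close> has expectation at most that
  of \<open>|N|\<close>; \<open>multiplier_unique\<close> then forces \<open>l = 0\<close>.\<close>

lemma multipliers_tendsto_0:
  assumes le: "\<And>j. (\<integral>x. vnorm k (\<lambda>i. Nt (1 / real (Suc j) / r) x i - \<nu> j i) \<partial>gauss n)
      \<le> (\<integral>x. vnorm k (Nt (1 / real (Suc j) / r) x) \<partial>gauss n)" and i: "i < k"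
  shows "(\<lambda>j. \<nu> j i) \<longlonglongrightarrow> 0"
proof (rule ccontr)
  assume "\<not> ?thesis"
  then obtain e where e: "e > 0" "\<And>J. \<exists>j\<ge>J. \<bar>\<nu> j i\<bar> \<ge> e"
    unfolding LIMSEQ_iff by (auto simp: not_less)
  have "infinite {j. \<bar>\<nu> j i\<bar> \<ge> e}"
    unfolding infinite_nat_iff_unbounded_le using e(2) by auto
  then obtain s where s: "strict_mono (s :: nat \<Rightarrow> nat)" "\<And>j. s j \<in> {j. \<bar>\<nu> j i\<bar> \<ge> e}"
    using infinite_enumerate by blast
  obtain C where C: "C \<ge> 0" "\<And>i x. i < k \<Longrightarrow> x \<in> vecs n \<Longrightarrow> \<bar>N x i\<bar> \<le> C"
    using bdd_meas_uniform_bound[of k n N] Nb by metis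
  have CNt: "\<bar>Nt t x i\<bar> \<le> C" if "i < k" for t x i
    unfolding Nt_def by (rule C(2)[OF that lincomb_in_space])
  have int: "integrable (gauss n) (\<lambda>x. vnorm k (\<lambda>i. Nt t x i - c i))" for t c
    using Ntb by (intro bdd_meas_integrable bdd_meas_vnorm) auto
  have bnd: "\<bar>\<nu> j l\<bar> \<le> 2 * (real k * C)" if l: "l < k" for j l
  proof -
    let ?t = "1 / real (Suc j) / r"
    have "vnorm k (\<nu> j) \<le> vnorm k (\<lambda>i. Nt ?t x i - 0) + vnorm k (\<lambda>i. Nt ?t x i - \<nu> j i)" for x
      using vnorm_diff_triangle[where v="\<nu> j" and u="Nt ?t x" and k=k] by simp
    then have "(\<integral>x. vnorm k (\<nu> j) \<partial>gauss n) \<le> (\<integral>x. vnorm k (\<lambda>i. Nt ?t x i - 0) + vnorm k (\<lambda>i. Nt ?t x i - \<nu> j i) \<partial>gauss n)"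
      by (intro integral_mono Bochner_Integration.integrable_add int) auto
    also have "\<dots> = (\<integral>x. vnorm k (\<lambda>i. Nt ?t x i - 0) \<partial>gauss n) + (\<integral>x. vnorm k (\<lambda>i. Nt ?t x i - \<nu> j i) \<partial>gauss n)"
      by (rule Bochner_Integration.integral_add[OF int int])
    also have "\<dots> \<le> 2 * (\<integral>x. vnorm k (Nt ?t x) \<partial>gauss n)" using le[of j] by simp
    also have "(\<integral>x. vnorm k (Nt ?t x) \<partial>gauss n) \<le> real k * C"
    proof -
      have "vnorm k (Nt ?t x) \<le> real k * C" for x
      proof -
        have "vnorm k (Nt ?t x) \<le> (\<Sum>i<k. \<bar>Nt ?t x i\<bar>)" by (rule L2_set_le_sum_abs)
        also have "\<dots> \<le> (\<Sum>i<k. C)" using CNt by (intro sum_mono) auto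
        finally show ?thesis by simp
      qed
      then show ?thesis using int[of ?t "\<lambda>_. 0"] by (intro gauss.integral_le_const AE_I2) auto
    qed
    finally have "vnorm k (\<nu> j) \<le> 2 * (real k * C)" using gauss.prob_space[of n] by simp
    then show ?thesis using abs_nth_le_vnorm[OF l, of "\<nu> j"] by linarith
  qed
  define b where "b j l = (if l < k then \<nu> (s j) l else 0)" for j l
  have bb: "\<bar>b j l\<bar> \<le> 2 * (real k * C)" for j l using bnd[of l "s j"] C(1) by (simp add: b_def)
  obtain l s' where s': "strict_mono (s' :: nat \<Rightarrow> nat)" and l: "\<And>i. (\<lambda>j. b (s' j) i) \<longlonglongrightarrow> l i"
    using bounded_coordinates_subseq[of b "\<lambda>_. 2 * (real k * C)"] bb by metis
  let ?t = "\<lambda>j. 1 / real (Suc (s (s' j))) / r"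
  have "strict_mono (s \<circ> s')" using s(1) s' by (simp add: strict_mono_o)
  from LIMSEQ_subseq_LIMSEQ[OF inverse_Suc_tendsto_0 this]
  have "(\<lambda>j. 1 / real (Suc (s (s' j)))) \<longlonglongrightarrow> 0" by (simp add: comp_def)
  from tendsto_divide[OF this tendsto_const[of r]] have t0: "?t \<longlonglongrightarrow> 0" using r by simp
  have Nlim: "(\<lambda>j. Nt (?t j) x i) \<longlonglongrightarrow> N x i" if "i < k" for x i
    unfolding Nt_def
  proof (rule N_tendsto[OF that])
    fix q assume "q < n"
    have "(\<lambda>j. 1 * x q + ?t j * w q) \<longlonglongrightarrow> 1 * x q + 0 * w q" by (intro tendsto_intros t0)
    then show "(\<lambda>j. lincomb n 1 (?t j) x w q) \<longlonglongrightarrow> x q" using \<open>q < n\<close> by simp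
  qed
  have NtM: "(\<lambda>x. Nt t x i) \<in> borel_measurable (borel_vec n)" "(\<lambda>x. N x i) \<in> borel_measurable (borel_vec n)" if "i < k" for t i
    using Ntb Nb that bdd_meas_measurable by auto
  have "(\<lambda>j. \<integral>x. vnorm k (\<lambda>i. Nt (?t j) x i - b (s' j) i) \<partial>gauss n) \<longlonglongrightarrow> (\<integral>x. vnorm k (\<lambda>i. N x i - l i) \<partial>gauss n)"
  proof (rule integral_vnorm_tendsto[where C="C + 2 * (real k * C)"])
    show "\<bar>Nt (?t j) x i - b (s' j) i\<bar> \<le> C + 2 * (real k * C)" if "i < k" for i j x
      using CNt[OF that, of "?t j" x] bb[of "s' j" i] by linarith
    show "(\<lambda>j. Nt (?t j) x i - b (s' j) i) \<longlonglongrightarrow> N x i - l i" if "i < k" for i x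
      by (intro tendsto_intros Nlim l that)
  qed (use NtM in auto)
  moreover have "(\<lambda>j. \<integral>x. vnorm k (Nt (?t j) x) \<partial>gauss n) \<longlonglongrightarrow> (\<integral>x. vnorm k (N x) \<partial>gauss n)"
    by (rule integral_vnorm_tendsto[where C=C]) (use NtM CNt Nlim in auto)
  moreover have "(\<integral>x. vnorm k (\<lambda>i. Nt (?t j) x i - b (s' j) i) \<partial>gauss n) \<le> (\<integral>x. vnorm k (Nt (?t j) x) \<partial>gauss n)" for j
  proof -
    have "(\<integral>x. vnorm k (\<lambda>i. Nt (?t j) x i - b (s' j) i) \<partial>gauss n) = (\<integral>x. vnorm k (\<lambda>i. Nt (?t j) x i - \<nu> (s (s' j)) i) \<partial>gauss n)"
      by (intro Bochner_Integration.integral_cong refl vnorm_cong) (simp add: b_def)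
    then show ?thesis using le by simp
  qed
  ultimately have "(\<integral>x. vnorm k (\<lambda>i. N x i - l i) \<partial>gauss n) \<le> (\<integral>x. vnorm k (N x) \<partial>gauss n)"
    by (intro LIMSEQ_le) auto
  then have "vnorm k l = 0" by (rule multiplier_unique)
  then have "l i = 0" using i by (simp add: vnorm_eq_0)
  moreover have "\<bar>l i\<bar> \<ge> e"
  proof (rule LIMSEQ_le_const[OF tendsto_rabs[OF l[of i]]])
    show "\<exists>J. \<forall>j\<ge>J. e \<le> \<bar>b (s' j) i\<bar>" using s(2) i by (auto simp: b_def)
  qed
  ultimately show False using e(1) by simp
qed

text \<open>The inequality \<open>F s t \<le> F t t\<close> determines the Hessian of \<open>F\<close> at the origin up to one
  nonnegative number \<open>a - d\<close>; optimality against the competitor forces \<open>(1/r - 1) (a - d) \<le> 0\<close>.\<close>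

lemma stab_difference_small:
  "(\<lambda>j. (F (1 / real (Suc j)) (1 / real (Suc j) / r) - F (1 / real (Suc j)) 0 - F 0 (1 / real (Suc j) / r) + F 0 0)
      / (1 / real (Suc j))\<^sup>2) \<longlonglongrightarrow> 0"
proof -
  define h where "h j = 1 / real (Suc j)" for j
  have h: "h j > 0" for j by (simp add: h_def)
  have h0: "h \<longlonglongrightarrow> 0" unfolding h_def by (rule inverse_Suc_tendsto_0)
  define \<beta> where "\<beta> = 1 / r"
  have \<beta>: "\<beta> > 1" using r by (simp add: \<beta>_def)
  obtain l1 l2 a b d where E: "\<And>\<alpha> \<beta>. (\<lambda>j. (F (\<alpha> * h j) (\<beta> * h j) - F 0 0 - h j * (\<alpha> * l1 + (\<beta> - \<alpha>) * l2)) / (h j)\<^sup>2)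
    \<longlonglongrightarrow> \<alpha>\<^sup>2 * a + \<alpha> * (\<beta> - \<alpha>) * b + (\<beta> - \<alpha>)\<^sup>2 * d"
    using F_expansion unfolding h_def by blast
  have lin: "(\<lambda>j. (F (\<alpha> * h j) (\<beta> * h j) - F 0 0) / h j) \<longlonglongrightarrow> \<alpha> * l1 + (\<beta> - \<alpha>) * l2" for \<alpha> \<beta>
  proof -
    let ?R = "\<lambda>j. (F (\<alpha> * h j) (\<beta> * h j) - F 0 0 - h j * (\<alpha> * l1 + (\<beta> - \<alpha>) * l2)) / (h j)\<^sup>2"
    have "(\<lambda>j. h j * ?R j + (\<alpha> * l1 + (\<beta> - \<alpha>) * l2)) \<longlonglongrightarrow> 0 * (\<alpha>\<^sup>2 * a + \<alpha> * (\<beta> - \<alpha>) * b + (\<beta> - \<alpha>)\<^sup>2 * d) + (\<alpha> * l1 + (\<beta> - \<alpha>) * l2)"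
      by (intro tendsto_add tendsto_mult h0 E tendsto_const)
    moreover have "h j * ?R j + (\<alpha> * l1 + (\<beta> - \<alpha>) * l2) = (F (\<alpha> * h j) (\<beta> * h j) - F 0 0) / h j" for j
      using h[of j] by (simp add: power2_eq_square divide_simps)
    ultimately show ?thesis by simp
  qed
  \<comment> \<open>First order of \<open>F s t \<le> F t t\<close>. The directions
    \<open>(0, 1)\<close> and \<open>(1, 0)\<close> give \<open>l2 \<le> l1\<close> and
    \<open>l1 \<le> l2\<close>.\<close>
  have l_le: "\<alpha> * l1 + (\<beta> - \<alpha>) * l2 \<le> \<beta> * l1" for \<alpha> \<beta>
  proof -
    have "\<alpha> * l1 + (\<beta> - \<alpha>) * l2 \<le> \<beta> * l1 + (\<beta> - \<beta>) * l2"
    proof (rule LIMSEQ_le[OF lin lin])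
      show "\<exists>J. \<forall>j\<ge>J. (F (\<alpha> * h j) (\<beta> * h j) - F 0 0) / h j \<le> (F (\<beta> * h j) (\<beta> * h j) - F 0 0) / h j"
        using F_le_diag h by (auto intro!: divide_right_mono simp: less_imp_le)
    qed
    then show ?thesis by simp
  qed
  have l12: "l2 = l1" using l_le[of 0 1] l_le[of 1 0] by simp
  have E': "(\<lambda>j. (F (\<alpha> * h j) (\<beta> * h j) - F 0 0 - h j * (\<beta> * l1)) / (h j)\<^sup>2)
    \<longlonglongrightarrow> \<alpha>\<^sup>2 * a + \<alpha> * (\<beta> - \<alpha>) * b + (\<beta> - \<alpha>)\<^sup>2 * d" for \<alpha> \<beta>
    using E[of \<alpha> \<beta>] unfolding l12 by (simp add: algebra_simps)
  have q_le: "\<alpha>\<^sup>2 * a + \<alpha> * (\<beta> - \<alpha>) * b + (\<beta> - \<alpha>)\<^sup>2 * d \<le> \<beta>\<^sup>2 * a" for \<alpha> \<beta>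
  proof -
    have "\<alpha>\<^sup>2 * a + \<alpha> * (\<beta> - \<alpha>) * b + (\<beta> - \<alpha>)\<^sup>2 * d \<le> \<beta>\<^sup>2 * a + \<beta> * (\<beta> - \<beta>) * b + (\<beta> - \<beta>)\<^sup>2 * d"
    proof (rule LIMSEQ_le[OF E' E'])
      show "\<exists>J. \<forall>j\<ge>J. (F (\<alpha> * h j) (\<beta> * h j) - F 0 0 - h j * (\<beta> * l1)) / (h j)\<^sup>2 \<le> (F (\<beta> * h j) (\<beta> * h j) - F 0 0 - h j * (\<beta> * l1)) / (h j)\<^sup>2"
        using F_le_diag by (auto intro!: divide_right_mono)
    qed
    then show ?thesis by simp
  qed
  \<comment> \<open>Equality holds at \<open>\<alpha> = \<beta> = 1\<close>, so the derivative in
    \<open>\<alpha>\<close> vanishes there. With \<open>b = 2 a\<close> the quadratic form is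
    \<open>\<beta>^2 a - (\<beta> - \<alpha>)^2 (a - d)\<close>.\<close>
  have b: "b = 2 * a"
  proof -
    have "e * (2 * a - b) + e\<^sup>2 * (a - b + d) \<le> 0" for e
      using q_le[of "1 + e" 1] by (simp add: power2_eq_square algebra_simps)
    then have "2 * a - b = 0" by (rule quadratic_nonpos_imp_linear_zero)
    then show ?thesis by simp
  qed
  have da: "d \<le> a" using q_le[of 1 0] b by simp
  have E10: "(\<lambda>j. (F (h j) 0 - F 0 0) / (h j)\<^sup>2) \<longlonglongrightarrow> d - a"
    using E'[of 1 0] b by simp
  have E1b: "(\<lambda>j. (F (h j) (h j / r) - F 0 0 - h j * (\<beta> * l1)) / (h j)\<^sup>2) \<longlonglongrightarrow> a + (\<beta> - 1) * b + (\<beta> - 1)\<^sup>2 * d"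
    using E'[of 1 \<beta>] by (simp add: \<beta>_def)
  have E0b: "(\<lambda>j. (F 0 (h j / r) - F 0 0 - h j * (\<beta> * l1)) / (h j)\<^sup>2) \<longlonglongrightarrow> \<beta>\<^sup>2 * d"
    using E'[of 0 \<beta>] by (simp add: \<beta>_def)
  define good where "good j \<nu> \<longleftrightarrow> (\<integral>x. vnorm k (\<lambda>i. Nt (h j / r) x i - \<nu> i) \<partial>gauss n) \<le> (\<integral>x. vnorm k (Nt (h j / r) x) \<partial>gauss n)
    \<and> F (h j) 0 - F 0 0 + F (h j) (h j / r) - F 0 (h j / r) \<le> 2 * (\<Sum>i<k. \<nu> i * m (h j) i)" for j \<nu>
  have "\<exists>\<nu>. good j \<nu>" for j
    unfolding good_def by (rule competitor[of "h j"]) (intro exI conjI)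
  then obtain \<nu> where good: "\<And>j. good j (\<nu> j)" by metis
  have \<nu>1: "(\<integral>x. vnorm k (\<lambda>i. Nt (h j / r) x i - \<nu> j i) \<partial>gauss n) \<le> (\<integral>x. vnorm k (Nt (h j / r) x) \<partial>gauss n)"
    and \<nu>2: "F (h j) 0 - F 0 0 + F (h j) (h j / r) - F 0 (h j / r) \<le> 2 * (\<Sum>i<k. \<nu> j i * m (h j) i)" for j
    using good[of j] unfolding good_def by (rule conjunct1, rule conjunct2)
  have \<nu>0: "(\<lambda>j. \<nu> j i) \<longlonglongrightarrow> 0" if "i < k" for i
    by (rule multipliers_tendsto_0[OF \<nu>1[unfolded h_def] that])
  have "\<exists>L. \<forall>i<k. (\<lambda>j. m (h j) i / (h j)\<^sup>2) \<longlonglongrightarrow> L i" using m_expansion unfolding h_def by metis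
  then obtain L where L: "\<And>i. i < k \<Longrightarrow> (\<lambda>j. m (h j) i / (h j)\<^sup>2) \<longlonglongrightarrow> L i" by blast
  \<comment> \<open>The means divided by \<open>h^2\<close> converge while the multipliers tend to
    \<open>0\<close>, so the competitor costs less than order \<open>h^2\<close>.\<close>
  have rhs: "(\<lambda>j. 2 * (\<Sum>i<k. \<nu> j i * (m (h j) i / (h j)\<^sup>2))) \<longlonglongrightarrow> 2 * (\<Sum>i<k. 0 * L i)"
    by (intro tendsto_intros \<nu>0 L) auto
  have lhs: "(\<lambda>j. (F (h j) 0 - F 0 0) / (h j)\<^sup>2 + (F (h j) (h j / r) - F 0 0 - h j * (\<beta> * l1)) / (h j)\<^sup>2 - (F 0 (h j / r) - F 0 0 - h j * (\<beta> * l1)) / (h j)\<^sup>2)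
      \<longlonglongrightarrow> (d - a) + (a + (\<beta> - 1) * b + (\<beta> - 1)\<^sup>2 * d) - \<beta>\<^sup>2 * d"
    by (intro tendsto_intros E10 E1b E0b)
  \<comment> \<open>The linear parts of \<open>F h (h / r)\<close> and \<open>F 0 (h / r)\<close>
    cancel, and the quadratic parts add up to \<open>2 (\<beta> - 1) (a - d)\<close> with
    \<open>\<beta> - 1\<close> positive.\<close>
  have "(d - a) + (a + (\<beta> - 1) * b + (\<beta> - 1)\<^sup>2 * d) - \<beta>\<^sup>2 * d \<le> 2 * (\<Sum>i<k. 0 * L i)"
  proof (rule LIMSEQ_le[OF lhs rhs], intro exI allI impI)
    fix j
    have "(F (h j) 0 - F 0 0) / (h j)\<^sup>2 + (F (h j) (h j / r) - F 0 0 - h j * (\<beta> * l1)) / (h j)\<^sup>2 - (F 0 (h j / r) - F 0 0 - h j * (\<beta> * l1)) / (h j)\<^sup>2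
      = (F (h j) 0 - F 0 0 + F (h j) (h j / r) - F 0 (h j / r)) / (h j)\<^sup>2"
      by (simp add: diff_divide_distrib add_divide_distrib)
    also have "\<dots> \<le> (2 * (\<Sum>i<k. \<nu> j i * m (h j) i)) / (h j)\<^sup>2"
      using \<nu>2 by (intro divide_right_mono) auto
    also have "\<dots> = 2 * (\<Sum>i<k. \<nu> j i * (m (h j) i / (h j)\<^sup>2))"
      by (simp only: times_divide_eq_right sum_divide_distrib[symmetric])
    finally show "(F (h j) 0 - F 0 0) / (h j)\<^sup>2 + (F (h j) (h j / r) - F 0 0 - h j * (\<beta> * l1)) / (h j)\<^sup>2 - (F 0 (h j / r) - F 0 0 - h j * (\<beta> * l1)) / (h j)\<^sup>2
      \<le> 2 * (\<Sum>i<k. \<nu> j i * (m (h j) i / (h j)\<^sup>2))" .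
  qed
  then have "2 * (\<beta> - 1) * (a - d) \<le> 0" unfolding b by (simp add: power2_eq_square algebra_simps)
  then have ad: "a = d" using da \<beta> by (simp add: mult_le_0_iff)
  have "(\<lambda>j. (F (h j) (h j / r) - F 0 0 - h j * (\<beta> * l1)) / (h j)\<^sup>2 - (F (h j) 0 - F 0 0) / (h j)\<^sup>2 - (F 0 (h j / r) - F 0 0 - h j * (\<beta> * l1)) / (h j)\<^sup>2)
      \<longlonglongrightarrow> (a + (\<beta> - 1) * b + (\<beta> - 1)\<^sup>2 * d) - (d - a) - \<beta>\<^sup>2 * d"
    by (intro tendsto_intros E10 E1b E0b)
  moreover have "(a + (\<beta> - 1) * b + (\<beta> - 1)\<^sup>2 * d) - (d - a) - \<beta>\<^sup>2 * d = 0"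
    unfolding b ad by (simp add: power2_eq_square algebra_simps)
  moreover have "(F (h j) (h j / r) - F 0 0 - h j * (\<beta> * l1)) / (h j)\<^sup>2 - (F (h j) 0 - F 0 0) / (h j)\<^sup>2 - (F 0 (h j / r) - F 0 0 - h j * (\<beta> * l1)) / (h j)\<^sup>2
    = (F (h j) (h j / r) - F (h j) 0 - F 0 (h j / r) + F 0 0) / (h j)\<^sup>2" for j
    by (simp add: diff_divide_distrib add_divide_distrib)
  ultimately show ?thesis unfolding h_def by simp
qed

section \<open>From small increments to exact translation invariance\<close>

lemma increment_L1:
  assumes i: "i < k"
  shows "(\<integral>x. \<bar>Nt (t / r) x i - N x i\<bar> \<partial>gauss n) \<le> sqrt (F t (t / r) - F t 0 - F 0 (t / r) + F 0 0)"
proof -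
  let ?D = "\<lambda>i x. ut t x i - u x i"
  have Db: "bdd_meas n (?D l)" if "l < k" for l using utb ub that by auto
  \<comment> \<open>The operator maps the increment of \<open>u\<close> to the increment of
    \<open>N\<close> at \<open>t / r\<close>, so \<open>ou_L2_le_stab\<close> bounds the latter by
    the stability of the former.\<close>
  have ouD: "ou n r (?D i) x = Nt (t / r) x i - N x i" for x
    using ou_diff[of n "\<lambda>x. ut t x i" "\<lambda>x. u x i" r x] utb ub i fun_cong[OF fun_cong[OF vou_ut[of t], of x], of i]
      fun_cong[OF fun_cong[OF vou_u, of x], of i] by (simp add: vou_def)
  have nb: "bdd_meas n (\<lambda>x. \<bar>Nt (t / r) x i - N x i\<bar>)"
    using Ntb Nb i by (intro bdd_meas_abs bdd_meas_diff) auto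
  have "(\<integral>x. \<bar>Nt (t / r) x i - N x i\<bar> \<partial>gauss n)\<^sup>2 \<le> (\<integral>x. (ou n r (?D i) x)\<^sup>2 \<partial>gauss n)"
    using gauss_square_le[OF nb] by (simp add: ouD)
  also have "\<dots> \<le> stab n r (?D i) (?D i)" by (rule ou_L2_le_stab[OF Db[OF i] r])
  also have "\<dots> \<le> (\<Sum>l<k. stab n r (?D l) (?D l))"
    using i Db r by (intro member_le_sum stab_nonneg) auto
  also have "\<dots> = ip n k (vou n r (\<lambda>x i. ut t x i - u x i)) (\<lambda>x i. ut t x i - u x i)"
    using Db by (subst ip_vou) auto
  also have "\<dots> = F t (t / r) - F t 0 - F 0 (t / r) + F 0 0" by (rule stab_difference)
  finally show ?thesis by (rule real_le_rsqrt)
qed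

text \<open>Integrals at translated points are carried back with the density \<open>tilt\<close>,
  which is unbounded. Confining \<open>x\<close> to the slab where its product with \<open>w\<close>
  is at most \<open>R\<close> in absolute value bounds the density by one constant for all
  \<open>s \<le> 1 / r\<close>.\<close>

lemma localized_shift_bound:
  assumes g: "bdd_meas n g" "\<And>x. x \<in> vecs n \<Longrightarrow> 0 \<le> g x" and s: "0 \<le> s" "s \<le> 1 / r" and R: "0 \<le> R"
  shows "(\<integral>x. indicator {x \<in> space (borel_vec n). \<bar>inner_k n w x\<bar> \<le> R} x * g (lincomb n 1 s x w) \<partial>gauss n)
    \<le> exp (1 / r * (R + 1 / r * inner_k n w w)) * (\<integral>x. g x \<partial>gauss n)"
proof -
  let ?A = "{x \<in> space (borel_vec n). \<bar>inner_k n w x\<bar> \<le> R}"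
  have wm[measurable]: "(\<lambda>x. inner_k n w x) \<in> borel_measurable (borel_vec n)" unfolding inner_k_def by measurable
  have A[measurable]: "?A \<in> sets (borel_vec n)" by measurable
  note [measurable] = bdd_meas_measurable[OF g(1)]
  have ww: "inner_k n w w \<ge> 0" by (simp add: vnorm_sq[symmetric])
  let ?g = "\<lambda>y. indicator ?A (lincomb n 1 (-s) y w) * g y :: real"
  have gm: "?g \<in> borel_measurable (borel_vec n)" by measurable
  let ?K = "exp (1 / r * (R + 1 / r * inner_k n w w))"
  have "(\<integral>x. indicator ?A x * g (lincomb n 1 s x w) \<partial>gauss n) = (\<integral>x. ?g (lincomb n 1 1 x (\<lambda>l. s * w l)) \<partial>gauss n)"
  proof (rule Bochner_Integration.integral_cong)
    fix x assume x: "x \<in> space (gauss n)"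
    have "lincomb n 1 (-s) (lincomb n 1 1 x (\<lambda>l. s * w l)) w = x"
      using x by (intro vec_eqI[of _ n]) auto
    moreover have "lincomb n 1 1 x (\<lambda>l. s * w l) = lincomb n 1 s x w" by (intro vec_eqI[of _ n]) auto
    ultimately show "indicator ?A x * g (lincomb n 1 s x w) = ?g (lincomb n 1 1 x (\<lambda>l. s * w l))" by simp
  qed simp
  also have "\<dots> = (\<integral>x. tilt n (\<lambda>l. s * w l) x * ?g x \<partial>gauss n)" by (rule integral_gauss_shift[OF gm])
  also have "\<dots> \<le> (\<integral>x. ?K * g x \<partial>gauss n)"
  proof (rule integral_mono')
    show "integrable (gauss n) (\<lambda>x. ?K * g x)" using g(1) by (intro integrable_mult_right bdd_meas_integrable)
    fix x assume x: "x \<in> space (gauss n)"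
    then have gx: "0 \<le> g x" using g(2) by simp
    then show "0 \<le> ?K * g x" by simp
    show "tilt n (\<lambda>l. s * w l) x * ?g x \<le> ?K * g x"
    proof (cases "lincomb n 1 (-s) x w \<in> ?A")
      case True
      have "inner_k n w (lincomb n 1 (-s) x w) = inner_k n w x - s * inner_k n w w"
        by (simp add: inner_k_def sum_subtractf sum_distrib_left algebra_simps)
      then have "inner_k n w x \<le> R + s * inner_k n w w" using True by (auto simp: abs_le_iff)
      then have "s * inner_k n w x \<le> s * (R + s * inner_k n w w)" using s by (intro mult_left_mono) auto
      also have "\<dots> \<le> 1 / r * (R + 1 / r * inner_k n w w)"
        using s R ww r by (intro mult_mono add_left_mono mult_right_mono add_nonneg_nonneg mult_nonneg_nonneg) auto
      finally have "s * inner_k n w x - s\<^sup>2 * inner_k n w w / 2 \<le> 1 / r * (R + 1 / r * inner_k n w w)"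
        using ww by (smt (verit) divide_nonneg_pos mult_nonneg_nonneg zero_le_power2)
      then have "tilt n (\<lambda>l. s * w l) x \<le> ?K" unfolding tilt_scaled by simp
      then show ?thesis using True gx by (simp add: mult_right_mono)
    next
      case False
      then show ?thesis using gx by simp
    qed
  qed
  finally show ?thesis by simp
qed

text \<open>The translation by \<open>w / r\<close> is cut into \<open>j + 1\<close> equal steps. On
  a slab each step costs \<open>o(1 / (j + 1))\<close> in \<open>L^1\<close>, so the sum tends to
  \<open>0\<close>, while the total increment does not depend on \<open>j\<close>.\<close>

lemma N_shift_AE:
  assumes i: "i < k"
  shows "AE x in gauss n. Nt (1 / r) x i = N x i"
proof -
  have wm[measurable]: "(\<lambda>x. inner_k n w x) \<in> borel_measurable (borel_vec n)" unfolding inner_k_def by measurable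
  have "AE x in gauss n. \<bar>inner_k n w x\<bar> \<le> real R \<longrightarrow> Nt (1 / r) x i = N x i" for R :: nat
  proof -
    let ?A = "{x \<in> space (borel_vec n). \<bar>inner_k n w x\<bar> \<le> real R}"
    have A[measurable]: "?A \<in> sets (borel_vec n)" by measurable
    let ?K = "exp (1 / r * (real R + 1 / r * inner_k n w w))"
    have bA: "bdd_meas n (\<lambda>x. indicator ?A x * \<bar>Nt (1 / r) x i - N x i\<bar>)"
      using Ntb Nb i bdd_meas_indicator[OF A] by (intro bdd_meas_mult bdd_meas_abs bdd_meas_diff) auto
    define I where "I = (\<integral>x. indicator ?A x * \<bar>Nt (1 / r) x i - N x i\<bar> \<partial>gauss n)"
    have absb: "bdd_meas n (\<lambda>x. \<bar>Nt t x i - Nt s x i\<bar>)" for s t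
      using Ntb i by (intro bdd_meas_abs bdd_meas_diff) auto
    have bI: "I \<le> ?K * sqrt ((F (1 / real (Suc j)) (1 / real (Suc j) / r) - F (1 / real (Suc j)) 0 - F 0 (1 / real (Suc j) / r) + F 0 0)
      / (1 / real (Suc j))\<^sup>2)" for j
    proof -
      define h where "h = 1 / real (Suc j)"
      have h: "h > 0" "real (Suc j) * h = 1" by (auto simp: h_def)
      let ?\<Delta> = "\<lambda>y. \<bar>Nt (h / r) y i - Nt 0 y i\<bar>"
      have step: "\<bar>Nt (real (Suc l) * h / r) x i - Nt (real l * h / r) x i\<bar> = ?\<Delta> (lincomb n 1 (real l * h / r) x w)" for l x
      proof -
        have "lincomb n 1 (h / r) (lincomb n 1 (real l * h / r) x w) w = lincomb n 1 (real (Suc l) * h / r) x w"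
          by (intro vec_eqI[of _ n]) (auto simp: algebra_simps add_divide_distrib)
        then show ?thesis by (simp add: Nt_def lincomb_1_0)
      qed
      have bs: "integrable (gauss n) (\<lambda>x. indicator ?A x * ?\<Delta> (lincomb n 1 (real l * h / r) x w))" for l
        using bdd_meas_indicator[OF A] bdd_meas_shift[OF absb] by (intro bdd_meas_integrable bdd_meas_mult) auto
      have "I \<le> (\<integral>x. (\<Sum>l<Suc j. indicator ?A x * ?\<Delta> (lincomb n 1 (real l * h / r) x w)) \<partial>gauss n)"
        unfolding I_def
      proof (rule integral_mono)
        show "integrable (gauss n) (\<lambda>x. indicator ?A x * \<bar>Nt (1 / r) x i - N x i\<bar>)" by (rule bdd_meas_integrable[OF bA])
        show "integrable (gauss n) (\<lambda>x. \<Sum>l<Suc j. indicator ?A x * ?\<Delta> (lincomb n 1 (real l * h / r) x w))"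
          by (intro Bochner_Integration.integrable_sum bs)
        fix x assume x: "x \<in> space (gauss n)"
        have N0: "N x i = Nt (real 0 * h / r) x i" using x by (simp add: Nt_def lincomb_1_0)
        have "Nt (1 / r) x i - N x i = (\<Sum>l<Suc j. Nt (real (Suc l) * h / r) x i - Nt (real l * h / r) x i)"
          using sum_lessThan_telescope[of "\<lambda>l. Nt (real l * h / r) x i" "Suc j"] unfolding N0 h(2) by (simp only:)
        then have "\<bar>Nt (1 / r) x i - N x i\<bar> \<le> (\<Sum>l<Suc j. \<bar>Nt (real (Suc l) * h / r) x i - Nt (real l * h / r) x i\<bar>)"
          by (simp only: sum_abs)
        then have "indicator ?A x * \<bar>Nt (1 / r) x i - N x i\<bar> \<le> indicator ?A x * (\<Sum>l<Suc j. ?\<Delta> (lincomb n 1 (real l * h / r) x w))"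
          unfolding step by (intro mult_left_mono) auto
        then show "indicator ?A x * \<bar>Nt (1 / r) x i - N x i\<bar> \<le> (\<Sum>l<Suc j. indicator ?A x * ?\<Delta> (lincomb n 1 (real l * h / r) x w))"
          by (simp only: sum_distrib_left)
      qed
      also have "\<dots> = (\<Sum>l<Suc j. \<integral>x. indicator ?A x * ?\<Delta> (lincomb n 1 (real l * h / r) x w) \<partial>gauss n)"
        by (rule Bochner_Integration.integral_sum) (rule bs)
      also have "\<dots> \<le> (\<Sum>l<Suc j. ?K * (\<integral>x. ?\<Delta> x \<partial>gauss n))"
      proof (rule sum_mono)
        fix l assume l: "l \<in> {..<Suc j}"
        have "real l * h \<le> real (Suc j) * h" using l h by (intro mult_right_mono) auto
        then have "real l * h / r \<le> 1 / r" using h(2) r by (intro divide_right_mono) auto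
        then show "(\<integral>x. indicator ?A x * ?\<Delta> (lincomb n 1 (real l * h / r) x w) \<partial>gauss n) \<le> ?K * (\<integral>x. ?\<Delta> x \<partial>gauss n)"
          using h(1) r by (intro localized_shift_bound[OF absb]) auto
      qed
      also have "\<dots> = real (Suc j) * (?K * (\<integral>x. ?\<Delta> x \<partial>gauss n))" by simp
      also have "(\<integral>x. ?\<Delta> x \<partial>gauss n) = (\<integral>x. \<bar>Nt (h / r) x i - N x i\<bar> \<partial>gauss n)"
        by (rule Bochner_Integration.integral_cong) (auto simp: Nt_def lincomb_1_0)
      also have "real (Suc j) * (?K * (\<integral>x. \<bar>Nt (h / r) x i - N x i\<bar> \<partial>gauss n))
          \<le> real (Suc j) * (?K * sqrt (F h (h / r) - F h 0 - F 0 (h / r) + F 0 0))"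
        using increment_L1[OF i, of h] by (intro mult_left_mono) auto
      also have "\<dots> = ?K * sqrt ((F h (h / r) - F h 0 - F 0 (h / r) + F 0 0) / h\<^sup>2)"
        using h by (simp add: real_sqrt_divide h_def)
      finally show ?thesis unfolding h_def .
    qed
    have "(\<lambda>j. ?K * sqrt ((F (1 / real (Suc j)) (1 / real (Suc j) / r) - F (1 / real (Suc j)) 0 - F 0 (1 / real (Suc j) / r) + F 0 0)
      / (1 / real (Suc j))\<^sup>2)) \<longlonglongrightarrow> ?K * sqrt 0"
      by (intro tendsto_intros stab_difference_small)
    then have "I \<le> ?K * sqrt 0" by (rule LIMSEQ_le_const) (use bI in auto)
    then have "I \<le> 0" by simp
    have nn: "AE x in gauss n. 0 \<le> indicator ?A x * \<bar>Nt (1 / r) x i - N x i\<bar>" by simp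
    have "I \<ge> 0" unfolding I_def by (rule integral_nonneg_AE[OF nn])
    with \<open>I \<le> 0\<close> have I0: "I = 0" by simp
    have "AE x in gauss n. indicator ?A x * \<bar>Nt (1 / r) x i - N x i\<bar> = 0"
      by (rule iffD1[OF integral_nonneg_eq_0_iff_AE[OF bdd_meas_integrable[OF bA] nn] I0[unfolded I_def]])
    then show ?thesis
    proof (rule AE_mp, intro AE_I2 impI)
      fix x assume "x \<in> space (gauss n)" "indicator ?A x * \<bar>Nt (1 / r) x i - N x i\<bar> = 0" "\<bar>inner_k n w x\<bar> \<le> real R"
      then show "Nt (1 / r) x i = N x i" by (simp add: indicator_def)
    qed
  qed
  then have "AE x in gauss n. \<forall>R::nat. \<bar>inner_k n w x\<bar> \<le> real R \<longrightarrow> Nt (1 / r) x i = N x i"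
    unfolding AE_all_countable by (rule allI)
  then show ?thesis
  proof eventually_elim
    case (elim x)
    obtain R :: nat where "\<bar>inner_k n w x\<bar> \<le> real R" using real_arch_simple by blast
    then show ?case using elim by blast
  qed
qed

text \<open>Invariance of \<open>N\<close> almost everywhere passes to \<open>u\<close> through
  \<open>u_cong\<close>. Applying the operator once more gives invariance of \<open>N\<close> at
  every point and stretches the translation by a second factor \<open>1 / r\<close>.\<close>

lemma N_shift_invariant:
  assumes i: "i < k"
  shows "N (lincomb n 1 (1 / r / r) x w) i = N x i"
proof -
  have "AE x in gauss n. \<forall>i\<in>{..<k}. Nt (1 / r) x i = N x i"
    using N_shift_AE by (intro AE_finite_allI) auto
  then have "AE x in gauss n. ut (1 / r) x i = u x i"
  proof eventually_elim
    case (elim x)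
    then have "u (lincomb n 1 (1 / r) x w) = u x" by (intro u_cong) (auto simp: Nt_def)
    then show ?case by (simp add: ut_def)
  qed
  then have "vou n r (ut (1 / r)) x i = vou n r u x i"
    unfolding vou_def using utb ub i bdd_meas_measurable by (intro ou_cong_AE r) auto
  then show ?thesis unfolding vou_ut vou_u Nt_def by simp
qed

end

section \<open>Dimension reduction\<close>

lemma sum_delta_mult: "i < (n::nat) \<Longrightarrow> (\<Sum>l<n. (if l = i then 1 else 0) * f l) = (f i :: real)"
proof -
  assume "i < n"
  have "(\<Sum>l<n. (if l = i then 1 else 0) * f l) = (\<Sum>l<n. if l = i then f l else 0)"
    by (intro sum.cong) auto
  then show ?thesis using \<open>i < n\<close> by simp
qed

text \<open>Rows of index at least \<open>k\<close> are orthogonal to all the vectors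
  \<open>v l\<close>, which makes the codimension bound concrete. The induction adds one Householder
  reflection per vector, acting only on later coordinates, so the zeros already produced
  survive.\<close>

lemma orthogonal_triangularization:
  fixes v :: "nat \<Rightarrow> nat \<Rightarrow> real"
  shows "k \<le> n \<Longrightarrow> \<exists>M. orthogonal_mat n M \<and> (\<forall>l<k. \<forall>i<n. l < i \<longrightarrow> (\<Sum>j<n. M i j * v l j) = 0)"
proof (induction k)
  case 0
  have "orthogonal_mat n (\<lambda>i j. if i = j then 1 else 0)"
    unfolding orthogonal_mat_def by (auto simp: sum_delta_mult)
  then show ?case by blast
next
  case (Suc k)
  then obtain M where M: "orthogonal_mat n M" and tri: "\<And>l i. l < k \<Longrightarrow> i < n \<Longrightarrow> l < i \<Longrightarrow> (\<Sum>j<n. M i j * v l j) = 0"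
    by auto
  have kn: "k < n" using Suc.prems by simp
  define y where "y i = (\<Sum>j<n. M i j * v k j)" for i
  define t where "t i = (if k \<le> i then y i else 0)" for i
  define s where "s = sqrt (\<Sum>i<n. (t i)\<^sup>2)"
  have s2: "(\<Sum>i<n. (t i)\<^sup>2) = s * s" unfolding s_def by (simp add: sum_nonneg)
  \<comment> \<open>The reflection orthogonal to \<open>p\<close> sends the tail \<open>t\<close> of
    the image of \<open>v k\<close> to \<open>s\<close> times the \<open>k\<close>-th unit vector,
    and it leaves coordinates before \<open>k\<close> alone. If \<open>p\<close> vanishes,
    \<open>M\<close> already has the required zeros.\<close>
  define p where "p i = t i - s * (if i = k then 1 else 0)" for i
  have tk: "(\<Sum>i<n. (if i = k then 1 else 0) * t i) = t k" by (rule sum_delta_mult[OF kn])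
  have pp: "(\<Sum>i<n. p i * p i) = 2 * (s * s - s * t k)"
  proof -
    have "(\<Sum>i<n. p i * p i) = (\<Sum>i<n. (t i)\<^sup>2 - 2 * s * ((if i = k then 1 else 0) * t i) + s * s * ((if i = k then 1 else 0) * 1))"
      by (intro sum.cong refl) (auto simp: p_def power2_eq_square algebra_simps)
    also have "\<dots> = s * s - 2 * s * t k + s * s"
      using kn by (simp only: sum.distrib sum_subtractf sum_distrib_left[symmetric] tk s2 sum_delta_mult)
    finally show ?thesis by simp
  qed
  have py: "(\<Sum>i<n. p i * y i) = s * s - s * t k"
  proof -
    have "(\<Sum>i<n. p i * y i) = (\<Sum>i<n. (t i)\<^sup>2 - s * ((if i = k then 1 else 0) * t i))"
      by (intro sum.cong refl) (auto simp: p_def t_def power2_eq_square algebra_simps)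
    also have "\<dots> = s * s - s * t k"
      by (simp only: sum_subtractf sum_distrib_left[symmetric] tk s2)
    finally show ?thesis .
  qed
  show ?case
  proof (cases "(\<Sum>i<n. p i * p i) = 0")
    case True
    then have "\<forall>i\<in>{..<n}. p i * p i = 0" by (subst (asm) sum_nonneg_eq_0_iff) auto
    then have p0: "p i = 0" if "i < n" for i using that by simp
    have "(\<Sum>j<n. M i j * v l j) = 0" if "l < Suc k" "i < n" "l < i" for l i
    proof (cases "l = k")
      case True
      then have "t i = 0" using p0[OF \<open>i < n\<close>] that by (simp add: p_def)
      then show ?thesis using True that by (simp add: t_def y_def)
    next
      case False
      then show ?thesis using that by (intro tri) auto
    qed
    then show ?thesis using M by blast
  next
    case False
    define c where "c = 2 / (\<Sum>i<n. p i * p i)"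
    have cpp: "c * (\<Sum>i<n. p i * p i) = 2" using False by (simp add: c_def)
    define q where "q j = (\<Sum>l<n. p l * M l j)" for j
    \<comment> \<open>\<open>M'\<close> is \<open>M\<close> followed by the reflection;
      \<open>q\<close> is the transpose of \<open>M\<close> applied to \<open>p\<close>.\<close>
    define M' where "M' i j = M i j - c * p i * q j" for i j
    have q_eq: "(\<Sum>l<n. M l j * p l) = q j" for j unfolding q_def by (simp add: mult.commute)
    have "orthogonal_mat n M'"
      unfolding orthogonal_mat_def
    proof (intro allI impI)
      fix i j assume ij: "i < n" "j < n"
      have "(\<Sum>l<n. M' l i * M' l j) = (\<Sum>l<n. M l i * M l j - c * q j * (M l i * p l) - c * q i * (M l j * p l) + c * c * q i * q j * (p l * p l))"
        by (intro sum.cong refl) (simp add: M'_def algebra_simps)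
      also have "\<dots> = (\<Sum>l<n. M l i * M l j) - c * q j * q i - c * q i * q j + c * c * q i * q j * (\<Sum>l<n. p l * p l)"
        by (simp only: sum.distrib sum_subtractf sum_distrib_left[symmetric] q_eq)
      also have "c * c * q i * q j * (\<Sum>l<n. p l * p l) = c * q i * q j * (c * (\<Sum>l<n. p l * p l))" by simp
      finally show "(\<Sum>l<n. M' l i * M' l j) = (if i = j then 1 else 0)"
        using M ij unfolding cpp orthogonal_mat_def by simp
    qed
    moreover have M'v: "(\<Sum>j<n. M' i j * v l j) = (\<Sum>j<n. M i j * v l j) - c * p i * (\<Sum>a<n. p a * (\<Sum>j<n. M a j * v l j))" for i l
    proof -
      have "(\<Sum>j<n. M' i j * v l j) = (\<Sum>j<n. M i j * v l j) - c * p i * (\<Sum>j<n. q j * v l j)"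
        by (simp add: M'_def left_diff_distrib sum_subtractf sum_distrib_left mult.assoc)
      also have "(\<Sum>j<n. q j * v l j) = (\<Sum>a<n. p a * (\<Sum>j<n. M a j * v l j))"
        unfolding q_def sum_distrib_right sum_distrib_left by (subst sum.swap) (simp add: mult.assoc)
      finally show ?thesis .
    qed
    have "(\<Sum>j<n. M' i j * v l j) = 0" if "l < Suc k" "i < n" "l < i" for l i
    proof (cases "l = k")
      case True
      have "2 * (c * (\<Sum>a<n. p a * y a)) = c * (\<Sum>i<n. p i * p i)" unfolding pp py by simp
      then have "c * (\<Sum>a<n. p a * y a) = 1" using cpp by simp
      then have "(\<Sum>j<n. M' i j * v l j) = y i - p i" unfolding M'v True y_def by (simp add: mult.commute mult.left_commute)
      then show ?thesis using True that by (simp add: p_def t_def)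
    next
      case False
      then have lk: "l < k" using that by simp
      have "(\<Sum>a<n. p a * (\<Sum>j<n. M a j * v l j)) = (\<Sum>a<n. 0)"
      proof (rule sum.cong)
        fix a assume a: "a \<in> {..<n}"
        show "p a * (\<Sum>j<n. M a j * v l j) = 0"
        proof (cases "k \<le> a")
          case True then show ?thesis using tri[OF lk, of a] a lk by simp
        next
          case False then show ?thesis by (simp add: p_def t_def)
        qed
      qed simp
      then show ?thesis unfolding M'v using tri[OF lk \<open>i < n\<close> \<open>l < i\<close>] by simp
    qed
    ultimately show ?thesis by blast
  qed
qed

text \<open>The maximizer \<open>u\<close> for \<open>T f\<close> has energy at most that of
  \<open>f\<close>. Positivity of the form on \<open>u - f\<close> then forces equality, and
  injectivity identifies the two almost everywhere. Taking \<open>h\<close> as \<open>u\<close>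
  after the embedding of the first \<open>k\<close> rotated coordinates gives its measurability and
  ball values directly.\<close>

lemma optimally_stable_factorization:
  assumes f: "optimally_stable n k r f" and kn: "k \<le> n" and r: "0 < r" "r < 1"
  shows "\<exists>M h. orthogonal_mat n M \<and> ball_valued k k h \<and> (AE x in gauss n. f x = h (proj_mat n k M x))"
proof -
  have fb: "ball_valued n k f" "mean_zero n k f" and
    fmax: "\<And>g. ball_valued n k g \<Longrightarrow> mean_zero n k g \<Longrightarrow> ip n k (vou n r g) g \<le> ip n k (vou n r f) f"
    using f unfolding optimally_stable_def by (auto simp: noise_stability_eq)
  note fv = ball_valued_vbdd[OF fb(1)]
  have Gb: "vbdd n k (vou n r f)" by (rule vbdd_vou[OF fv])
  obtain lam u where u: "ball_valued n k u" "mean_zero n k u"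
    "\<And>x. inner_k k (\<lambda>i. vou n r f x i - lam i) (u x) = vnorm k (\<lambda>i. vou n r f x i - lam i)"
    "\<And>x y. (\<And>i. i < k \<Longrightarrow> vou n r f x i = vou n r f y i) \<Longrightarrow> u x = u y"
  proof (rule dual_maximizer[of k n "vou n r f"])
    show "bdd_meas n (\<lambda>x. vou n r f x i)" if "i < k" for i using Gb that by simp
    fix lam u
    assume "ball_valued n k u" "mean_zero n k u"
      "\<And>x. inner_k k (\<lambda>i. vou n r f x i - lam i) (u x) = vnorm k (\<lambda>i. vou n r f x i - lam i)"
      "\<And>x y. (\<And>i. i < k \<Longrightarrow> vou n r f x i = vou n r f y i) \<Longrightarrow> u x = u y"
    then show thesis by (rule that)
  qed
  note uv = ball_valued_vbdd[OF u(1)]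
  have cross: "ip n k (vou n r f) f \<le> ip n k (vou n r f) u"
  proof -
    have "ip n k (vou n r f) f = ip n k (\<lambda>x i. vou n r f x i - lam i) f"
      using ip_diff_const[OF Gb fv fb(2)] by simp
    also have "\<dots> \<le> (\<integral>x. vnorm k (\<lambda>i. vou n r f x i - lam i) \<partial>gauss n)"
      by (rule ip_le_vnorm[OF vbdd_diff_const[OF Gb] fb(1)])
    also have "\<dots> = ip n k (\<lambda>x i. vou n r f x i - lam i) u" unfolding ip_def u(3) ..
    also have "\<dots> = ip n k (vou n r f) u" by (rule ip_diff_const[OF Gb uv u(2)])
    finally show ?thesis .
  qed
  let ?D = "\<lambda>x i. u x i - f x i"
  have Dv: "vbdd n k ?D" by (rule vbdd_diff[OF uv fv])
  have expand: "ip n k (vou n r ?D) ?D = ip n k (vou n r u) u - 2 * ip n k (vou n r f) u + ip n k (vou n r f) f"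
    using r by (intro ip_vou_diff uv fv) auto
  have nn: "0 \<le> ip n k (vou n r ?D) ?D" by (rule ip_vou_nonneg[OF Dv r])
  have Eu: "ip n k (vou n r u) u \<le> ip n k (vou n r f) f" by (rule fmax[OF u(1,2)])
  have D0: "ip n k (vou n r ?D) ?D = 0" using expand nn cross Eu by linarith
  have Euf: "ip n k (vou n r f) f \<le> ip n k (vou n r u) u" using expand nn cross by linarith
  have AEi: "AE x in gauss n. u x i = f x i" if i: "i < k" for i
  proof -
    have "(\<Sum>i<k. stab n r (\<lambda>x. ?D x i) (\<lambda>x. ?D x i)) = 0" using D0 ip_vou[OF Dv Dv, of r] by simp
    then have "\<forall>i\<in>{..<k}. stab n r (\<lambda>x. ?D x i) (\<lambda>x. ?D x i) = 0"
      using Dv r by (subst (asm) sum_nonneg_eq_0_iff) (auto intro: stab_nonneg)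
    then have "stab n r (\<lambda>x. ?D x i) (\<lambda>x. ?D x i) = 0" using i by simp
    then have "AE x in gauss n. ?D x i = 0" using Dv i r by (intro stab_eq_0_imp_AE) auto
    then show ?thesis by eventually_elim simp
  qed
  have AEu: "AE x in gauss n. f x = u x"
  proof -
    have "AE x in gauss n. \<forall>i\<in>{..<k}. u x i = f x i" using AEi by (intro AE_finite_allI) auto
    then show ?thesis
    proof (rule AE_mp, intro AE_I2 impI)
      fix x assume x: "x \<in> space (gauss n)" and eq: "\<forall>i\<in>{..<k}. u x i = f x i"
      have "f x \<in> vecs k" "u x \<in> vecs k"
        using measurable_space[of f "borel_vec n" "borel_vec k" x] measurable_space[of u "borel_vec n" "borel_vec k" x] fb(1) u(1) x
        unfolding ball_valued_def by auto
      then show "f x = u x" using eq by (intro vec_eqI[of _ k]) auto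
    qed
  qed
  \<comment> \<open>Equality almost everywhere of \<open>u\<close> and \<open>f\<close> becomes
    equality of their images at every point, so \<open>u\<close> is the pointwise maximizer for its
    own image, as the locale asks.\<close>
  have vou_eq: "vou n r f x i = vou n r u x i" if i: "i < k" for x i
    unfolding vou_def using AEi[OF i] uv fv i bdd_meas_measurable
    by (intro ou_cong_AE r) (auto elim: AE_mp)
  define N where "N = (\<lambda>x i. vou n r u x i - lam i)"
  interpret stable_maximizer n k r u lam N
  proof
    show "0 < r" "r < 1" "ball_valued n k u" "mean_zero n k u" "N = (\<lambda>x i. vou n r u x i - lam i)" by (fact r u N_def)+
    show "ip n k (vou n r g) g \<le> ip n k (vou n r u) u" if "ball_valued n k g" "mean_zero n k g" for g
      using fmax[OF that] Euf by linarith
    show "inner_k k (N x) (u x) = vnorm k (N x)" for x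
    proof -
      have "inner_k k (N x) (u x) = inner_k k (\<lambda>i. vou n r f x i - lam i) (u x)"
        unfolding inner_k_def N_def by (intro sum.cong refl) (simp add: vou_eq)
      also have "\<dots> = vnorm k (\<lambda>i. vou n r f x i - lam i)" by (rule u(3))
      also have "\<dots> = vnorm k (N x)" unfolding N_def by (intro vnorm_cong) (simp add: vou_eq)
      finally show ?thesis .
    qed
    show "u x = u y" if "\<And>i. i < k \<Longrightarrow> N x i = N y i" for x y
      by (rule u(4)) (use that in \<open>simp add: N_def vou_eq\<close>)
  qed
  \<comment> \<open>First moments of the coordinates of \<open>u\<close>. A direction satisfies
    \<open>ker\<close> exactly when it is orthogonal to these \<open>k\<close> vectors.\<close>
  define v where "v l j = (\<integral>x. u x l * x j \<partial>gauss n)" for l j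
  have iv: "integrable (gauss n) (\<lambda>x. u x l * x j)" if l: "l < k" and j: "j < n" for l j
  proof -
    let ?e = "\<lambda>i. if i = j then 1 else 0 :: real"
    have X: "inner_k n ?e x = x j" for x unfolding inner_k_def by (rule sum_delta_mult[OF j])
    have "integrable (gauss n) (\<lambda>x. u x l * inner_k n ?e x)"
    proof (rule second_order_expansion(1)[where C=1 and K=0, OF gauss.prob_space_axioms _ _ _ integrable_exp_inner])
      show "(\<lambda>x. u x l) \<in> borel_measurable (gauss n)" using uv l bdd_meas_measurable by auto
      show "(\<lambda>x. inner_k n ?e x) \<in> borel_measurable (gauss n)"
        unfolding X using j by (intro measurable_nth[where f="\<lambda>x. x" and n=n]) auto
      show "\<bar>u x l\<bar> \<le> 1" if "x \<in> space (gauss n)" for x using ball_valued_abs_le[OF u(1) l] that by simp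
    qed simp
    then show ?thesis unfolding X .
  qed
  obtain M where M: "orthogonal_mat n M" and tri: "\<And>l i. l < k \<Longrightarrow> i < n \<Longrightarrow> l < i \<Longrightarrow> (\<Sum>j<n. M i j * v l j) = 0"
    using orthogonal_triangularization[OF kn, of v] by blast
  define emb where "emb y = (\<lambda>j\<in>{..<n}. \<Sum>i<k. y i * M i j)" for y :: "nat \<Rightarrow> real"
  have embm: "emb \<in> measurable (borel_vec k) (borel_vec n)"
    unfolding emb_def by (intro measurable_restrict borel_measurable_sum borel_measurable_times measurable_nth[where f="\<lambda>x. x"]) auto
  have um: "u \<in> measurable (borel_vec n) (borel_vec k)" using u(1) by (simp add: ball_valued_def)
  have key: "u x = u (emb (proj_mat n k M x))" if x: "x \<in> vecs n" for x
  proof -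
    define z where "z i = (\<Sum>j<n. M i j * x j)" for i
    \<comment> \<open>The direction depends on the point \<open>x\<close>: it is
      \<open>- r^2\<close> times the component of \<open>x\<close> along the rows of index at least
      \<open>k\<close>. The factor \<open>r^2\<close> offsets the length \<open>1 / r^2\<close> of
      the invariant translation, which thus removes this component exactly.\<close>
    define w where "w j = - (r * r) * (\<Sum>i\<in>{k..<n}. z i * M i j)" for j
    interpret stable_direction n k r u lam N w
    proof
      fix l assume l: "l < k"
      have "(\<integral>x. u x l * inner_k n w x \<partial>gauss n) = (\<integral>x. (\<Sum>j<n. w j * (u x l * x j)) \<partial>gauss n)"
        by (intro Bochner_Integration.integral_cong refl) (simp add: inner_k_def sum_distrib_left mult_ac)
      also have "\<dots> = (\<Sum>j<n. w j * v l j)"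
        using iv[OF l] by (subst Bochner_Integration.integral_sum) (auto simp: v_def)
      also have "\<dots> = - (r * r) * (\<Sum>j<n. \<Sum>i\<in>{k..<n}. z i * (M i j * v l j))"
        by (simp add: w_def sum_distrib_left sum_distrib_right mult_ac)
      also have "(\<Sum>j<n. \<Sum>i\<in>{k..<n}. z i * (M i j * v l j)) = (\<Sum>i\<in>{k..<n}. z i * (\<Sum>j<n. M i j * v l j))"
        by (subst sum.swap) (simp add: sum_distrib_left)
      also have "\<dots> = (\<Sum>i\<in>{k..<n}. 0)"
        using tri[OF l] l by (intro sum.cong) auto
      finally show "(\<integral>x. u x l * inner_k n w x \<partial>gauss n) = 0" by simp
    qed
    have xz: "x j = (\<Sum>i<n. z i * M i j)" if j: "j < n" for j
    proof -
      have "(\<Sum>i<n. z i * M i j) = (\<Sum>a<n. (\<Sum>i<n. M i a * M i j) * x a)"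
        unfolding z_def sum_distrib_right by (subst sum.swap) (simp add: mult_ac)
      also have "\<dots> = (\<Sum>a<n. (if a = j then 1 else 0) * x a)"
        using M j unfolding orthogonal_mat_def by (intro sum.cong refl) simp
      also have "\<dots> = x j" by (rule sum_delta_mult[OF j])
      finally show ?thesis by simp
    qed
    have "lincomb n 1 (1 / r / r) x w = emb (proj_mat n k M x)"
    proof (rule vec_eqI[of _ n])
      fix j assume j: "j < n"
      have "lincomb n 1 (1 / r / r) x w j = x j - (\<Sum>i\<in>{k..<n}. z i * M i j)"
        using j r by (simp add: w_def)
      also have "x j = (\<Sum>i<k. z i * M i j) + (\<Sum>i\<in>{k..<n}. z i * M i j)"
        unfolding xz[OF j] using sum.atLeastLessThan_concat[of 0 k n "\<lambda>i. z i * M i j"] kn by (simp add: lessThan_atLeast0)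
      finally show "lincomb n 1 (1 / r / r) x w j = emb (proj_mat n k M x) j"
        using j by (simp add: emb_def proj_mat_def z_def)
    qed (auto simp: emb_def)
    then show ?thesis using N_shift_invariant[of _ x] by (intro u_cong) metis
  qed
  have "ball_valued k k (\<lambda>y. u (emb y))"
    unfolding ball_valued_def
  proof (intro conjI ballI)
    show "(\<lambda>y. u (emb y)) \<in> measurable (borel_vec k) (borel_vec k)" by (rule measurable_compose[OF embm um])
    show "inner_k k (u (emb y)) (u (emb y)) \<le> 1" for y by (rule u_le_1) (simp add: emb_def)
  qed
  moreover have "AE x in gauss n. f x = u (emb (proj_mat n k M x))"
    using AEu
  proof (rule AE_mp, intro AE_I2 impI)
    fix x assume "x \<in> space (gauss n)" "f x = u x"
    then show "f x = u (emb (proj_mat n k M x))" using key[of x] by simp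
  qed
  ultimately show ?thesis using M by blast
qed

theorem theorem5p1:
  shows "(\<forall>n k \<rho>. 1 \<le> n \<and> 1 \<le> k \<and> 0 \<le> \<rho> \<and> \<rho> \<le> 1 \<longrightarrow>
            (\<exists>f. optimally_stable n k \<rho> f))
       \<and> (\<forall>n k \<rho> f. 1 \<le> k \<and> k \<le> n \<and> 0 < \<rho> \<and> \<rho> < 1 \<and> optimally_stable n k \<rho> f \<longrightarrow>
            (\<exists>M h. orthogonal_mat n M \<and> ball_valued k k h \<and>
               (AE x in gauss n. f x = h (proj_mat n k M x))))"
proof (intro conjI allI impI)
  fix n k :: nat and \<rho> :: real assume *: "1 \<le> n \<and> 1 \<le> k \<and> 0 \<le> \<rho> \<and> \<rho> \<le> 1"
  then consider "\<rho> = 0" | "\<rho> = 1" | "0 < \<rho>" "\<rho> < 1" by linarith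
  then show "\<exists>f. optimally_stable n k \<rho> f"
    by cases (use * exists_optimally_stable_0 exists_optimally_stable_1 exists_optimally_stable_interior in auto)
next
  fix n k :: nat and \<rho> :: real and f
  assume "1 \<le> k \<and> k \<le> n \<and> 0 < \<rho> \<and> \<rho> < 1 \<and> optimally_stable n k \<rho> f"
  then show "\<exists>M h. orthogonal_mat n M \<and> ball_valued k k h \<and> (AE x in gauss n. f x = h (proj_mat n k M x))"
    by (intro optimally_stable_factorization) auto
qed

end
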